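(* Let $X$ be a separable complex Fréchet space whose topology is given by a countable system of norms $\{p_n\}_{n\in\mathbb{N}}$, and let $Y$ be a (complex) Banach space. Suppose that for every $n\in\mathbb{N}$ the normed space $X_n=(X,p_n)$ admits a separating $*$-polynomial. Let $f:X\to Y$ be a function for which there exists $k\in\mathbb{N}$ such that for every sequence $\{x_m\}$ of points which is Cauchy in $X_k=(X,p_k)$, the sequence $\{f(x_m)\}\subset Y$ is convergent. Then $f$ is approximated by $*$-analytic functions uniformly on all of $X$: for every $\varepsilon>0$ there is a $*$-analytic map $H:X\to Y$ such that $\|f(x)-H(x)\|<\varepsilon$ for all $x\in X$.
   Context: A Fréchet space is a locally convex topological vector space metrizable by a complete metric. "With a countable system of norms $\{p_n\}$" means that each $p_n$ is a norm on $X$, that the topology of $X$ is the weakest one for which all $p_n$ are continuous, and that the metric $\rho(x,y)=\sum_n 2^{-n}\frac{p_n(x-y)}{1+p_n(x-y)}$ is complete. $X_n=(X,p_n)$ is the vector space $X$ with the single norm $p_n$ (not necessarily complete). Let $X,Y$ be complex vector spaces. A map $B_n:X^n\to Y$ is $*$-$n$-linear if $B_n(x_1,\dots,x_n)=\sum_{k+m=n}c_{km}B_{km}(x_1,\dots,x_k,x_{k+1},\dots,x_{k+m})$, where each $B_{km}:X^{k+m}\to Y$ is linear in each of $x_1,\dots,x_k$ and antilinear (conjugate-linear) in each of $x_{k+1},\dots,x_{k+m}$, and $c_{km}\in\{0,1\}$. An $n$-homogeneous $*$-polynomial is a map $F_n:X\to Y$ of the form $F_n(x)=B_n(x,\dots,x)$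 with $B_n$ $*$-$n$-linear (for $n=0$, a constant); the zero map is allowed. A $*$-polynomial is a finite sum of homogeneous $*$-polynomials. A separating $*$-polynomial on a complex normed space $(Z,\|\cdot\|)$ is a continuous $*$-polynomial $P:Z\to\mathbb{C}$ such that $P(0)=0$ and $|P(z)|\ge 1$ for every $z\in Z$ with $\|z\|=1$. A map $F:X\to Y$ from a complex topological vector space $X$ to a complex normed space $Y$ is $*$-analytic if for every $x\in X$ there are a neighbourhood $V$ of $0$ in $X$ and continuous $n$-homogeneous $*$-polynomials $F_n:X\to Y$ ($n\ge 0$) such that $F(x+h)=\sum_{n=0}^\infty F_n(h)$ for $h\in V$, the series converging uniformly on $V$ in the norm of $Y$. *)

theory Defs
  imports "HOL-Analysis.Analysis"
begin

section \<open>Complex vector spaces\<close>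

text \<open>The distribution has type classes for real vector spaces only. As usual, a complex vector
  space carries the real structure obtained by restricting the scalars.\<close>

class complex_vector = real_vector +
  fixes scaleC :: "complex \<Rightarrow> 'a \<Rightarrow> 'a"  (infixr \<open>*\<^sub>C\<close> 75)
  assumes scaleC_add_right: "a *\<^sub>C (x + y) = a *\<^sub>C x + a *\<^sub>C y"
    and scaleC_add_left: "(a + b) *\<^sub>C x = a *\<^sub>C x + b *\<^sub>C x"
    and scaleC_scaleC: "a *\<^sub>C (b *\<^sub>C x) = (a * b) *\<^sub>C x"
    and scaleC_one: "1 *\<^sub>C x = x"
    and scaleR_scaleC: "r *\<^sub>R x = complex_of_real r *\<^sub>C x"

class complex_normed_vector = complex_vector + real_normed_vector +
  assumes norm_scaleC: "norm (a *\<^sub>C x) = cmod a * norm x"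

class complex_banach = complex_normed_vector + banach

instantiation complex :: complex_banach
begin

definition scaleC_complex :: "complex \<Rightarrow> complex \<Rightarrow> complex"
  where "scaleC_complex a x = a * x"

instance
  by standard
    (simp_all add: scaleC_complex_def algebra_simps norm_mult scaleR_conv_of_real)

end

lemma vector_space_scaleC: "vector_space (scaleC :: complex \<Rightarrow> 'a::complex_vector \<Rightarrow> 'a)"
  by standard (simp_all add: scaleC_add_right scaleC_add_left scaleC_scaleC scaleC_one)

definition antilinear :: "('a::complex_vector \<Rightarrow> 'b::complex_vector) \<Rightarrow> bool"
  where "antilinear g \<longleftrightarrow> Modules.additive g \<and> (\<forall>a x. g (a *\<^sub>C x) = cnj a *\<^sub>C g x)"


section \<open>\<open>*\<close>-polynomials\<close>

text \<open>An \<open>n\<close>-tuple of vectors is a list of length \<open>n\<close>; values at lists of any other length are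
  irrelevant.\<close>

definition mixed_multilinear ::
    "nat \<Rightarrow> nat \<Rightarrow> ('a::complex_vector list \<Rightarrow> 'b::complex_vector) \<Rightarrow> bool"
  where "mixed_multilinear k m B \<longleftrightarrow>
    (\<forall>xs. length xs = k + m \<longrightarrow>
      (\<forall>i<k. Vector_Spaces.linear scaleC scaleC (\<lambda>v. B (xs[i := v]))) \<and>
      (\<forall>i\<in>{k..<k + m}. antilinear (\<lambda>v. B (xs[i := v]))))"

definition star_multilinear ::
    "nat \<Rightarrow> ('a::complex_vector list \<Rightarrow> 'b::complex_vector) \<Rightarrow> bool"
  where "star_multilinear n B \<longleftrightarrow>
    (\<exists>c Bkm.
      (\<forall>k m. k + m = n \<longrightarrow> c k m \<in> {0, 1} \<and> mixed_multilinear k m (Bkm k m)) \<and>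
      (\<forall>xs. length xs = n \<longrightarrow> B xs = (\<Sum>(k, m)\<in>{(k, m). k + m = n}. c k m *\<^sub>C Bkm k m xs)))"

definition homogeneous_star_polynomial ::
    "nat \<Rightarrow> ('a::complex_vector \<Rightarrow> 'b::complex_vector) \<Rightarrow> bool"
  where "homogeneous_star_polynomial n F \<longleftrightarrow>
    (\<exists>B. star_multilinear n B \<and> (\<forall>x. F x = B (replicate n x)))"

definition star_polynomial :: "('a::complex_vector \<Rightarrow> 'b::complex_vector) \<Rightarrow> bool"
  where "star_polynomial P \<longleftrightarrow>
    (\<exists>(N::nat) F. (\<forall>i<N. \<exists>n. homogeneous_star_polynomial n (F i)) \<and>
      (\<forall>x. P x = (\<Sum>i<N. F i x)))"


section \<open>Norms and separating \<open>*\<close>-polynomials\<close>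

text \<open>The norms live on one common space, so they are functions rather than the type-class
  norm.\<close>

definition is_norm :: "('a::complex_vector \<Rightarrow> real) \<Rightarrow> bool"
  where "is_norm q \<longleftrightarrow>
    (\<forall>x. 0 \<le> q x) \<and> (\<forall>x. q x = 0 \<longleftrightarrow> x = 0) \<and>
    (\<forall>a x. q (a *\<^sub>C x) = cmod a * q x) \<and> (\<forall>x y. q (x + y) \<le> q x + q y)"

definition norm_dist :: "('a::complex_vector \<Rightarrow> real) \<Rightarrow> 'a \<Rightarrow> 'a \<Rightarrow> real"
  where "norm_dist q x y = q (x - y)"

definition norm_topology :: "('a::complex_vector \<Rightarrow> real) \<Rightarrow> 'a topology"
  where "norm_topology q = Metric_space.mtopology UNIV (norm_dist q)"

lemma is_norm_minus_commute:
  assumes "is_norm q" shows "q (x - y) = q (y - x)"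
proof -
  have "(- 1 :: complex) *\<^sub>C (y - x) = x - y"
    using scaleR_scaleC[of "- 1" "y - x"] by simp
  then have "q (x - y) = cmod (- 1) * q (y - x)"
    using assms unfolding is_norm_def by metis
  then show ?thesis by simp
qed

lemma Metric_space_norm_dist:
  assumes "is_norm q" shows "Metric_space UNIV (norm_dist q)"
proof
  show "0 \<le> norm_dist q x y" for x y
    using assms by (simp add: is_norm_def norm_dist_def)
  show "norm_dist q x y = norm_dist q y x" for x y
    unfolding norm_dist_def by (rule is_norm_minus_commute[OF assms])
  show "norm_dist q x y = 0 \<longleftrightarrow> x = y" for x y
    using assms by (simp add: is_norm_def norm_dist_def)
  show "norm_dist q x z \<le> norm_dist q x y + norm_dist q y z" for x y z
  proof -
    have "q ((x - y) + (y - z)) \<le> q (x - y) + q (y - z)"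
      using assms unfolding is_norm_def by blast
    then show ?thesis by (simp add: norm_dist_def)
  qed
qed

definition separating_star_polynomial ::
    "('a::complex_vector \<Rightarrow> real) \<Rightarrow> ('a \<Rightarrow> complex) \<Rightarrow> bool"
  where "separating_star_polynomial q P \<longleftrightarrow>
    star_polynomial P \<and> continuous_map (norm_topology q) euclidean P \<and>
    P 0 = 0 \<and> (\<forall>z. q z = 1 \<longrightarrow> 1 \<le> cmod (P z))"


section \<open>Frechet spaces\<close>

definition complex_vector_topology :: "'a::complex_vector topology \<Rightarrow> bool"
  where "complex_vector_topology T \<longleftrightarrow>
    topspace T = UNIV \<and>
    continuous_map (prod_topology T T) T (\<lambda>(x, y). x + y) \<and>
    continuous_map (prod_topology euclidean T) T (\<lambda>(a, x). a *\<^sub>C x)"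

definition frechet_topology :: "'a::complex_vector topology \<Rightarrow> bool"
  where "frechet_topology T \<longleftrightarrow>
    complex_vector_topology T \<and> neighbourhood_base_of convex T \<and> completely_metrizable_space T"

definition separable_topology :: "'a topology \<Rightarrow> bool"
  where "separable_topology T \<longleftrightarrow>
    (\<exists>D. countable D \<and> D \<subseteq> topspace T \<and> T closure_of D = topspace T)"

definition frechet_dist :: "(nat \<Rightarrow> 'a::complex_vector \<Rightarrow> real) \<Rightarrow> 'a \<Rightarrow> 'a \<Rightarrow> real"
  where "frechet_dist p x y = (\<Sum>n. (1 / 2) ^ n * (p n (x - y) / (1 + p n (x - y))))"

text \<open>``Weakest'' is meant among the vector topologies: the coarsest topology whatsoever making
  the functions \<open>p n\<close> continuous does not separate \<open>x\<close> from \<open>- x\<close>.\<close>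

definition topology_given_by_norms ::
    "'a::complex_vector topology \<Rightarrow> (nat \<Rightarrow> 'a \<Rightarrow> real) \<Rightarrow> bool"
  where "topology_given_by_norms T p \<longleftrightarrow>
    (\<forall>n. is_norm (p n)) \<and>
    (\<forall>n. continuous_map T euclidean (p n)) \<and>
    (\<forall>T'. complex_vector_topology T' \<and> (\<forall>n. continuous_map T' euclidean (p n)) \<longrightarrow>
      (\<forall>U. openin T U \<longrightarrow> openin T' U)) \<and>
    Metric_space.mcomplete UNIV (frechet_dist p)"

lemma Metric_space_frechet_dist:
  assumes p: "\<And>n. is_norm (p n)" shows "Metric_space UNIV (frechet_dist p)"
proof -
  define g where "g = (\<lambda>x y n. (1 / 2) ^ n * (p n (x - y) / (1 + p n (x - y))))"
  have pos: "0 \<le> p n x" for n x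
    using p unfolding is_norm_def by blast
  have g0: "0 \<le> g x y n" for x y n
    using pos by (simp add: g_def)
  have sm: "summable (g x y)" for x y
  proof (rule summable_comparison_test'[where N = 0])
    show "summable (\<lambda>n. (1 / 2 :: real) ^ n)" by simp
    show "norm (g x y n) \<le> (1 / 2) ^ n" for n
    proof -
      have "p n (x - y) / (1 + p n (x - y)) \<le> 1"
        using pos[of n "x - y"] by (simp add: divide_simps)
      then have "g x y n \<le> (1 / 2) ^ n * 1"
        unfolding g_def by (intro mult_left_mono) auto
      then show ?thesis using g0 by simp
    qed
  qed
  have d: "frechet_dist p x y = suminf (g x y)" for x y
    by (simp add: frechet_dist_def g_def)
  show ?thesis
  proof
    show "0 \<le> frechet_dist p x y" for x y
      unfolding d using sm g0 by (rule suminf_nonneg)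
    show "frechet_dist p x y = frechet_dist p y x" for x y
      unfolding frechet_dist_def by (simp only: is_norm_minus_commute[OF p, of _ x y])
    show "frechet_dist p x y = 0 \<longleftrightarrow> x = y" for x y
    proof -
      have "frechet_dist p x y = 0 \<longleftrightarrow> (\<forall>n. g x y n = 0)"
        unfolding d using sm g0 by (rule suminf_eq_zero_iff)
      also have "\<dots> \<longleftrightarrow> (\<forall>n. p n (x - y) = 0)"
      proof -
        have "g x y n = 0 \<longleftrightarrow> p n (x - y) = 0" for n
          using pos[of n "x - y"] by (simp add: g_def add_nonneg_eq_0_iff)
        then show ?thesis by simp
      qed
      also have "\<dots> \<longleftrightarrow> x = y"
        using p unfolding is_norm_def by auto
      finally show ?thesis .
    qed
    show "frechet_dist p x z \<le> frechet_dist p x y + frechet_dist p y z" for x y z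
    proof -
      have "g x z n \<le> g x y n + g y z n" for n
      proof -
        define a b c where "a = p n (x - y)" and "b = p n (y - z)" and "c = p n (x - z)"
        have abc: "0 \<le> a" "0 \<le> b" "0 \<le> c"
          using pos by (simp_all add: a_def b_def c_def)
        have "c \<le> a + b"
        proof -
          have "p n ((x - y) + (y - z)) \<le> p n (x - y) + p n (y - z)"
            using p[of n] unfolding is_norm_def by blast
          then show ?thesis by (simp add: a_def b_def c_def)
        qed
        then have "1 / (1 + (a + b)) \<le> 1 / (1 + c)"
          using abc by (intro divide_left_mono) auto
        moreover have "t / (1 + t) = 1 - 1 / (1 + t)" if "0 \<le> t" for t :: real
          using that by (simp add: divide_simps)
        ultimately have "c / (1 + c) \<le> (a + b) / (1 + (a + b))"
          using abc by simp
        also have "\<dots> = a / (1 + (a + b)) + b / (1 + (a + b))"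
          by (simp add: add_divide_distrib)
        also have "\<dots> \<le> a / (1 + a) + b / (1 + b)"
          using abc by (intro add_mono divide_left_mono) auto
        finally have "(1 / 2) ^ n * (c / (1 + c)) \<le> (1 / 2) ^ n * (a / (1 + a) + b / (1 + b))"
          by (intro mult_left_mono) auto
        then show ?thesis
          by (simp add: g_def a_def b_def c_def distrib_left)
      qed
      then show ?thesis
        unfolding d using sm by (subst suminf_add) (auto intro!: suminf_le summable_add)
    qed
  qed
qed


section \<open>\<open>*\<close>-analytic maps\<close>

definition star_analytic ::
    "'a::complex_vector topology \<Rightarrow> ('a \<Rightarrow> 'b::complex_normed_vector) \<Rightarrow> bool"
  where "star_analytic T F \<longleftrightarrow>
    (\<forall>x. \<exists>V Fn. 0 \<in> T interior_of V \<and>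
      (\<forall>n. homogeneous_star_polynomial n (Fn n) \<and> continuous_map T euclidean (Fn n)) \<and>
      uniform_limit V (\<lambda>N h. \<Sum>n<N. Fn n h) (\<lambda>h. F (x + h)) sequentially)"

end

theory Submission
  imports Defs "HOL-Computational_Algebra.Polynomial"
begin

text \<open>Only one of the norms matters: with \<open>q = p k\<close>, a function that sends \<open>q\<close>-Cauchy sequences to
  convergent ones is \<open>q\<close>-continuous, the space is \<open>q\<close>-separable, and whatever is analytic with respect
  to \<open>q\<close> is analytic for the finer Frechet topology. So let \<open>f\<close> be continuous on a separable normed
  space with a separating \<open>*\<close>-polynomial \<open>P\<close>.

  The obstacle is that a limit of analytic functions is analytic only if the power series converge
  with uniform control, so the approximant must be a series whose terms have summable \<^emph>\<open>majorants\<close>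
  near every point. The majorant used here is the weighted \<open>l\<^sup>1\<close> norm of an expansion into bounded
  multilinear forms (\<open>germ\<close>). Germs form a Banach algebra: they are closed under products,
  absolutely convergent sums, exponentials and geometric series, and a map with a germ at every
  point is \<open>*\<close>-analytic (\<open>star_analytic_of_germs\<close>). Forms are kept real multilinear for this purpose;
  they are split into linear and antilinear slots once, at the end
  (\<open>homogeneous_star_polynomial_of_real_multilinear\<close>). The homogeneous components of the merely
  continuous \<open>P\<close> enter the algebra by polarization (\<open>monomial_of_bound\<close>).

  The sum \<open>Q\<close> of the squared moduli of the homogeneous components of \<open>P\<close> is a nonnegative polynomial
  whose sublevel sets are a base of neighbourhoods of \<open>0\<close>. By separability there are points \<open>x\<^sub>j\<close>,
  levels \<open>\<sigma> j\<close> and values \<open>v j\<close> such that, for suitable positive multiples \<open>u j\<close> of \<open>Q (x - x\<^sub>j)\<close>, the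
  sets \<open>{u j < \<sigma> j}\<close> cover the space and \<open>f\<close> is close to \<open>v j\<close> on \<open>{u j < 4 * \<sigma> j}\<close>. The scaling
  makes the germs of \<open>u j\<close> square summable in \<open>j\<close>, so that \<open>x \<mapsto> (u j x)\<^sub>j\<close> is locally a controlled
  analytic map into \<open>l\<^sup>2\<close>.

  The approximant is \<open>(\<Sum> w\<^sub>k v\<^sub>k) / (\<Sum> w\<^sub>k)\<close> with Gaussian weights
  \<open>w\<^sub>k = c\<^sub>k exp (\<kappa>\<^sub>k (r\<^sub>k\<^sup>2 - \<Sum>j\<le>n. (u j x - y j)\<^sup>2))\<close>. The centres \<open>y\<close> run through a grid in the part
  \<open>y j \<ge> 2 \<sigma> j\<close> for \<open>j < n\<close>, \<open>y n \<le> 3 \<sigma> n\<close> of \<open>(n+1)\<close>-space, for every \<open>n\<close>. This choice replaces a locally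
  finite partition: if \<open>u m x < \<sigma> m\<close>, then every centre with \<open>n > m\<close> is at distance at least \<open>\<sigma> m\<close>
  from \<open>x\<close>, and only finitely many centres with \<open>n \<le> m\<close> are near. A Gaussian is good here because a
  perturbation of size \<open>\<tau>\<close> of the coordinates changes the exponent by at most
  \<open>\<kappa> (d\<^sup>2 / 2 + 3 \<tau>\<^sup>2)\<close>, which the negative term \<open>- \<kappa> d\<^sup>2\<close> absorbs uniformly in \<open>\<kappa>\<close>; so the \<open>\<kappa>\<^sub>k\<close> may grow as
  fast as summability demands (\<open>local_majorants\<close>). At each point some weight of a cell near the point
  is at least \<open>c\<^sub>k\<close> (\<open>dominant_cell\<close>) while the cells on which \<open>f\<close> is far from \<open>v\<^sub>k\<close> have negligible
  total weight (\<open>weighted_error\<close>).\<close>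

section \<open>Extracting coefficients of a polynomial curve\<close>

text \<open>The functional \<open>c\<close> depends on \<open>n\<close> and \<open>j\<close> only; this is what turns bounds on the values of
  a vector-valued polynomial into bounds on its coefficients. It consists of the \<open>j\<close>-th coefficients of
  the Lagrange polynomials of the nodes \<open>0, \<dots>, n\<close>.\<close>

lemma coefficient_from_values:
  assumes "j \<le> n"
  shows "\<exists>c::nat \<Rightarrow> real. \<forall>A :: nat \<Rightarrow> 'v::real_vector.
    (\<Sum>l\<le>n. c l *\<^sub>R (\<Sum>i\<le>n. real l ^ i *\<^sub>R A i)) = A j"
proof -
  define L :: "nat \<Rightarrow> real poly" where
    "L l = (\<Prod>i\<in>{..n} - {l}. smult (1 / (real l - real i)) [:- real i, 1:])" for l
  have L_at: "poly (L l) (real m) = (if l = m then 1 else 0)" if "l \<le> n" "m \<le> n" for l m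
  proof (cases "l = m")
    case True
    have "poly (L l) (real m) = (\<Prod>i\<in>{..n} - {l}. 1)"
      unfolding L_def poly_prod
    proof (rule prod.cong[OF refl])
      fix i assume "i \<in> {..n} - {l}"
      then have "real m - real i \<noteq> 0" using True by auto
      then show "poly (smult (1 / (real l - real i)) [:- real i, 1:]) (real m) = 1"
        using True by (simp flip: diff_divide_distrib)
    qed
    then show ?thesis using True by simp
  next
    case False
    then show ?thesis
      unfolding L_def poly_prod using that by (auto intro!: bexI[of _ m])
  qed
  have L_deg: "degree (L l) \<le> n" if "l \<le> n" for l
  proof -
    have "degree (L l) \<le> (\<Sum>i\<in>{..n} - {l}. 1)"
      unfolding L_def
      by (rule order_trans[OF degree_prod_sum_le]) (auto intro!: sum_mono)
    also have "\<dots> = n" using that by simp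
    finally show ?thesis .
  qed
  have monom: "monom 1 i = (\<Sum>l\<le>n. smult (real l ^ i) (L l))" if "i \<le> n" for i
  proof (rule poly_eqI_degree[of "real ` {..n}"])
    have card: "card (real ` {..n}) = Suc n"
      by (subst card_image) auto
    show "degree (monom (1::real) i) < card (real ` {..n})"
      using that card by (simp add: degree_monom_eq)
    have "degree (\<Sum>l\<le>n. smult (real l ^ i) (L l)) \<le> n"
      by (rule degree_sum_le) (auto intro: order_trans[OF degree_smult_le] L_deg)
    then show "degree (\<Sum>l\<le>n. smult (real l ^ i) (L l)) < card (real ` {..n})"
      using card by simp
    fix t assume "t \<in> real ` {..n}"
    then obtain m where m: "m \<le> n" "t = real m" by auto
    have "(\<Sum>l\<le>n. real l ^ i * poly (L l) (real m)) = (\<Sum>l\<le>n. if l = m then real m ^ i else 0)"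
      by (rule sum.cong) (auto simp: L_at m)
    then show "poly (monom 1 i) t = poly (\<Sum>l\<le>n. smult (real l ^ i) (L l)) t"
      using m by (simp add: poly_monom poly_sum)
  qed
  have dual: "(\<Sum>l\<le>n. coeff (L l) j * real l ^ i) = (if i = j then 1 else 0)" if "i \<le> n" for i
    using arg_cong[OF monom[OF that], of "\<lambda>p. coeff p j"]
    by (simp add: coeff_sum mult.commute)
  show ?thesis
  proof (intro exI allI)
    fix A :: "nat \<Rightarrow> 'v"
    have "(\<Sum>l\<le>n. coeff (L l) j *\<^sub>R (\<Sum>i\<le>n. real l ^ i *\<^sub>R A i))
        = (\<Sum>i\<le>n. (\<Sum>l\<le>n. coeff (L l) j * real l ^ i) *\<^sub>R A i)"
      by (simp add: scaleR_sum_right scaleR_sum_left) (rule sum.swap)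
    also have "\<dots> = (\<Sum>i\<le>n. if i = j then A i else 0)"
      by (rule sum.cong) (auto simp: dual)
    finally show "(\<Sum>l\<le>n. coeff (L l) j *\<^sub>R (\<Sum>i\<le>n. real l ^ i *\<^sub>R A i)) = A j"
      using assms by simp
  qed
qed

section \<open>Real multilinear forms on lists\<close>

text \<open>Over the reals linear and antilinear slots have the same status, so that the product of two
  forms is given by concatenation of the argument lists.\<close>

definition real_multilinear :: "nat \<Rightarrow> ('a::real_vector list \<Rightarrow> 'b::real_vector) \<Rightarrow> bool" where
  "real_multilinear n B \<longleftrightarrow>
    (\<forall>xs i. length xs = n \<longrightarrow> i < n \<longrightarrow> linear (\<lambda>v. B (xs[i := v])))"

lemma real_multilinear_slot:
  assumes "real_multilinear n B" "length xs + length ys + 1 = n"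
  shows "linear (\<lambda>v. B (xs @ v # ys))"
proof -
  have "length (xs @ 0 # ys) = n" "length xs < n" using assms(2) by auto
  then have "linear (\<lambda>v. B ((xs @ 0 # ys)[length xs := v]))"
    using assms(1) unfolding real_multilinear_def by blast
  then show ?thesis by (simp add: list_update_append)
qed

lemma real_multilinearI:
  assumes "\<And>xs ys. length xs + length ys + 1 = n \<Longrightarrow> linear (\<lambda>v. B (xs @ v # ys))"
  shows "real_multilinear n B"
  unfolding real_multilinear_def
proof (intro allI impI)
  fix xs :: "'a list" and i assume "length xs = n" "i < n"
  then show "linear (\<lambda>v. B (xs[i := v]))"
    using assms[of "take i xs" "drop (Suc i) xs"] by (simp add: upd_conv_take_nth_drop)
qed

lemma real_multilinear_Suc:
  "real_multilinear (Suc n) B \<longleftrightarrow>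
    (\<forall>ys. length ys = n \<longrightarrow> linear (\<lambda>v. B (v # ys))) \<and>
    (\<forall>v. real_multilinear n (\<lambda>ys. B (v # ys)))"
proof (intro iffI conjI allI impI)
  assume B: "real_multilinear (Suc n) B"
  show "linear (\<lambda>v. B (v # ys))" if "length ys = n" for ys
    using real_multilinear_slot[OF B, of "[]" ys] that by simp
  show "real_multilinear n (\<lambda>ys. B (v # ys))" for v
  proof (rule real_multilinearI)
    fix xs ys :: "'a list" assume "length xs + length ys + 1 = n"
    then show "linear (\<lambda>w. B (v # xs @ w # ys))"
      using real_multilinear_slot[OF B, of "v # xs" ys] by simp
  qed
next
  assume *: "(\<forall>ys. length ys = n \<longrightarrow> linear (\<lambda>v. B (v # ys))) \<and>
    (\<forall>v. real_multilinear n (\<lambda>ys. B (v # ys)))"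
  show "real_multilinear (Suc n) B"
  proof (rule real_multilinearI)
    fix xs ys :: "'a list" assume l: "length xs + length ys + 1 = Suc n"
    show "linear (\<lambda>v. B (xs @ v # ys))"
    proof (cases xs)
      case Nil then show ?thesis using * l by simp
    next
      case (Cons u us)
      have "real_multilinear n (\<lambda>ys. B (u # ys))" using * by blast
      from real_multilinear_slot[OF this, of us ys] show ?thesis using l Cons by simp
    qed
  qed
qed

lemma real_multilinear_0 [simp]: "real_multilinear 0 B"
  by (simp add: real_multilinear_def)

lemma real_multilinear_compose:
  assumes "real_multilinear n B" "linear g"
  shows "real_multilinear n (\<lambda>xs. g (B xs))"
  using assms unfolding real_multilinear_def by (auto intro: linear_compose[unfolded o_def])

lemma real_multilinear_sum:
  assumes "\<And>i. i \<in> I \<Longrightarrow> real_multilinear n (B i)"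
  shows "real_multilinear n (\<lambda>xs. \<Sum>i\<in>I. B i xs)"
  using assms unfolding real_multilinear_def by (auto intro: linear_compose_sum)

lemma real_multilinear_insert:
  assumes B: "real_multilinear (Suc n) B" and "m \<le> n"
  shows "real_multilinear n (\<lambda>ys. B (take m ys @ v # drop m ys))"
proof (rule real_multilinearI)
  fix xs ys :: "'a list" assume l: "length xs + length ys + 1 = n"
  show "linear (\<lambda>w. B (take m (xs @ w # ys) @ v # drop m (xs @ w # ys)))"
  proof (cases "m \<le> length xs")
    case True
    then show ?thesis
      using real_multilinear_slot[OF B, of "take m xs @ v # drop m xs" ys] l by simp
  next
    case False
    then obtain k where k: "m = length xs + Suc k" 
      by (metis less_imp_Suc_add not_le add_Suc_right)
    then show ?thesis
      using real_multilinear_slot[OF B, of xs "take k ys @ v # drop k ys"] l by simp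
  qed
qed

lemma real_multilinear_insert_linear:
  assumes "real_multilinear (Suc n) B" "length ys = n" "m \<le> n"
  shows "linear (\<lambda>v. B (take m ys @ v # drop m ys))"
  using real_multilinear_slot[OF assms(1), of "take m ys" "drop m ys"] assms by simp

lemma real_multilinear_scaled:
  assumes "real_multilinear n B"
  shows "B (replicate n (t *\<^sub>R x)) = t ^ n *\<^sub>R B (replicate n x)"
  using assms
proof (induction n arbitrary: B)
  case (Suc n)
  have "linear (\<lambda>v. B (v # replicate n (t *\<^sub>R x)))"
    using Suc.prems unfolding real_multilinear_Suc by simp
  from linear_scale[OF this, of t x]
  have "B (replicate (Suc n) (t *\<^sub>R x)) = t *\<^sub>R B (x # replicate n (t *\<^sub>R x))"
    by simp
  also have "B (x # replicate n (t *\<^sub>R x)) = t ^ n *\<^sub>R B (x # replicate n x)"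
    using Suc.IH[of "\<lambda>ys. B (x # ys)"] Suc.prems unfolding real_multilinear_Suc by blast
  finally show ?case by simp
qed simp

section \<open>Symmetrization: from the diagonal to a bounded form\<close>

text \<open>On the diagonal this is the derivative of \<open>x \<mapsto> B (x, \<dots>, x)\<close> in the direction \<open>v\<close>.\<close>

definition insertions :: "nat \<Rightarrow> ('a list \<Rightarrow> 'b::real_vector) \<Rightarrow> 'a \<Rightarrow> 'a list \<Rightarrow> 'b" where
  "insertions n B v ys = (\<Sum>i\<le>n. B (take i ys @ v # drop i ys))"

text \<open>The polar form of \<open>x \<mapsto> B (x, \<dots>, x)\<close>, obtained by iterating directional derivatives. In
  contrast to \<open>B\<close> itself it is determined by the diagonal, hence bounded if the diagonal is.\<close>

primrec symmetrized :: "nat \<Rightarrow> ('a list \<Rightarrow> 'b::real_vector) \<Rightarrow> 'a list \<Rightarrow> 'b" where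
  "symmetrized 0 B xs = B []"
| "symmetrized (Suc n) B xs = (1 / real (Suc n)) *\<^sub>R symmetrized n (insertions n B (hd xs)) (tl xs)"

lemma real_multilinear_insertions:
  "real_multilinear (Suc n) B \<Longrightarrow> real_multilinear n (insertions n B v)"
  unfolding insertions_def by (intro real_multilinear_sum real_multilinear_insert) auto

lemma insertions_linear:
  "real_multilinear (Suc n) B \<Longrightarrow> length ys = n \<Longrightarrow> linear (\<lambda>v. insertions n B v ys)"
  unfolding insertions_def by (intro linear_compose_sum) (auto intro: real_multilinear_insert_linear)

lemma symmetrized_cong:
  assumes "\<And>xs. length xs = n \<Longrightarrow> B xs = C xs" "length ys = n"
  shows "symmetrized n B ys = symmetrized n C ys"
  using assms
proof (induction n arbitrary: B C ys)
  case (Suc n)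
  have "symmetrized n (insertions n B (hd ys)) (tl ys) = symmetrized n (insertions n C (hd ys)) (tl ys)"
    using Suc.prems by (intro Suc.IH) (auto simp: insertions_def intro!: sum.cong)
  then show ?case by simp
qed simp

lemma symmetrized_add: "symmetrized n (\<lambda>xs. B xs + C xs) ys = symmetrized n B ys + symmetrized n C ys"
proof (induction n arbitrary: B C ys)
  case (Suc n)
  have "insertions n (\<lambda>xs. B xs + C xs) v = (\<lambda>xs. insertions n B v xs + insertions n C v xs)" for v
    by (auto simp: insertions_def sum.distrib)
  then show ?case by (simp add: Suc scaleR_add_right)
qed simp

lemma symmetrized_scaleR: "symmetrized n (\<lambda>xs. c *\<^sub>R B xs) ys = c *\<^sub>R symmetrized n B ys"
proof (induction n arbitrary: B ys)
  case (Suc n)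
  have "insertions n (\<lambda>xs. c *\<^sub>R B xs) v = (\<lambda>xs. c *\<^sub>R insertions n B v xs)" for v
    by (auto simp: insertions_def scaleR_sum_right)
  then show ?case by (simp add: Suc)
qed simp

lemma real_multilinear_symmetrized:
  "real_multilinear n B \<Longrightarrow> real_multilinear n (symmetrized n B)"
proof (induction n arbitrary: B)
  case (Suc n)
  have "linear (\<lambda>v. symmetrized n (insertions n B v) ys)" if l: "length ys = n" for ys
  proof (rule linearI)
    note lin = insertions_linear[OF Suc.prems]
    fix v w and c :: real
    have "symmetrized n (insertions n B (v + w)) ys
        = symmetrized n (\<lambda>zs. insertions n B v zs + insertions n B w zs) ys"
      using l by (intro symmetrized_cong linear_add[OF lin])
    then show "symmetrized n (insertions n B (v + w)) ys
        = symmetrized n (insertions n B v) ys + symmetrized n (insertions n B w) ys"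
      by (simp add: symmetrized_add)
    have "symmetrized n (insertions n B (c *\<^sub>R v)) ys
        = symmetrized n (\<lambda>zs. c *\<^sub>R insertions n B v zs) ys"
      using l by (intro symmetrized_cong linear_scale[OF lin])
    then show "symmetrized n (insertions n B (c *\<^sub>R v)) ys = c *\<^sub>R symmetrized n (insertions n B v) ys"
      by (simp add: symmetrized_scaleR)
  qed
  moreover have "real_multilinear n (symmetrized n (insertions n B v))" for v
    using Suc.IH real_multilinear_insertions[OF Suc.prems] by blast
  ultimately show ?case
    unfolding real_multilinear_Suc
    by (auto intro!: linear_compose_scale_right real_multilinear_compose[where g = "\<lambda>y. _ *\<^sub>R y"] linear_id[unfolded id_def])
qed simp

lemma insertions_diagonal:
  "insertions n B v (replicate n x) = (\<Sum>i\<le>n. B (replicate i x @ v # replicate (n - i) x))"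
  unfolding insertions_def by (intro sum.cong) (auto simp: min_def)

lemma symmetrized_diagonal:
  "real_multilinear n B \<Longrightarrow> symmetrized n B (replicate n x) = B (replicate n x)"
proof (induction n arbitrary: B)
  case (Suc n)
  have "replicate i x @ x # replicate (n - i) x = x # replicate n x" if "i \<le> n" for i
    using that by (simp add: replicate_app_Cons_same flip: replicate_add)
  then have "insertions n B x (replicate n x) = real (Suc n) *\<^sub>R B (x # replicate n x)"
    unfolding insertions_diagonal by (simp add: sum_constant_scaleR)
  moreover have "symmetrized n (insertions n B x) (replicate n x) = insertions n B x (replicate n x)"
    using Suc.IH real_multilinear_insertions[OF Suc.prems] by blast
  ultimately show ?case by simp
qed simp

text \<open>The form \<open>B\<close> need not be symmetric; the coefficient of \<open>t\<close> is still the sum over all slots in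
  which \<open>v\<close> can stand.\<close>

lemma diagonal_along_line:
  assumes "real_multilinear n B"
  shows "\<exists>A. (\<forall>t. B (replicate n (x + t *\<^sub>R v)) = (\<Sum>j\<le>n. t ^ j *\<^sub>R A j)) \<and>
    A 0 = B (replicate n x) \<and>
    (0 < n \<longrightarrow> A 1 = (\<Sum>i<n. B (replicate i x @ v # replicate (n - 1 - i) x)))"
  using assms
proof (induction n arbitrary: B)
  case 0
  show ?case by (intro exI[of _ "\<lambda>_. B []"]) simp
next
  case (Suc n)
  have ml: "real_multilinear n (\<lambda>ys. B (u # ys))" for u
    using Suc.prems unfolding real_multilinear_Suc by blast
  obtain Ax where Ax: "\<And>t. B (x # replicate n (x + t *\<^sub>R v)) = (\<Sum>j\<le>n. t ^ j *\<^sub>R Ax j)"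
    "Ax 0 = B (x # replicate n x)"
    "0 < n \<Longrightarrow> Ax 1 = (\<Sum>i<n. B (x # replicate i x @ v # replicate (n - 1 - i) x))"
    using Suc.IH[OF ml[of x]] by auto
  obtain Av where Av: "\<And>t. B (v # replicate n (x + t *\<^sub>R v)) = (\<Sum>j\<le>n. t ^ j *\<^sub>R Av j)"
    "Av 0 = B (v # replicate n x)"
    using Suc.IH[OF ml[of v]] by auto
  define A where "A j = (if j \<le> n then Ax j else 0) + (case j of 0 \<Rightarrow> 0 | Suc i \<Rightarrow> Av i)" for j
  have "B (replicate (Suc n) (x + t *\<^sub>R v)) = (\<Sum>j\<le>Suc n. t ^ j *\<^sub>R A j)" for t
  proof -
    have "linear (\<lambda>u. B (u # replicate n (x + t *\<^sub>R v)))"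
      using Suc.prems unfolding real_multilinear_Suc by simp
    from linear_add[OF this, of x "t *\<^sub>R v"] linear_scale[OF this, of t v]
    have "B (replicate (Suc n) (x + t *\<^sub>R v))
      = B (x # replicate n (x + t *\<^sub>R v)) + t *\<^sub>R B (v # replicate n (x + t *\<^sub>R v))"
      by simp
    also have "\<dots> = (\<Sum>j\<le>n. t ^ j *\<^sub>R Ax j) + (\<Sum>j\<le>n. t ^ Suc j *\<^sub>R Av j)"
      unfolding Ax Av by (simp add: scaleR_sum_right)
    also have "(\<Sum>j\<le>n. t ^ Suc j *\<^sub>R Av j)
        = (\<Sum>j\<le>Suc n. t ^ j *\<^sub>R (case j of 0 \<Rightarrow> 0 | Suc i \<Rightarrow> Av i))"
      by (subst sum.atMost_Suc_shift) simp
    also have "(\<Sum>j\<le>n. t ^ j *\<^sub>R Ax j) = (\<Sum>j\<le>Suc n. t ^ j *\<^sub>R (if j \<le> n then Ax j else 0))"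
      by simp
    finally show ?thesis
      by (simp only: A_def scaleR_add_right sum.distrib)
  qed
  moreover have "A 0 = B (replicate (Suc n) x)"
    by (simp add: A_def Ax)
  moreover have "A 1 = (\<Sum>i<Suc n. B (replicate i x @ v # replicate (Suc n - 1 - i) x))"
    by (subst sum.lessThan_Suc_shift) (cases "n = 0"; simp add: A_def Av Ax(3)[simplified])
  ultimately show ?case by blast
qed

section \<open>Splitting real multilinear forms into linear and antilinear slots\<close>

lemma scaleC_minus_one: "(- 1) *\<^sub>C x = - (x :: 'a::complex_vector)"
  using scaleR_scaleC[of "- 1" x] by simp

lemma linear_scaleC: "linear (\<lambda>x :: 'a::complex_vector. c *\<^sub>C x)"
proof (rule linearI)
  fix x y :: 'a and r :: real
  show "c *\<^sub>C (x + y) = c *\<^sub>C x + c *\<^sub>C y" by (rule scaleC_add_right)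
  show "c *\<^sub>C (r *\<^sub>R x) = r *\<^sub>R (c *\<^sub>C x)"
    by (simp add: scaleR_scaleC scaleC_scaleC mult.commute)
qed

lemma scaleC_decompose: "a *\<^sub>C x = Re a *\<^sub>R x + Im a *\<^sub>R (\<i> *\<^sub>C (x :: 'a::complex_vector))"
proof -
  have "a = complex_of_real (Re a) + complex_of_real (Im a) * \<i>"
    by (simp add: complex_eq_iff)
  then have "a *\<^sub>C x = (complex_of_real (Re a) + complex_of_real (Im a) * \<i>) *\<^sub>C x"
    by (rule arg_cong)
  then show ?thesis
    by (simp only: scaleC_add_left scaleR_scaleC scaleC_scaleC)
qed

lemma linear_of_slot:
  assumes "Vector_Spaces.linear scaleC scaleC (g :: 'a::complex_vector \<Rightarrow> 'b::complex_vector)"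
  shows "linear g"
proof (rule linearI)
  show "g (x + y) = g x + g y" for x y
    using assms by (simp add: Vector_Spaces.linear_iff)
  show "g (r *\<^sub>R x) = r *\<^sub>R g x" for r x
    using assms by (simp add: Vector_Spaces.linear_iff scaleR_scaleC)
qed

lemma linear_of_antilinear: "antilinear g \<Longrightarrow> linear g"
  unfolding antilinear_def by (auto intro!: linearI simp: Modules.additive_def scaleR_scaleC)

text \<open>A real linear map is complex linear for \<open>s = \<i>\<close> and antilinear for \<open>s = - \<i>\<close>.\<close>

definition twisted_linear :: "complex \<Rightarrow> ('a::complex_vector \<Rightarrow> 'b::complex_vector) \<Rightarrow> bool" where
  "twisted_linear s g \<longleftrightarrow> linear g \<and> (\<forall>x. g (\<i> *\<^sub>C x) = s *\<^sub>C g x)"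

lemma twisted_linear_i:
  assumes "twisted_linear \<i> g"
  shows "Vector_Spaces.linear scaleC scaleC g"
proof -
  have lin: "linear g" and i: "\<And>x. g (\<i> *\<^sub>C x) = \<i> *\<^sub>C g x"
    using assms unfolding twisted_linear_def by auto
  have "g (a *\<^sub>C x) = a *\<^sub>C g x" for a x
    unfolding scaleC_decompose[of a] by (simp only: linear_add[OF lin] linear_scale[OF lin] i)
  then show ?thesis
    by (simp add: Vector_Spaces.linear_iff vector_space_scaleC linear_add[OF lin])
qed

lemma twisted_linear_minus_i:
  assumes "twisted_linear (- \<i>) g"
  shows "antilinear g"
proof -
  have lin: "linear g" and i: "\<And>x. g (\<i> *\<^sub>C x) = (- \<i>) *\<^sub>C g x"
    using assms unfolding twisted_linear_def by auto
  have neg: "(- \<i>) *\<^sub>C y = - (\<i> *\<^sub>C y)" for y :: 'b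
    using scaleC_scaleC[of "-1" \<i> y] by (simp add: scaleC_minus_one)
  have "g (a *\<^sub>C x) = cnj a *\<^sub>C g x" for a x
    unfolding scaleC_decompose[of a] scaleC_decompose[of "cnj a"]
    by (simp only: linear_add[OF lin] linear_scale[OF lin] i neg) simp
  then show ?thesis
    by (simp add: antilinear_def Modules.additive_def linear_add[OF lin])
qed

text \<open>For \<open>s = \<plusminus> \<i>\<close> this is the projection of the first slot onto its \<open>s\<close>-twisted part.\<close>

definition twisted_part ::
    "complex \<Rightarrow> ('a::complex_vector list \<Rightarrow> 'b::complex_vector) \<Rightarrow> 'a \<Rightarrow> 'a list \<Rightarrow> 'b" where
  "twisted_part s B u ys = (1/2) *\<^sub>R (B (u # ys) - s *\<^sub>C B ((\<i> *\<^sub>C u) # ys))"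

lemma twisted_linear_twisted_part:
  assumes B: "real_multilinear (Suc n) B" and "length ys = n" and s: "s * s = - 1"
  shows "twisted_linear s (\<lambda>u. twisted_part s B u ys)"
  unfolding twisted_linear_def
proof
  have lin: "linear (\<lambda>u. B (u # ys))"
    using assms unfolding real_multilinear_Suc by blast
  have "linear (\<lambda>u. s *\<^sub>C B ((\<i> *\<^sub>C u) # ys))"
    using linear_compose[OF linear_compose[OF linear_scaleC[of \<i>] lin] linear_scaleC[of s]]
    by (simp add: o_def)
  then show "linear (\<lambda>u. twisted_part s B u ys)"
    unfolding twisted_part_def by (intro linear_compose_scale_right linear_compose_sub lin)
  show "\<forall>u. twisted_part s B (\<i> *\<^sub>C u) ys = s *\<^sub>C twisted_part s B u ys"
  proof
    fix u
    have 1: "B ((\<i> *\<^sub>C \<i> *\<^sub>C u) # ys) = - B (u # ys)"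
      using linear_neg[OF lin, of u] by (simp add: scaleC_scaleC scaleC_minus_one)
    have 2: "s *\<^sub>C s *\<^sub>C y = - y" for y :: 'b
      by (simp add: scaleC_scaleC s scaleC_minus_one)
    show "twisted_part s B (\<i> *\<^sub>C u) ys = s *\<^sub>C twisted_part s B u ys"
      unfolding twisted_part_def 1
      by (simp add: linear_scale[OF linear_scaleC] linear_diff[OF linear_scaleC]
          linear_neg[OF linear_scaleC] 2)
  qed
qed

lemma real_multilinear_twisted_part:
  assumes "real_multilinear (Suc n) B"
  shows "real_multilinear n (twisted_part s B u)"
proof -
  have "real_multilinear n (\<lambda>ys. B (v # ys))" for v
    using assms unfolding real_multilinear_Suc by blast
  then show ?thesis
    unfolding real_multilinear_def twisted_part_def
    by (auto intro!: linear_compose_scale_right linear_compose_sub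
        linear_compose[OF _ linear_scaleC, unfolded o_def])
qed

lemma twisted_parts_add:
  fixes B :: "'a::complex_vector list \<Rightarrow> 'b::complex_vector"
  shows "twisted_part \<i> B u ys + twisted_part (- \<i>) B u ys = B (u # ys)"
proof -
  have neg: "(- \<i>) *\<^sub>C y = - (\<i> *\<^sub>C y)" for y :: 'b
    using scaleC_scaleC[of "-1" \<i> y] by (simp add: scaleC_minus_one)
  show ?thesis
    unfolding twisted_part_def neg by (simp flip: scaleR_add_right add: scaleR_half_double)
qed

text \<open>The sum, over all ways of merging the lists \<open>us\<close> and \<open>vs\<close> into one argument list, of the part of \<open>B\<close>
  that is linear in the slots filled from \<open>us\<close> and antilinear in those filled from \<open>vs\<close>. Merging
  avoids permutations of slots: on the diagonal every choice of linear slots occurs exactly once.\<close>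

fun type_component ::
    "('a::complex_vector list \<Rightarrow> 'b::complex_vector) \<Rightarrow> 'a list \<Rightarrow> 'a list \<Rightarrow> 'b" where
  "type_component B [] [] = B []"
| "type_component B (u # us) [] = type_component (twisted_part \<i> B u) us []"
| "type_component B [] (v # vs) = type_component (twisted_part (- \<i>) B v) [] vs"
| "type_component B (u # us) (v # vs) =
    type_component (twisted_part \<i> B u) us (v # vs) +
    type_component (twisted_part (- \<i>) B v) (u # us) vs"

lemma type_component_cong:
  assumes "\<And>xs. length xs = length us + length vs \<Longrightarrow> B xs = C xs"
  shows "type_component B us vs = type_component C us vs"
  using assms
proof (induction B us vs arbitrary: C rule: type_component.induct)
  case (2 B u us)
  have "type_component (twisted_part \<i> B u) us [] = type_component (twisted_part \<i> C u) us []"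
    by (rule 2) (simp add: twisted_part_def 2)
  then show ?case by simp
next
  case (3 B v vs)
  have "type_component (twisted_part (- \<i>) B v) [] vs = type_component (twisted_part (- \<i>) C v) [] vs"
    by (rule 3) (simp add: twisted_part_def 3)
  then show ?case by simp
next
  case (4 B u us v vs)
  have "type_component (twisted_part \<i> B u) us (v # vs) = type_component (twisted_part \<i> C u) us (v # vs)"
    by (rule 4) (simp add: twisted_part_def 4)
  moreover have "type_component (twisted_part (- \<i>) B v) (u # us) vs
      = type_component (twisted_part (- \<i>) C v) (u # us) vs"
    by (rule 4) (simp add: twisted_part_def 4)
  ultimately show ?case by simp
qed simp

lemma twisted_part_apply_linear:
  assumes "linear (g :: 'b::complex_vector \<Rightarrow> 'c::complex_vector)" "\<And>y. g (s *\<^sub>C y) = s *\<^sub>C g y"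
  shows "twisted_part s (\<lambda>xs. g (B xs)) u = (\<lambda>ys. g (twisted_part s B u ys))"
  using assms by (simp add: fun_eq_iff twisted_part_def linear_scale linear_diff)

lemma type_component_add:
  fixes B :: "'a::complex_vector list \<Rightarrow> 'b::complex_vector"
  shows "type_component (\<lambda>xs. B xs + C xs) us vs = type_component B us vs + type_component C us vs"
proof -
  have *: "twisted_part s (\<lambda>xs. B xs + C xs) u = (\<lambda>ys. twisted_part s B u ys + twisted_part s C u ys)"
    for s u and B C :: "'a list \<Rightarrow> 'b"
    by (simp add: fun_eq_iff twisted_part_def scaleC_add_right algebra_simps)
  show ?thesis
    by (induction B us vs arbitrary: C rule: type_component.induct) (simp_all add: *)
qed

lemma type_component_scaleC:
  fixes B :: "'a::complex_vector list \<Rightarrow> 'b::complex_vector"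
  shows "type_component (\<lambda>xs. a *\<^sub>C B xs) us vs = a *\<^sub>C type_component B us vs"
proof -
  have *: "twisted_part s (\<lambda>xs. a *\<^sub>C B xs) u = (\<lambda>ys. a *\<^sub>C twisted_part s B u ys)"
    for s u and B :: "'a list \<Rightarrow> 'b"
    by (rule twisted_part_apply_linear[OF linear_scaleC]) (simp add: scaleC_scaleC mult.commute)
  show ?thesis
    by (induction B us vs rule: type_component.induct) (simp_all add: * scaleC_add_right)
qed

lemma twisted_linear_add:
  "twisted_linear s g \<Longrightarrow> twisted_linear s h \<Longrightarrow> twisted_linear s (\<lambda>x. g x + h x)"
  by (auto simp: twisted_linear_def scaleC_add_right intro: linear_compose_add)

lemma twisted_linear_type_component:
  assumes "\<And>ys. length ys = length us + length vs \<Longrightarrow> twisted_linear s (\<lambda>w. G w ys)"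
  shows "twisted_linear s (\<lambda>w. type_component (G w) us vs)"
  unfolding twisted_linear_def
proof (intro conjI allI linearI)
  note lin = assms[unfolded twisted_linear_def, THEN conjunct1]
  have lin': "linear (\<lambda>w. G w ys)" if "length ys = length us + length vs" for ys
    using lin that by blast
  fix x y and r :: real
  show "type_component (G (x + y)) us vs = type_component (G x) us vs + type_component (G y) us vs"
    unfolding type_component_add[symmetric]
    by (intro type_component_cong linear_add[OF lin'])
  show "type_component (G (r *\<^sub>R x)) us vs = r *\<^sub>R type_component (G x) us vs"
    unfolding scaleR_scaleC type_component_scaleC[symmetric]
    unfolding scaleR_scaleC[symmetric]
    by (intro type_component_cong linear_scale[OF lin'])
  show "type_component (G (\<i> *\<^sub>C x)) us vs = s *\<^sub>C type_component (G x) us vs"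
    unfolding type_component_scaleC[symmetric]
    using assms by (intro type_component_cong) (auto simp: twisted_linear_def)
qed

lemma type_component_slots:
  assumes "real_multilinear (length us + length vs) B"
  shows "i < length us \<Longrightarrow> twisted_linear \<i> (\<lambda>w. type_component B (us[i := w]) vs)"
    and "i < length vs \<Longrightarrow> twisted_linear (- \<i>) (\<lambda>w. type_component B us (vs[i := w]))"
proof -
  have ii: "\<i> * \<i> = - 1" "(- \<i>) * (- \<i>) = - 1" by auto
  have "(\<forall>i < length us. twisted_linear \<i> (\<lambda>w. type_component B (us[i := w]) vs)) \<and>
    (\<forall>i < length vs. twisted_linear (- \<i>) (\<lambda>w. type_component B us (vs[i := w])))"
    using assms
  proof (induction B us vs rule: type_component.induct)
    case (1 B) then show ?case by simp
  next
    case (2 B u us)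
    have B: "real_multilinear (Suc (length us)) B" using 2 by simp
    show ?case
    proof (intro conjI allI impI)
      fix i assume i: "i < length (u # us)"
      show "twisted_linear \<i> (\<lambda>w. type_component B ((u # us)[i := w]) [])"
      proof (cases i)
        case 0
        then show ?thesis
          using twisted_linear_type_component[of us "[]", OF twisted_linear_twisted_part[OF B _ ii(1)]]
          by simp
      next
        case (Suc j)
        then show ?thesis
          using 2 i real_multilinear_twisted_part[OF B] by simp
      qed
    qed simp
  next
    case (3 B v vs)
    have B: "real_multilinear (Suc (length vs)) B" using 3 by simp
    show ?case
    proof (intro conjI allI impI)
      fix i assume i: "i < length (v # vs)"
      show "twisted_linear (- \<i>) (\<lambda>w. type_component B [] ((v # vs)[i := w]))"
      proof (cases i)
        case 0
        then show ?thesis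
          using twisted_linear_type_component[of "[]" vs, OF twisted_linear_twisted_part[OF B _ ii(2)]]
          by simp
      next
        case (Suc j)
        then show ?thesis
          using 3 i real_multilinear_twisted_part[OF B] by simp
      qed
    qed simp
  next
    case (4 B u us v vs)
    have B: "real_multilinear (Suc (length us + length (v # vs))) B"
      "real_multilinear (Suc (length (u # us) + length vs)) B" using 4 by simp_all
    note IH1 = "4.IH"(1)[OF real_multilinear_twisted_part[OF B(1)]]
    note IH2 = "4.IH"(2)[OF real_multilinear_twisted_part[OF B(2)]]
    show ?case
    proof (intro conjI allI impI)
      fix i assume i: "i < length (u # us)"
      have "twisted_linear \<i> (\<lambda>w. type_component (twisted_part (- \<i>) B v) ((u # us)[i := w]) vs)"
        using IH2 i by blast
      moreover have "twisted_linear \<i> (\<lambda>w. case (u # us)[i := w] of u' # us' \<Rightarrow>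
          type_component (twisted_part \<i> B u') us' (v # vs))"
      proof (cases i)
        case 0
        then show ?thesis
          using twisted_linear_type_component[of us "v # vs",
              OF twisted_linear_twisted_part[OF B(1) _ ii(1)]] by simp
      next
        case (Suc j)
        then show ?thesis using IH1 i by simp
      qed
      ultimately show "twisted_linear \<i> (\<lambda>w. type_component B ((u # us)[i := w]) (v # vs))"
        by (cases i) (auto dest: twisted_linear_add simp: add.commute)
    next
      fix i assume i: "i < length (v # vs)"
      have "twisted_linear (- \<i>) (\<lambda>w. type_component (twisted_part \<i> B u) us ((v # vs)[i := w]))"
        using IH1 i by blast
      moreover have "twisted_linear (- \<i>) (\<lambda>w. case (v # vs)[i := w] of v' # vs' \<Rightarrow>
          type_component (twisted_part (- \<i>) B v') (u # us) vs')"
      proof (cases i)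
        case 0
        then show ?thesis
          using twisted_linear_type_component[of "u # us" vs,
              OF twisted_linear_twisted_part[OF B(2) _ ii(2)]] by simp
      next
        case (Suc j)
        then show ?thesis using IH2 i by simp
      qed
      ultimately show "twisted_linear (- \<i>) (\<lambda>w. type_component B (u # us) ((v # vs)[i := w]))"
        by (cases i) (auto dest: twisted_linear_add)
    qed
  qed
  then show "i < length us \<Longrightarrow> twisted_linear \<i> (\<lambda>w. type_component B (us[i := w]) vs)"
    and "i < length vs \<Longrightarrow> twisted_linear (- \<i>) (\<lambda>w. type_component B us (vs[i := w]))"
    by blast+
qed

text \<open>The recursion in the length is that of Pascal's triangle: the first slot is either linear or
  antilinear, and its two parts add up to \<open>B\<close>.\<close>

lemma type_component_diagonal:
  "(\<Sum>k\<le>n. type_component B (replicate k x) (replicate (n - k) x)) = B (replicate n x)"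
proof (induction n arbitrary: B)
  case (Suc n)
  define L where "L k = (if k = 0 then 0 else
    type_component (twisted_part \<i> B x) (replicate (k - 1) x) (replicate (Suc n - k) x))" for k
  define R where "R k = (if k = Suc n then 0 else
    type_component (twisted_part (- \<i>) B x) (replicate k x) (replicate (n - k) x))" for k
  have "type_component B (replicate k x) (replicate (Suc n - k) x) = L k + R k" if "k \<le> Suc n" for k
  proof -
    have "k = 0 \<or> k = Suc n \<or> (\<exists>j. k = Suc j \<and> j < n)"
      using that by (cases k) auto
    then consider "k = 0" | "k = Suc n" | j where "k = Suc j" "j < n"
      by blast
    then show ?thesis
    proof cases
      case 3
      then have "Suc n - k = Suc (n - k)" by auto
      with 3 show ?thesis by (auto simp: L_def R_def)
    qed (auto simp: L_def R_def)
  qed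
  then have "(\<Sum>k\<le>Suc n. type_component B (replicate k x) (replicate (Suc n - k) x))
      = (\<Sum>k\<le>Suc n. L k) + (\<Sum>k\<le>Suc n. R k)"
    by (simp add: sum.distrib del: sum.atMost_Suc)
  also have "(\<Sum>k\<le>Suc n. L k)
      = (\<Sum>k\<le>n. type_component (twisted_part \<i> B x) (replicate k x) (replicate (n - k) x))"
    by (subst sum.atMost_Suc_shift) (simp add: L_def)
  also have "(\<Sum>k\<le>Suc n. R k)
      = (\<Sum>k\<le>n. type_component (twisted_part (- \<i>) B x) (replicate k x) (replicate (n - k) x))"
    by (simp add: R_def)
  finally show ?case
    unfolding Suc by (simp add: twisted_parts_add)
qed simp

lemma pairs_with_sum: "{(k, m). k + m = n} = (\<lambda>k. (k, n - k)) ` {..n :: nat}"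
  by (auto simp: image_iff)

theorem homogeneous_star_polynomial_of_real_multilinear:
  fixes B :: "'a::complex_vector list \<Rightarrow> 'b::complex_vector"
  assumes B: "real_multilinear n B"
  shows "homogeneous_star_polynomial n (\<lambda>x. B (replicate n x))"
proof -
  define C where "C k m xs = type_component B (take k xs) (drop k xs)" for k m :: nat and xs
  have mixed: "mixed_multilinear k m (C k m)" if km: "k + m = n" for k m
    unfolding mixed_multilinear_def
  proof (intro allI impI conjI ballI)
    fix xs :: "'a list" assume l: "length xs = k + m"
    then have ml: "real_multilinear (length (take k xs) + length (drop k xs)) B"
      using B km by simp
    show "Vector_Spaces.linear scaleC scaleC (\<lambda>v. C k m (xs[i := v]))" if "i < k" for i
      using type_component_slots(1)[OF ml, of i] that l
      by (simp add: C_def twisted_linear_i take_update_swap)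
    show "antilinear (\<lambda>v. C k m (xs[i := v]))" if "i \<in> {k..<k + m}" for i
      using type_component_slots(2)[OF ml, of "i - k"] that l
      by (auto simp: C_def twisted_linear_minus_i drop_update_swap)
  qed
  define B' where "B' xs = (\<Sum>(k, m)\<in>{(k, m). k + m = n}. C k m xs)" for xs
  have "star_multilinear n B'"
    unfolding star_multilinear_def
    by (rule exI[of _ "\<lambda>_ _. 1"], rule exI[of _ C]) (auto simp: mixed B'_def scaleC_one)
  moreover have "B (replicate n x) = B' (replicate n x)" for x
  proof -
    have "B' (replicate n x) = (\<Sum>k\<le>n. C k (n - k) (replicate n x))"
      unfolding B'_def pairs_with_sum by (subst sum.reindex) (auto simp: inj_on_def)
    also have "\<dots> = (\<Sum>k\<le>n. type_component B (replicate k x) (replicate (n - k) x))"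
      by (rule sum.cong) (auto simp: C_def min_def)
    finally show ?thesis by (simp add: type_component_diagonal)
  qed
  ultimately show ?thesis
    unfolding homogeneous_star_polynomial_def by auto
qed

theorem real_multilinear_of_homogeneous_star_polynomial:
  assumes "homogeneous_star_polynomial n F"
  shows "\<exists>B. real_multilinear n B \<and> (\<forall>x. F x = B (replicate n x))"
proof -
  obtain B c C where F: "\<And>x. F x = B (replicate n x)"
    and C: "\<And>k m. k + m = n \<Longrightarrow> mixed_multilinear k m (C k m)"
    and B: "\<And>xs. length xs = n \<Longrightarrow> B xs = (\<Sum>(k, m)\<in>{(k, m). k + m = n}. c k m *\<^sub>C C k m xs)"
    using assms unfolding homogeneous_star_polynomial_def star_multilinear_def by blast
  have "real_multilinear n (C k m)" if "k + m = n" for k m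
    unfolding real_multilinear_def
  proof (intro allI impI)
    fix xs :: "'a list" and i assume "length xs = n" "i < n"
    then show "linear (\<lambda>v. C k m (xs[i := v]))"
      using C[OF that] that unfolding mixed_multilinear_def
      by (cases "i < k") (auto intro: linear_of_slot linear_of_antilinear)
  qed
  then have "real_multilinear n (\<lambda>xs. \<Sum>(k, m)\<in>{(k, m). k + m = n}. c k m *\<^sub>C C k m xs)"
    by (intro real_multilinear_sum) (auto intro: real_multilinear_compose linear_scaleC)
  then show ?thesis
    using B F by (intro exI[of _ "\<lambda>xs. \<Sum>(k, m)\<in>{(k, m). k + m = n}. c k m *\<^sub>C C k m xs"]) simp
qed

section \<open>Bounded monomials\<close>

lemma has_sum_fibres:
  fixes f :: "'i \<Rightarrow> 'a::{topological_comm_monoid_add, t3_space}"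
  assumes "(f has_sum S) I" "\<And>n. (f has_sum g n) {i \<in> I. d i = n}"
  shows "(g has_sum S) UNIV"
proof -
  have inj: "inj_on (\<lambda>i. (d i, i)) I" by (auto simp: inj_on_def)
  have "(\<lambda>i. (d i, i)) ` I = Sigma UNIV (\<lambda>n. {i \<in> I. d i = n})" by auto
  moreover have "((\<lambda>(n, i). f i) has_sum S) ((\<lambda>i. (d i, i)) ` I)"
    using assms(1) by (subst has_sum_reindex[OF inj]) (simp add: o_def)
  ultimately have "((\<lambda>(n, i). f i) has_sum S) (Sigma UNIV (\<lambda>n. {i \<in> I. d i = n}))"
    by metis
  then show ?thesis
    by (rule has_sum_SigmaD) (simp add: assms(2))
qed

lemma has_sum_product_real:
  fixes a :: "'i \<Rightarrow> real" and b :: "'j \<Rightarrow> real"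
  assumes a: "(a has_sum s) I" and b: "(b has_sum t) J"
    and "\<And>i. i \<in> I \<Longrightarrow> 0 \<le> a i" "\<And>j. j \<in> J \<Longrightarrow> 0 \<le> b j"
  shows "((\<lambda>(i, j). a i * b j) has_sum (s * t)) (I \<times> J)"
proof (rule has_sum_SigmaI)
  show inner: "((\<lambda>j. case (i, j) of (i, j) \<Rightarrow> a i * b j) has_sum (a i * t)) J" for i
    using has_sum_cmult_right[OF b] by simp
  show outer: "((\<lambda>i. a i * t) has_sum (s * t)) I"
    by (rule has_sum_cmult_left[OF a])
  show "(\<lambda>(i, j). a i * b j) summable_on I \<times> J"
    by (rule summable_on_SigmaI[OF inner]) (use outer assms in \<open>auto simp: has_sum_imp_summable\<close>)
qed

lemma bounded_linear_scaleC_right: "bounded_linear (\<lambda>y :: 'a::complex_normed_vector. a *\<^sub>C y)"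
  using linear_scaleC[of a]
  by (auto intro!: bounded_linear_intro[of _ "cmod a"]
      simp: linear_add linear_scale norm_scaleC mult.commute dest: linear_scale linear_add)

lemma bounded_linear_scaleC_left: "bounded_linear (\<lambda>a. a *\<^sub>C (y :: 'a::complex_normed_vector))"
  by (rule bounded_linear_intro[of _ "norm y"])
    (auto simp: scaleC_add_left norm_scaleC scaleR_scaleC[of _ y] scaleR_scaleC[of _ "_ *\<^sub>C y"]
      scaleC_scaleC scaleR_conv_of_real)

lemma has_sum_product_scaleC:
  fixes f :: "'i \<Rightarrow> complex" and g :: "'j \<Rightarrow> 'a::complex_banach"
  assumes f: "(f has_sum s) I" and g: "(g has_sum t) J"
    and "(\<lambda>i. norm (f i)) summable_on I" "(\<lambda>j. norm (g j)) summable_on J"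
  shows "((\<lambda>(i, j). f i *\<^sub>C g j) has_sum (s *\<^sub>C t)) (I \<times> J)"
proof (rule has_sum_SigmaI)
  show "((\<lambda>j. case (i, j) of (i, j) \<Rightarrow> f i *\<^sub>C g j) has_sum (f i *\<^sub>C t)) J" for i
    using has_sum_bounded_linear[OF bounded_linear_scaleC_right g] by simp
  show "((\<lambda>i. f i *\<^sub>C t) has_sum (s *\<^sub>C t)) I"
    by (rule has_sum_bounded_linear[OF bounded_linear_scaleC_left f])
  have "(\<lambda>(i, j). norm (f i) * norm (g j)) summable_on I \<times> J"
    using has_sum_product_real[OF has_sum_infsum[OF assms(3)] has_sum_infsum[OF assms(4)]]
    by (auto simp: has_sum_imp_summable)
  then have "(\<lambda>ij. norm ((\<lambda>(i, j). f i *\<^sub>C g j) ij)) summable_on I \<times> J"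
    by (simp add: case_prod_unfold norm_scaleC)
  then show "(\<lambda>(i, j). f i *\<^sub>C g j) summable_on I \<times> J"
    by (rule abs_summable_summable)
qed

locale normed_by =
  fixes q :: "'x::complex_vector \<Rightarrow> real"
  assumes is_norm: "is_norm q"
begin

lemma q_nonneg [simp]: "0 \<le> q x"
  and q_zero_iff: "q x = 0 \<longleftrightarrow> x = 0"
  and q_scaleC: "q (a *\<^sub>C x) = cmod a * q x"
  and q_triangle: "q (x + y) \<le> q x + q y"
  using is_norm unfolding is_norm_def by auto

lemma q_0 [simp]: "q 0 = 0"
  by (simp add: q_zero_iff)

lemma q_scaleR: "q (r *\<^sub>R x) = \<bar>r\<bar> * q x"
  by (simp add: scaleR_scaleC q_scaleC)

lemma q_minus [simp]: "q (- x) = q x"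
  using q_scaleR[of "- 1" x] by simp

lemma q_minus_commute: "q (x - y) = q (y - x)"
  using q_minus[of "x - y"] by simp

lemma q_triangle_diff: "q (x - z) \<le> q (x - y) + q (y - z)"
  using q_triangle[of "x - y" "y - z"] by simp

lemma prod_list_q_nonneg [simp]: "0 \<le> prod_list (map q xs)"
  by (induction xs) auto

definition bounded_multilinear :: "nat \<Rightarrow> real \<Rightarrow> ('x list \<Rightarrow> 'y::complex_normed_vector) \<Rightarrow> bool" where
  "bounded_multilinear n b B \<longleftrightarrow> real_multilinear n B \<and>
    (\<forall>xs. length xs = n \<longrightarrow> norm (B xs) \<le> b * prod_list (map q xs))"

text \<open>The number \<open>b\<close> bounds a multilinear form, not only its diagonal, so that infinite sums of
  monomials with summable bounds converge as forms.\<close>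

definition monomial :: "nat \<Rightarrow> real \<Rightarrow> ('x \<Rightarrow> 'y::complex_normed_vector) \<Rightarrow> bool" where
  "monomial n b E \<longleftrightarrow> 0 \<le> b \<and> (\<exists>B. bounded_multilinear n b B \<and> (\<forall>x. E x = B (replicate n x)))"

lemma monomial_nonneg: "monomial n b E \<Longrightarrow> 0 \<le> b"
  by (simp add: monomial_def)

lemma monomialE:
  assumes "monomial n b E"
  obtains B where "real_multilinear n B" "\<And>x. E x = B (replicate n x)"
    "\<And>xs. length xs = n \<Longrightarrow> norm (B xs) \<le> b * prod_list (map q xs)" "0 \<le> b"
  using assms unfolding monomial_def bounded_multilinear_def by blast

lemma monomialI:
  assumes "real_multilinear n B" "\<And>x. E x = B (replicate n x)"
    "\<And>xs. length xs = n \<Longrightarrow> norm (B xs) \<le> b * prod_list (map q xs)" "0 \<le> b"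
  shows "monomial n b E"
  using assms unfolding monomial_def bounded_multilinear_def by blast

lemma monomial_norm_le:
  assumes "monomial n b E" shows "norm (E x) \<le> b * q x ^ n"
proof -
  obtain B where B: "\<And>x. E x = B (replicate n x)"
    "\<And>xs. length xs = n \<Longrightarrow> norm (B xs) \<le> b * prod_list (map q xs)"
    using monomialE[OF assms] by metis
  show ?thesis using B(2)[of "replicate n x"] by (simp add: B(1))
qed

lemma monomial_at_0:
  assumes "monomial n b E" "0 < n" shows "E 0 = 0"
  using monomial_norm_le[OF assms(1), of 0] assms(2) by (simp add: power_0_left)

lemma monomial_const: "monomial 0 (norm c) (\<lambda>_. c)"
  by (rule monomialI[of _ "\<lambda>_. c"]) auto

lemma monomial_degree_0: "monomial 0 b E \<Longrightarrow> E x = E y"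
  by (erule monomialE) simp

lemma monomial_zero: "monomial n 0 (\<lambda>_. 0)"
  by (rule monomialI[of _ "\<lambda>_. 0"]) (auto simp: real_multilinear_def linear_zero)

lemma monomial_scaleC:
  assumes "monomial m a g" "monomial n b E"
  shows "monomial (m + n) (a * b) (\<lambda>x. g x *\<^sub>C E x)"
proof -
  obtain B where B: "real_multilinear m B" "\<And>x. g x = B (replicate m x)"
    "\<And>xs. length xs = m \<Longrightarrow> norm (B xs) \<le> a * prod_list (map q xs)" and a: "0 \<le> a"
    using monomialE[OF assms(1)] by metis
  obtain C where C: "real_multilinear n C" "\<And>x. E x = C (replicate n x)"
    "\<And>xs. length xs = n \<Longrightarrow> norm (C xs) \<le> b * prod_list (map q xs)" and b: "0 \<le> b"
    using monomialE[OF assms(2)] by metis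
  show ?thesis
  proof (rule monomialI[of _ "\<lambda>xs. B (take m xs) *\<^sub>C C (drop m xs)"])
    show "real_multilinear (m + n) (\<lambda>xs. B (take m xs) *\<^sub>C C (drop m xs))"
    proof (rule real_multilinearI)
      fix xs ys :: "'x list" assume l: "length xs + length ys + 1 = m + n"
      show "linear (\<lambda>v. B (take m (xs @ v # ys)) *\<^sub>C C (drop m (xs @ v # ys)))"
      proof (cases "m \<le> length xs")
        case True
        then have "linear (\<lambda>v. C (drop m xs @ v # ys))"
          using l by (intro real_multilinear_slot[OF C(1)]) auto
        from linear_compose[OF this linear_scaleC[of "B (take m xs)"]]
        show ?thesis using True by (simp add: o_def)
      next
        case False
        then obtain k where k: "m = length xs + Suc k"
          by (metis less_imp_Suc_add not_le add_Suc_right)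
        then have "linear (\<lambda>v. B (xs @ v # take k ys))"
          using l by (intro real_multilinear_slot[OF B(1)]) auto
        from linear_compose[OF this bounded_linear.linear[OF bounded_linear_scaleC_left[of "C (drop k ys)"]]]
        show ?thesis using k by (simp add: o_def)
      qed
    qed
    show "g x *\<^sub>C E x = B (take m (replicate (m + n) x)) *\<^sub>C C (drop m (replicate (m + n) x))" for x
      by (simp add: B C min_def)
    fix xs :: "'x list" assume l: "length xs = m + n"
    have "norm (B (take m xs) *\<^sub>C C (drop m xs))
        \<le> (a * prod_list (map q (take m xs))) * (b * prod_list (map q (drop m xs)))"
      unfolding norm_scaleC using l a by (intro mult_mono B C) auto
    also have "\<dots> = a * b * (prod_list (map q (take m xs)) * prod_list (map q (drop m xs)))"
      by (simp add: mult_ac)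
    also have "prod_list (map q (take m xs)) * prod_list (map q (drop m xs)) = prod_list (map q xs)"
      by (metis append_take_drop_id map_append prod_list.append)
    finally show "norm (B (take m xs) *\<^sub>C C (drop m xs)) \<le> a * b * prod_list (map q xs)" .
  qed (use a b in auto)
qed

lemma monomial_infsum:
  fixes E :: "'i \<Rightarrow> 'x \<Rightarrow> 'y::complex_banach"
  assumes E: "\<And>i. i \<in> I \<Longrightarrow> monomial n (b i) (E i)" and b: "b summable_on I"
  shows "monomial n (infsum b I) (\<lambda>x. \<Sum>\<^sub>\<infinity>i\<in>I. E i x)"
proof -
  have "\<forall>i\<in>I. \<exists>B. real_multilinear n B \<and> (\<forall>x. E i x = B (replicate n x)) \<and>
    (\<forall>xs. length xs = n \<longrightarrow> norm (B xs) \<le> b i * prod_list (map q xs))"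
    using E by (metis monomialE)
  then obtain B where B: "\<And>i. i \<in> I \<Longrightarrow> real_multilinear n (B i)"
    "\<And>i x. i \<in> I \<Longrightarrow> E i x = B i (replicate n x)"
    "\<And>i xs. i \<in> I \<Longrightarrow> length xs = n \<Longrightarrow> norm (B i xs) \<le> b i * prod_list (map q xs)"
    by metis
  have sum: "(\<lambda>i. B i xs) summable_on I" if "length xs = n" for xs
    by (rule abs_summable_summable,
        rule Infinite_Sum.abs_summable_on_comparison_test'[OF summable_on_cmult_left[OF b] B(3)[OF _ that]])
  show ?thesis
  proof (rule monomialI[of _ "\<lambda>xs. \<Sum>\<^sub>\<infinity>i\<in>I. B i xs"])
    show "real_multilinear n (\<lambda>xs. \<Sum>\<^sub>\<infinity>i\<in>I. B i xs)"
      unfolding real_multilinear_def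
    proof (intro allI impI)
      fix xs :: "'x list" and j assume j: "length xs = n" "j < n"
      have lin: "linear (\<lambda>v. B i (xs[j := v]))" if "i \<in> I" for i
        using B(1)[OF that] j unfolding real_multilinear_def by blast
      have s: "(\<lambda>i. B i (xs[j := v])) summable_on I" for v
        using j by (intro sum) simp
      show "linear (\<lambda>v. \<Sum>\<^sub>\<infinity>i\<in>I. B i (xs[j := v]))"
      proof (rule linearI)
        fix v w and r :: real
        have "(\<Sum>\<^sub>\<infinity>i\<in>I. B i (xs[j := v + w])) = (\<Sum>\<^sub>\<infinity>i\<in>I. B i (xs[j := v]) + B i (xs[j := w]))"
          by (rule infsum_cong) (rule linear_add[OF lin])
        then show "(\<Sum>\<^sub>\<infinity>i\<in>I. B i (xs[j := v + w]))
            = (\<Sum>\<^sub>\<infinity>i\<in>I. B i (xs[j := v])) + (\<Sum>\<^sub>\<infinity>i\<in>I. B i (xs[j := w]))"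
          by (simp add: infsum_add s)
        have "(\<Sum>\<^sub>\<infinity>i\<in>I. B i (xs[j := r *\<^sub>R v])) = (\<Sum>\<^sub>\<infinity>i\<in>I. r *\<^sub>R B i (xs[j := v]))"
          by (rule infsum_cong) (rule linear_scale[OF lin])
        then show "(\<Sum>\<^sub>\<infinity>i\<in>I. B i (xs[j := r *\<^sub>R v])) = r *\<^sub>R (\<Sum>\<^sub>\<infinity>i\<in>I. B i (xs[j := v]))"
          by (simp add: infsum_scaleR_right)
      qed
    qed
    show "(\<Sum>\<^sub>\<infinity>i\<in>I. E i x) = (\<Sum>\<^sub>\<infinity>i\<in>I. B i (replicate n x))" for x
      by (rule infsum_cong) (rule B)
    show "norm (\<Sum>\<^sub>\<infinity>i\<in>I. B i xs) \<le> infsum b I * prod_list (map q xs)" if "length xs = n" for xs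
      by (rule norm_infsum_le[OF has_sum_infsum[OF sum[OF that]]
          has_sum_cmult_left[OF has_sum_infsum[OF b]] B(3)[OF _ that]])
    show "0 \<le> infsum b I"
      by (rule infsum_nonneg) (use E monomial_nonneg in blast)
  qed
qed

lemma monomial_star_polynomial:
  fixes E :: "'x \<Rightarrow> 'y::complex_normed_vector"
  assumes "monomial n b E" shows "homogeneous_star_polynomial n E"
proof -
  obtain B where B: "real_multilinear n B" "\<And>x. E x = B (replicate n x)"
    using monomialE[OF assms] by metis
  have "E = (\<lambda>x. B (replicate n x))" using B by auto
  then show ?thesis
    using homogeneous_star_polynomial_of_real_multilinear[OF B(1)] by simp
qed

lemma monomial_Lipschitz:
  assumes "monomial n b E" and R: "q x \<le> R" "q y \<le> R"
  shows "norm (E x - E y) \<le> real n * b * R ^ (n - 1) * q (x - y)"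
proof -
  obtain B where B: "real_multilinear n B" "\<And>x. E x = B (replicate n x)"
    "\<And>xs. length xs = n \<Longrightarrow> norm (B xs) \<le> b * prod_list (map q xs)" and b: "0 \<le> b"
    using monomialE[OF assms(1)] by metis
  have R0: "0 \<le> R" using R(1) q_nonneg[of x] by linarith
  \<comment> \<open>The arguments are exchanged one at a time.\<close>
  define Z where "Z i = B (replicate i x @ replicate (n - i) y)" for i
  have step: "norm (Z (Suc i) - Z i) \<le> b * R ^ (n - 1) * q (x - y)" if "i < n" for i
  proof -
    have lin: "linear (\<lambda>v. B (replicate i x @ v # replicate (n - Suc i) y))"
      using that by (intro real_multilinear_slot[OF B(1)]) auto
    have "Z (Suc i) = B (replicate i x @ x # replicate (n - Suc i) y)"
      by (simp add: Z_def replicate_app_Cons_same)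
    moreover have "Z i = B (replicate i x @ y # replicate (n - Suc i) y)"
      using that by (simp add: Z_def Suc_diff_Suc flip: replicate_Suc)
    ultimately have "Z (Suc i) - Z i = B (replicate i x @ (x - y) # replicate (n - Suc i) y)"
      by (simp add: linear_diff[OF lin])
    also have "norm \<dots> \<le> b * prod_list (map q (replicate i x @ (x - y) # replicate (n - Suc i) y))"
      using that by (intro B(3)) auto
    also have "\<dots> = b * (q x ^ i * q y ^ (n - Suc i)) * q (x - y)"
      by (simp add: mult_ac)
    also have "\<dots> \<le> b * (R ^ i * R ^ (n - Suc i)) * q (x - y)"
      using b R R0 by (intro mult_right_mono mult_left_mono mult_mono power_mono) auto
    also have "R ^ i * R ^ (n - Suc i) = R ^ (n - 1)"
      using that by (simp flip: power_add)
    finally show ?thesis .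
  qed
  have "E x - E y = Z n - Z 0" by (simp add: Z_def B)
  also have "\<dots> = (\<Sum>i<n. Z (Suc i) - Z i)" by (rule sum_lessThan_telescope[symmetric])
  also have "norm \<dots> \<le> (\<Sum>i<n. b * R ^ (n - 1) * q (x - y))"
    by (rule sum_norm_le) (use step in auto)
  finally show ?thesis by (simp add: mult_ac)
qed

text \<open>The derivative in the direction \<open>v\<close> is the coefficient of \<open>t\<close> in \<open>B (x + t v, \<dots>, x + t v)\<close>, hence a
  combination of the values at \<open>t = 0, \<dots>, n + 1\<close>, with coefficients independent of \<open>B\<close>. Homogeneity in
  \<open>x\<close> and \<open>v\<close> gives the bound of product form.\<close>

lemma insertions_diagonal_bound:
  "\<exists>K\<ge>0. \<forall>(B :: 'x list \<Rightarrow> 'y::complex_normed_vector) C. real_multilinear (Suc n) B \<longrightarrow> 0 \<le> C \<longrightarrow>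
    (\<forall>x. norm (B (replicate (Suc n) x)) \<le> C * q x ^ Suc n) \<longrightarrow>
    (\<forall>x v. norm (insertions n B v (replicate n x)) \<le> K * C * q v * q x ^ n)"
proof -
  obtain c :: "nat \<Rightarrow> real" where c: "\<And>A :: nat \<Rightarrow> 'y.
      (\<Sum>l\<le>Suc n. c l *\<^sub>R (\<Sum>i\<le>Suc n. real l ^ i *\<^sub>R A i)) = A 1"
    using coefficient_from_values[of 1 "Suc n"] by auto
  define K where "K = (\<Sum>l\<le>Suc n. \<bar>c l\<bar>) * real (Suc (Suc n)) ^ Suc n"
  have K0: "0 \<le> K" unfolding K_def by (intro mult_nonneg_nonneg sum_nonneg) auto
  have "norm (insertions n B v (replicate n x)) \<le> K * C * q v * q x ^ n"
    if B: "real_multilinear (Suc n) B" and C: "0 \<le> C"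
      and bound: "\<And>x. norm (B (replicate (Suc n) x)) \<le> C * q x ^ Suc n"
    for B :: "'x list \<Rightarrow> 'y" and C x v
  proof -
    have unit: "norm (insertions n B v (replicate n x)) \<le> K * C" if "q x \<le> 1" "q v \<le> 1" for x v
    proof -
      obtain A where A: "\<And>t. B (replicate (Suc n) (x + t *\<^sub>R v)) = (\<Sum>j\<le>Suc n. t ^ j *\<^sub>R A j)"
        "A 1 = (\<Sum>i<Suc n. B (replicate i x @ v # replicate (Suc n - 1 - i) x))"
        using diagonal_along_line[OF B, of x v] by auto
      have "insertions n B v (replicate n x) = A 1"
        unfolding insertions_diagonal A(2) lessThan_Suc_atMost by simp
      also have "\<dots> = (\<Sum>l\<le>Suc n. c l *\<^sub>R B (replicate (Suc n) (x + real l *\<^sub>R v)))"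
        unfolding A(1) c ..
      also have "norm \<dots> \<le> (\<Sum>l\<le>Suc n. \<bar>c l\<bar> * (C * real (Suc (Suc n)) ^ Suc n))"
      proof (rule sum_norm_le)
        fix l assume l: "l \<in> {..Suc n}"
        have "q (x + real l *\<^sub>R v) \<le> q x + real l * q v"
          using q_triangle[of x "real l *\<^sub>R v"] by (simp add: q_scaleR)
        also have "\<dots> \<le> 1 + real (Suc n) * 1"
          using that l by (intro add_mono mult_mono) auto
        finally have "q (x + real l *\<^sub>R v) \<le> real (Suc (Suc n))" by simp
        then have "C * q (x + real l *\<^sub>R v) ^ Suc n \<le> C * real (Suc (Suc n)) ^ Suc n"
          using C by (intro mult_left_mono power_mono) auto
        then show "norm (c l *\<^sub>R B (replicate (Suc n) (x + real l *\<^sub>R v)))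
            \<le> \<bar>c l\<bar> * (C * real (Suc (Suc n)) ^ Suc n)"
          using bound[of "x + real l *\<^sub>R v"] unfolding norm_scaleR
          by (intro mult_left_mono) auto
      qed
      also have "\<dots> = K * C"
        unfolding K_def sum_distrib_right[symmetric] by (simp add: mult_ac)
      finally show ?thesis .
    qed
    have scaled: "norm (insertions n B v (replicate n x)) \<le> K * C * s * r ^ n"
      if "0 < r" "0 < s" "q x \<le> r" "q v \<le> s" for r s
    proof -
      have "insertions n B (s *\<^sub>R ((1/s) *\<^sub>R v)) (replicate n (r *\<^sub>R ((1/r) *\<^sub>R x)))
          = r ^ n *\<^sub>R s *\<^sub>R insertions n B ((1/s) *\<^sub>R v) (replicate n ((1/r) *\<^sub>R x))"
        unfolding real_multilinear_scaled[OF real_multilinear_insertions[OF B]]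
        by (subst linear_scale[OF insertions_linear[OF B]]) auto
      then have "norm (insertions n B v (replicate n x))
          = r ^ n * (s * norm (insertions n B ((1/s) *\<^sub>R v) (replicate n ((1/r) *\<^sub>R x))))"
        using that by simp
      also have "\<dots> \<le> r ^ n * (s * (K * C))"
        using that by (intro mult_left_mono unit) (auto simp: q_scaleR)
      finally show ?thesis by (simp add: mult_ac)
    qed
    \<comment> \<open>Scaling by \<open>q x\<close> and \<open>q v\<close> themselves fails when they vanish, so they are approached from above.\<close>
    have "((\<lambda>e. K * C * (q v + e) * (q x + e) ^ n) \<longlongrightarrow> K * C * (q v + 0) * (q x + 0) ^ n) (at_right 0)"
      by (intro tendsto_intros)
    moreover have "\<forall>\<^sub>F e in at_right 0. norm (insertions n B v (replicate n x)) \<le> K * C * (q v + e) * (q x + e) ^ n"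
      unfolding eventually_at_right_field
      using scaled by (intro exI[of _ 1]) (auto intro!: scaled simp: add_nonneg_pos)
    ultimately show ?thesis
      using tendsto_lowerbound trivial_limit_at_right_real by fastforce
  qed
  then show ?thesis using K0 by blast
qed

lemma symmetrized_bound:
  "\<exists>K\<ge>0. \<forall>(B :: 'x list \<Rightarrow> 'y::complex_normed_vector) C. real_multilinear n B \<longrightarrow> 0 \<le> C \<longrightarrow>
    (\<forall>x. norm (B (replicate n x)) \<le> C * q x ^ n) \<longrightarrow>
    (\<forall>xs. length xs = n \<longrightarrow> norm (symmetrized n B xs) \<le> K * C * prod_list (map q xs))"
proof (induction n)
  case 0
  show ?case by (intro exI[of _ 1]) auto
next
  case (Suc n)
  obtain K where K: "0 \<le> K" "\<And>(B :: 'x list \<Rightarrow> 'y) C xs. real_multilinear n B \<Longrightarrow> 0 \<le> C \<Longrightarrow>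
    (\<And>x. norm (B (replicate n x)) \<le> C * q x ^ n) \<Longrightarrow> length xs = n \<Longrightarrow>
    norm (symmetrized n B xs) \<le> K * C * prod_list (map q xs)"
    using Suc.IH by blast
  obtain L where L: "0 \<le> L" "\<And>(B :: 'x list \<Rightarrow> 'y) C x v. real_multilinear (Suc n) B \<Longrightarrow> 0 \<le> C \<Longrightarrow>
    (\<And>x. norm (B (replicate (Suc n) x)) \<le> C * q x ^ Suc n) \<Longrightarrow>
    norm (insertions n B v (replicate n x)) \<le> L * C * q v * q x ^ n"
    using insertions_diagonal_bound[of n, where ?'y = 'y] by blast
  have "norm (symmetrized (Suc n) B xs) \<le> K * L * C * prod_list (map q xs)"
    if B: "real_multilinear (Suc n) B" and C: "0 \<le> C"
      and bound: "\<And>x. norm (B (replicate (Suc n) x)) \<le> C * q x ^ Suc n"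
      and l: "length xs = Suc n"
    for B :: "'x list \<Rightarrow> 'y" and C xs
  proof -
    obtain v ys where xs: "xs = v # ys" "length ys = n"
      using l by (cases xs) auto
    have "norm (symmetrized n (insertions n B v) ys) \<le> K * (L * C * q v) * prod_list (map q ys)"
      by (rule K(2)[OF real_multilinear_insertions[OF B] _ L(2)[OF B C bound] xs(2)])
        (use L C in auto)
    moreover have "norm (symmetrized (Suc n) B xs) \<le> norm (symmetrized n (insertions n B v) ys)"
      by (simp add: xs divide_le_eq mult_left_le mult_le_cancel_left1)
    ultimately show ?thesis by (simp add: xs mult_ac)
  qed
  then show ?case using K(1) L(1) by (intro exI[of _ "K * L"]) auto
qed

text \<open>Polarization: a bounded diagonal has a bounded form, although the form that comes with a
  \<open>*\<close>-polynomial may be unbounded.\<close>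

theorem monomial_of_bound:
  fixes F :: "'x \<Rightarrow> 'y::complex_normed_vector"
  assumes F: "homogeneous_star_polynomial n F" and C: "\<And>x. norm (F x) \<le> C * q x ^ n" "0 \<le> C"
  shows "\<exists>b. monomial n b F"
proof -
  obtain B where B: "real_multilinear n B" "\<And>x. F x = B (replicate n x)"
    using real_multilinear_of_homogeneous_star_polynomial[OF F] by blast
  obtain K where "0 \<le> K" and K: "\<And>(B :: 'x list \<Rightarrow> 'y) C xs. real_multilinear n B \<Longrightarrow> 0 \<le> C \<Longrightarrow>
    (\<And>x. norm (B (replicate n x)) \<le> C * q x ^ n) \<Longrightarrow> length xs = n \<Longrightarrow>
    norm (symmetrized n B xs) \<le> K * C * prod_list (map q xs)"
    using symmetrized_bound[of n, where ?'y = 'y] by blast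
  have "monomial n (K * C) F"
    by (rule monomialI[of _ "symmetrized n B"])
      (use B C K[OF B(1) C(2)] \<open>0 \<le> K\<close> in \<open>auto simp: symmetrized_diagonal real_multilinear_symmetrized\<close>)
  then show ?thesis ..
qed

section \<open>Germs with an absolutely convergent expansion\<close>

text \<open>\<open>M\<close> bounds the \<open>l\<^sup>1\<close> norm, with weights \<open>\<delta>\<^sup>n\<close>, of an expansion of \<open>G\<close> on the ball of radius \<open>\<delta>\<close>. This
  norm is submultiplicative, and it plays the role that the supremum over a complex neighbourhood
  has in classical proofs.\<close>

definition germ :: "real \<Rightarrow> real \<Rightarrow> ('x \<Rightarrow> 'y::complex_normed_vector) \<Rightarrow> bool" where
  "germ \<delta> M G \<longleftrightarrow> (\<exists>b E S. (\<forall>n. monomial n (b n) (E n)) \<and>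
    ((\<lambda>n. b n * \<delta> ^ n) has_sum S) UNIV \<and> S \<le> M \<and>
    (\<forall>h. q h \<le> \<delta> \<longrightarrow> ((\<lambda>n. E n h) has_sum G h) UNIV))"

lemma germE:
  assumes "germ \<delta> M G"
  obtains b E S where "\<And>n. monomial n (b n) (E n)" "((\<lambda>n. b n * \<delta> ^ n) has_sum S) UNIV" "S \<le> M"
    "\<And>h. q h \<le> \<delta> \<Longrightarrow> ((\<lambda>n. E n h) has_sum G h) UNIV"
  using assms unfolding germ_def by blast

lemma germI:
  assumes "\<And>n. monomial n (b n) (E n)" "((\<lambda>n. b n * \<delta> ^ n) has_sum S) UNIV" "S \<le> M"
    "\<And>h. q h \<le> \<delta> \<Longrightarrow> ((\<lambda>n. E n h) has_sum G h) UNIV"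
  shows "germ \<delta> M G"
  using assms unfolding germ_def by blast

lemma germ_mono: "germ \<delta> M G \<Longrightarrow> M \<le> N \<Longrightarrow> germ \<delta> N G"
  unfolding germ_def by (meson order_trans)

lemma germ_cong: "germ \<delta> M F \<Longrightarrow> (\<And>h. q h \<le> \<delta> \<Longrightarrow> F h = G h) \<Longrightarrow> germ \<delta> M G"
  by (erule germE, rule germI) auto

text \<open>The monomials may be indexed in any way; terms of equal degree are collected here once, and
  not in each of the closure properties that follow.\<close>

lemma germ_of_monomials:
  fixes E :: "'i \<Rightarrow> 'x \<Rightarrow> 'y::complex_banach"
  assumes \<delta>: "0 < \<delta>" and E: "\<And>i. i \<in> I \<Longrightarrow> monomial (d i) (b i) (E i)"
    and b: "((\<lambda>i. b i * \<delta> ^ d i) has_sum S) I" "S \<le> M"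
    and G: "\<And>h. q h \<le> \<delta> \<Longrightarrow> ((\<lambda>i. E i h) has_sum G h) I"
  shows "germ \<delta> M G"
proof (rule germI)
  let ?J = "\<lambda>n. {i \<in> I. d i = n}"
  have bJ: "b summable_on ?J n" for n
  proof -
    have "(\<lambda>i. b i * \<delta> ^ d i) summable_on ?J n"
      by (rule summable_on_subset_banach[OF has_sum_imp_summable[OF b(1)]]) auto
    then have "(\<lambda>i. b i * \<delta> ^ n) summable_on ?J n"
      by (rule summable_on_cong[THEN iffD1, rotated]) auto
    then show ?thesis using \<delta> by (subst (asm) summable_on_cmult_left') auto
  qed
  have EJ: "\<And>i. i \<in> ?J n \<Longrightarrow> monomial n (b i) (E i)" for n
    using E by blast
  show "monomial n (infsum b (?J n)) (\<lambda>h. \<Sum>\<^sub>\<infinity>i\<in>?J n. E i h)" for n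
    by (rule monomial_infsum[OF EJ bJ])
  show "((\<lambda>n. infsum b (?J n) * \<delta> ^ n) has_sum S) UNIV"
  proof (rule has_sum_fibres[OF b(1)])
    fix n
    have "((\<lambda>i. b i * \<delta> ^ n) has_sum infsum b (?J n) * \<delta> ^ n) (?J n)"
      by (rule has_sum_cmult_left[OF has_sum_infsum[OF bJ]])
    then show "((\<lambda>i. b i * \<delta> ^ d i) has_sum infsum b (?J n) * \<delta> ^ n) (?J n)"
      by (rule has_sum_cong[THEN iffD1, rotated]) auto
  qed
  show "((\<lambda>n. \<Sum>\<^sub>\<infinity>i\<in>?J n. E i h) has_sum G h) UNIV" if "q h \<le> \<delta>" for h
  proof (rule has_sum_fibres[OF G[OF that]])
    fix n
    have "(\<lambda>i. E i h) summable_on ?J n"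
      by (rule abs_summable_summable,
        rule Infinite_Sum.abs_summable_on_comparison_test'[OF summable_on_cmult_left[OF bJ]
          monomial_norm_le[OF EJ]])
    then show "((\<lambda>i. E i h) has_sum (\<Sum>\<^sub>\<infinity>i\<in>?J n. E i h)) (?J n)"
      by (rule has_sum_infsum)
  qed
qed (rule b)

lemma germ_nonneg:
  assumes "germ \<delta> M G" "0 \<le> \<delta>" shows "0 \<le> M"
  using assms(1)
proof (rule germE)
  fix b and E :: "nat \<Rightarrow> 'x \<Rightarrow> 'a" and S
  assume *: "\<And>n. monomial n (b n) (E n)" "((\<lambda>n. b n * \<delta> ^ n) has_sum S) UNIV" "S \<le> M"
  have "0 \<le> S" by (rule has_sum_nonneg[OF *(2)]) (use monomial_nonneg[OF *(1)] assms(2) in auto)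
  then show ?thesis using *(3) by simp
qed

lemma monomial_norm_le_radius:
  assumes "monomial n b E" "q h \<le> \<delta>" shows "norm (E h) \<le> b * \<delta> ^ n"
  using monomial_norm_le[OF assms(1), of h] monomial_nonneg[OF assms(1)]
    mult_left_mono[OF power_mono[OF assms(2)], of b n] by simp

lemma germ_norm_le:
  assumes "germ \<delta> M G" "q h \<le> \<delta>" shows "norm (G h) \<le> M"
  using assms(1)
proof (rule germE)
  fix b and E :: "nat \<Rightarrow> 'x \<Rightarrow> 'a" and S
  assume *: "\<And>n. monomial n (b n) (E n)" "((\<lambda>n. b n * \<delta> ^ n) has_sum S) UNIV" "S \<le> M"
    "\<And>h. q h \<le> \<delta> \<Longrightarrow> ((\<lambda>n. E n h) has_sum G h) UNIV"
  have "norm (G h) \<le> S"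
    by (rule norm_infsum_le[OF *(4)[OF assms(2)] *(2)]) (rule monomial_norm_le_radius[OF *(1) assms(2)])
  then show ?thesis using *(3) by simp
qed

lemma germ_monomial:
  fixes E :: "'x \<Rightarrow> 'y::complex_banach"
  assumes "monomial n b E" "0 < \<delta>" shows "germ \<delta> (b * \<delta> ^ n) E"
  by (rule germ_of_monomials[where I = "{()}" and E = "\<lambda>_. E" and b = "\<lambda>_. b" and d = "\<lambda>_. n"])
    (use assms in \<open>auto intro!: has_sum_finiteI\<close>)

lemma germ_const: "0 < \<delta> \<Longrightarrow> germ \<delta> (norm c) (\<lambda>_. c :: 'y::complex_banach)"
  using germ_monomial[OF monomial_const, of \<delta> c] by simp

lemma germ_infsum:
  fixes G :: "'i \<Rightarrow> 'x \<Rightarrow> 'y::complex_banach"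
  assumes \<delta>: "0 < \<delta>" and G: "\<And>i. i \<in> I \<Longrightarrow> germ \<delta> (M i) (G i)" and M: "M summable_on I"
  shows "germ \<delta> (infsum M I) (\<lambda>h. \<Sum>\<^sub>\<infinity>i\<in>I. G i h)"
proof -
  have "\<forall>i\<in>I. \<exists>b E S. (\<forall>n. monomial n (b n) (E n)) \<and>
    ((\<lambda>n. b n * \<delta> ^ n) has_sum S) UNIV \<and> S \<le> M i \<and>
    (\<forall>h. q h \<le> \<delta> \<longrightarrow> ((\<lambda>n. E n h) has_sum G i h) UNIV)"
    using G unfolding germ_def by blast
  from bchoice[OF this] obtain b where "\<forall>i\<in>I. \<exists>E S. (\<forall>n. monomial n (b i n) (E n)) \<and>
    ((\<lambda>n. b i n * \<delta> ^ n) has_sum S) UNIV \<and> S \<le> M i \<and>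
    (\<forall>h. q h \<le> \<delta> \<longrightarrow> ((\<lambda>n. E n h) has_sum G i h) UNIV)" ..
  from bchoice[OF this] obtain E where "\<forall>i\<in>I. \<exists>S. (\<forall>n. monomial n (b i n) (E i n)) \<and>
    ((\<lambda>n. b i n * \<delta> ^ n) has_sum S) UNIV \<and> S \<le> M i \<and>
    (\<forall>h. q h \<le> \<delta> \<longrightarrow> ((\<lambda>n. E i n h) has_sum G i h) UNIV)" ..
  from bchoice[OF this] obtain S where *: "\<And>i n. i \<in> I \<Longrightarrow> monomial n (b i n) (E i n)"
    "\<And>i. i \<in> I \<Longrightarrow> ((\<lambda>n. b i n * \<delta> ^ n) has_sum S i) UNIV" "\<And>i. i \<in> I \<Longrightarrow> S i \<le> M i"
    "\<And>i h. i \<in> I \<Longrightarrow> q h \<le> \<delta> \<Longrightarrow> ((\<lambda>n. E i n h) has_sum G i h) UNIV"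
    by blast
  have nonneg: "0 \<le> b i n * \<delta> ^ n" if "i \<in> I" for i n
    using monomial_nonneg[OF *(1)[OF that]] \<delta> by simp
  have S0: "0 \<le> S i" if "i \<in> I" for i
    by (rule has_sum_nonneg[OF *(2)[OF that]]) (rule nonneg[OF that])
  have S: "S summable_on I"
    by (rule summable_on_comparison_test[OF M]) (use *(3) S0 in auto)
  have bsum: "(\<lambda>(i, n). b i n * \<delta> ^ n) summable_on I \<times> UNIV"
    by (rule summable_on_SigmaI[where g = S]) (use *(2) S nonneg in auto)
  show ?thesis
  proof (rule germ_of_monomials[OF \<delta>, where I = "I \<times> UNIV" and d = snd and
        b = "\<lambda>(i, n). b i n" and E = "\<lambda>(i, n). E i n" and S = "infsum S I"])
    have "((\<lambda>(i, n). b i n * \<delta> ^ n) has_sum infsum S I) (I \<times> UNIV)"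
      by (rule has_sum_SigmaI[where g = S]) (use *(2) S bsum in auto)
    then show "((\<lambda>x. (case x of (i, n) \<Rightarrow> b i n) * \<delta> ^ snd x) has_sum infsum S I) (I \<times> UNIV)"
      by (simp add: case_prod_unfold)
    show "infsum S I \<le> infsum M I"
      by (rule infsum_mono[OF S M]) (rule *(3))
    fix h assume h: "q h \<le> \<delta>"
    have "(\<lambda>x. norm (case x of (i, n) \<Rightarrow> E i n h)) summable_on I \<times> UNIV"
      by (rule Infinite_Sum.abs_summable_on_comparison_test'[OF bsum])
        (use monomial_norm_le_radius[OF *(1) h] in auto)
    then have sum: "(\<lambda>(i, n). E i n h) summable_on I \<times> UNIV"
      by (rule abs_summable_summable)
    have "(\<lambda>i. norm (G i h)) summable_on I"
      by (rule Infinite_Sum.abs_summable_on_comparison_test'[OF M])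
        (rule germ_norm_le[OF G h])
    then have "(\<lambda>i. G i h) summable_on I"
      by (rule abs_summable_summable)
    then have "((\<lambda>(i, n). E i n h) has_sum (\<Sum>\<^sub>\<infinity>i\<in>I. G i h)) (I \<times> UNIV)"
      using *(4) h sum by (intro has_sum_SigmaI[where g = "\<lambda>i. G i h"]) auto
    then show "((\<lambda>x. (case x of (i, n) \<Rightarrow> E i n) h) has_sum (\<Sum>\<^sub>\<infinity>i\<in>I. G i h)) (I \<times> UNIV)"
      by (simp add: case_prod_unfold)
  qed (use *(1) in auto)
qed

lemma germ_sum:
  fixes G :: "'i \<Rightarrow> 'x \<Rightarrow> 'y::complex_banach"
  assumes "0 < \<delta>" "finite I" "\<And>i. i \<in> I \<Longrightarrow> germ \<delta> (M i) (G i)"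
  shows "germ \<delta> (\<Sum>i\<in>I. M i) (\<lambda>h. \<Sum>i\<in>I. G i h)"
  using germ_infsum[of \<delta> I M G] assms by simp

lemma germ_add:
  fixes F :: "'x \<Rightarrow> 'y::complex_banach"
  assumes "0 < \<delta>" "germ \<delta> M F" "germ \<delta> N G"
  shows "germ \<delta> (M + N) (\<lambda>h. F h + G h)"
proof -
  have "germ \<delta> (\<Sum>i\<in>{0, 1::nat}. if i = 0 then M else N) (\<lambda>h. \<Sum>i\<in>{0, 1::nat}. (if i = 0 then F else G) h)"
    by (rule germ_sum) (use assms in auto)
  then show ?thesis by simp
qed

lemma germ_scaleC:
  fixes G :: "'x \<Rightarrow> 'y::complex_banach"
  assumes \<delta>: "0 < \<delta>" and g: "germ \<delta> M g" and G: "germ \<delta> N G"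
  shows "germ \<delta> (M * N) (\<lambda>h. g h *\<^sub>C G h)"
proof -
  obtain a D S where D: "\<And>n. monomial n (a n) (D n)" "((\<lambda>n. a n * \<delta> ^ n) has_sum S) UNIV" "S \<le> M"
    "\<And>h. q h \<le> \<delta> \<Longrightarrow> ((\<lambda>n. D n h) has_sum g h) UNIV"
    by (rule germE[OF g]) (rule that)
  obtain b E U where E: "\<And>n. monomial n (b n) (E n)" "((\<lambda>n. b n * \<delta> ^ n) has_sum U) UNIV" "U \<le> N"
    "\<And>h. q h \<le> \<delta> \<Longrightarrow> ((\<lambda>n. E n h) has_sum G h) UNIV"
    by (rule germE[OF G]) (rule that)
  have nonneg: "0 \<le> a n * \<delta> ^ n" "0 \<le> b n * \<delta> ^ n" for n
    using monomial_nonneg[OF D(1)] monomial_nonneg[OF E(1)] \<delta> by auto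
  have SU: "0 \<le> S" "0 \<le> U"
    using has_sum_nonneg[OF D(2)] has_sum_nonneg[OF E(2)] nonneg by auto
  show ?thesis
  proof (rule germ_of_monomials[OF \<delta>, where I = "UNIV \<times> UNIV" and d = "\<lambda>(m, n). m + n" and
        b = "\<lambda>(m, n). a m * b n" and E = "\<lambda>(m, n) h. D m h *\<^sub>C E n h" and S = "S * U"])
    show "((\<lambda>x. (case x of (m, n) \<Rightarrow> a m * b n) * \<delta> ^ (case x of (m, n) \<Rightarrow> m + n)) has_sum S * U)
        (UNIV \<times> UNIV)"
      using has_sum_product_real[OF D(2) E(2)] nonneg
      by (simp add: case_prod_unfold power_add mult_ac)
    show "S * U \<le> M * N"
      using D(3) E(3) SU by (intro mult_mono) auto
    fix h assume h: "q h \<le> \<delta>"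
    have "((\<lambda>(m, n). D m h *\<^sub>C E n h) has_sum g h *\<^sub>C G h) (UNIV \<times> UNIV)"
    proof (rule has_sum_product_scaleC[OF D(4)[OF h] E(4)[OF h]])
      show "(\<lambda>n. norm (D n h)) summable_on UNIV"
        by (rule Infinite_Sum.abs_summable_on_comparison_test'[OF has_sum_imp_summable[OF D(2)]])
          (rule monomial_norm_le_radius[OF D(1) h])
      show "(\<lambda>n. norm (E n h)) summable_on UNIV"
        by (rule Infinite_Sum.abs_summable_on_comparison_test'[OF has_sum_imp_summable[OF E(2)]])
          (rule monomial_norm_le_radius[OF E(1) h])
    qed
    then show "((\<lambda>x. (case x of (m, n) \<Rightarrow> \<lambda>h. D m h *\<^sub>C E n h) h) has_sum g h *\<^sub>C G h) (UNIV \<times> UNIV)"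
      by (simp add: case_prod_unfold)
  qed (use monomial_scaleC[OF D(1) E(1)] in auto)
qed

lemma germ_mult:
  fixes g :: "'x \<Rightarrow> complex"
  assumes "0 < \<delta>" "germ \<delta> M f" "germ \<delta> N g"
  shows "germ \<delta> (M * N) (\<lambda>h. f h * g h)"
  using germ_scaleC[OF assms] by (simp add: scaleC_complex_def)

lemma germ_cmult:
  fixes g :: "'x \<Rightarrow> complex"
  assumes "0 < \<delta>" "germ \<delta> M g"
  shows "germ \<delta> (cmod c * M) (\<lambda>h. c * g h)"
  using germ_mult[OF assms(1) germ_const[OF assms(1)] assms(2)] .

lemma germ_power:
  fixes g :: "'x \<Rightarrow> complex"
  assumes "0 < \<delta>" "germ \<delta> M g"
  shows "germ \<delta> (M ^ n) (\<lambda>h. g h ^ n)"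
proof (induction n)
  case 0 then show ?case using germ_const[OF assms(1), of "1::complex"] by simp
next
  case (Suc n) then show ?case using germ_mult[OF assms] by simp
qed

lemma germ_exp:
  fixes g :: "'x \<Rightarrow> complex"
  assumes \<delta>: "0 < \<delta>" and g: "germ \<delta> M g"
  shows "germ \<delta> (exp M) (\<lambda>h. exp (g h))"
proof -
  have exp_sum: "((\<lambda>n. inverse (fact n) *\<^sub>R z ^ n) has_sum exp z) UNIV"
    for z :: "'b::{real_normed_algebra_1,banach}"
  proof (rule norm_summable_imp_has_sum)
    show "summable (\<lambda>n. norm (inverse (fact n) *\<^sub>R z ^ n))" by (rule summable_norm_exp)
    show "(\<lambda>n. inverse (fact n) *\<^sub>R z ^ n) sums exp z" by (rule exp_converges)
  qed
  have "M \<ge> 0" using germ_nonneg[OF g] \<delta> by simp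
  have summand: "germ \<delta> (inverse (fact n) *\<^sub>R M ^ n) (\<lambda>h. inverse (fact n) *\<^sub>R g h ^ n)" for n
    using germ_cmult[OF \<delta> germ_power[OF \<delta> g], of "complex_of_real (inverse (fact n))" n]
    by (simp add: scaleR_conv_of_real norm_inverse)
  have "germ \<delta> (\<Sum>\<^sub>\<infinity>n. inverse (fact n) *\<^sub>R M ^ n) (\<lambda>h. \<Sum>\<^sub>\<infinity>n. inverse (fact n) *\<^sub>R g h ^ n)"
    by (rule germ_infsum[OF \<delta> summand has_sum_imp_summable[OF exp_sum]])
  then show ?thesis by (simp only: infsumI[OF exp_sum])
qed

lemma germ_geometric:
  fixes g :: "'x \<Rightarrow> complex"
  assumes \<delta>: "0 < \<delta>" and g: "germ \<delta> M g" and M: "M < 1"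
  shows "germ \<delta> (1 / (1 - M)) (\<lambda>h. 1 / (1 - g h))"
proof -
  have geo: "((\<lambda>n. z ^ n) has_sum 1 / (1 - z)) UNIV" if "norm z < 1"
    for z :: "'b::{real_normed_field,banach}"
  proof (rule norm_summable_imp_has_sum)
    show "summable (\<lambda>n. norm (z ^ n))" using that by (simp add: norm_power)
    show "(\<lambda>n. z ^ n) sums (1 / (1 - z))" using that by (rule geometric_sums)
  qed
  have M0: "norm M < 1" using germ_nonneg[OF g] \<delta> M by simp
  have "germ \<delta> (\<Sum>\<^sub>\<infinity>n. M ^ n) (\<lambda>h. \<Sum>\<^sub>\<infinity>n. g h ^ n)"
    by (rule germ_infsum[OF \<delta> germ_power[OF \<delta> g] has_sum_imp_summable[OF geo[OF M0]]])
  then have "germ \<delta> (1 / (1 - M)) (\<lambda>h. \<Sum>\<^sub>\<infinity>n. g h ^ n)"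
    by (simp only: infsumI[OF geo[OF M0]])
  then show ?thesis
    by (rule germ_cong) (rule infsumI[OF geo], use germ_norm_le[OF g] M in fastforce)
qed

text \<open>Without a constant term, every monomial gains a factor \<open>\<delta>' / \<delta>\<close> on the smaller ball.\<close>

lemma germ_recentre:
  fixes G :: "'x \<Rightarrow> 'y::complex_banach"
  assumes G: "germ \<delta> M G" and "0 < \<delta>'" "\<delta>' \<le> \<delta>"
  shows "germ \<delta>' (\<delta>' / \<delta> * M) (\<lambda>h. G h - G 0)"
proof -
  obtain b E S where E: "\<And>n. monomial n (b n) (E n)" "((\<lambda>n. b n * \<delta> ^ n) has_sum S) UNIV" "S \<le> M"
    "\<And>h. q h \<le> \<delta> \<Longrightarrow> ((\<lambda>n. E n h) has_sum G h) UNIV"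
    by (rule germE[OF G]) (rule that)
  define b' where "b' n = (if n = 0 then 0 else b n)" for n
  define E' where "E' n = (if n = 0 then (\<lambda>_. 0) else E n)" for n
  have \<delta>: "0 < \<delta>" using assms by simp
  have mon: "monomial n (b' n) (E' n)" for n
    using E(1) monomial_zero by (auto simp: b'_def E'_def)
  have le: "b' n * \<delta>' ^ n \<le> \<delta>' / \<delta> * (b n * \<delta> ^ n)" for n
  proof (cases n)
    case 0 then show ?thesis using assms \<delta> monomial_nonneg[OF E(1)[of 0]] by (simp add: b'_def)
  next
    case (Suc k)
    have "\<delta>' ^ k \<le> \<delta> ^ k" using assms by (intro power_mono) auto
    then have "b n * (\<delta>' * \<delta>' ^ k) \<le> b n * (\<delta>' * \<delta> ^ k)"
      using monomial_nonneg[OF E(1)] assms by (intro mult_left_mono) auto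
    then show ?thesis using Suc \<delta> by (simp add: b'_def field_simps)
  qed
  have nonneg: "0 \<le> b' n * \<delta>' ^ n" for n
    using monomial_nonneg[OF mon] assms by auto
  have scaled: "((\<lambda>n. \<delta>' / \<delta> * (b n * \<delta> ^ n)) has_sum \<delta>' / \<delta> * S) UNIV"
    by (rule has_sum_cmult_right[OF E(2)])
  have sum: "(\<lambda>n. b' n * \<delta>' ^ n) summable_on UNIV"
    by (rule summable_on_comparison_test[OF has_sum_imp_summable[OF scaled]]) (use le nonneg in auto)
  show ?thesis
  proof (rule germI[OF mon has_sum_infsum[OF sum]])
    have "infsum (\<lambda>n. b' n * \<delta>' ^ n) UNIV \<le> \<delta>' / \<delta> * S"
      by (rule has_sum_mono[OF has_sum_infsum[OF sum] scaled]) (rule le)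
    also have "\<dots> \<le> \<delta>' / \<delta> * M"
      using E(3) assms \<delta> by (intro mult_left_mono) auto
    finally show "infsum (\<lambda>n. b' n * \<delta>' ^ n) UNIV \<le> \<delta>' / \<delta> * M" .
    fix h assume h: "q h \<le> \<delta>'"
    have "((\<lambda>n. E n 0) has_sum E 0 0) UNIV"
      by (rule has_sum_finite_neutralI[of "{0}"]) (use monomial_at_0[OF E(1)] in auto)
    with E(4)[of 0] \<delta> have "G 0 = E 0 0" by (auto intro: has_sum_unique)
    then have "G 0 = E 0 h" using monomial_degree_0[OF E(1)[of 0]] by simp
    then have "((\<lambda>n. if n = 0 then E 0 h else 0) has_sum G 0) UNIV"
      by (intro has_sum_finite_neutralI[of "{0}"]) auto
    then have "((\<lambda>n. - (if n = 0 then E 0 h else 0)) has_sum - G 0) UNIV"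
      by (simp only: has_sum_uminus minus_minus)
    with E(4) h assms have "((\<lambda>n. E n h + - (if n = 0 then E 0 h else 0)) has_sum G h + - G 0) UNIV"
      by (intro has_sum_add) auto
    moreover have "(\<lambda>n. E n h + - (if n = 0 then E 0 h else 0)) = (\<lambda>n. E' n h)"
      by (auto simp: E'_def)
    ultimately show "((\<lambda>n. E' n h) has_sum G h - G 0) UNIV" by simp
  qed
qed

lemma germ_restrict:
  fixes G :: "'x \<Rightarrow> 'y::complex_banach"
  assumes G: "germ \<delta> M G" and "0 < \<delta>'" "\<delta>' \<le> \<delta>"
  shows "germ \<delta>' M G"
proof -
  obtain b E S where E: "\<And>n. monomial n (b n) (E n)" "((\<lambda>n. b n * \<delta> ^ n) has_sum S) UNIV" "S \<le> M"
    "\<And>h. q h \<le> \<delta> \<Longrightarrow> ((\<lambda>n. E n h) has_sum G h) UNIV"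
    by (rule germE[OF G]) (rule that)
  have le: "b n * \<delta>' ^ n \<le> b n * \<delta> ^ n" for n
    using monomial_nonneg[OF E(1)] assms by (intro mult_left_mono power_mono) auto
  have nonneg: "0 \<le> b n * \<delta>' ^ n" for n
    using monomial_nonneg[OF E(1)] assms by auto
  have sum: "(\<lambda>n. b n * \<delta>' ^ n) summable_on UNIV"
    by (rule summable_on_comparison_test[OF has_sum_imp_summable[OF E(2)]]) (use le nonneg in auto)
  have "infsum (\<lambda>n. b n * \<delta>' ^ n) UNIV \<le> S"
    by (rule has_sum_mono[OF has_sum_infsum[OF sum] E(2)]) (rule le)
  then show ?thesis
    by (intro germI[OF E(1) has_sum_infsum[OF sum]] order_trans[OF _ E(3)] E(4)) (use assms in auto)
qed

section \<open>From germs to \<open>*\<close>-analytic maps\<close>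

lemma openin_q_ball:
  assumes T: "complex_vector_topology T" and q: "continuous_map T euclideanreal q"
  shows "openin T {y. q (y - x) < d}"
proof -
  have top: "topspace T = UNIV" using T by (simp add: complex_vector_topology_def)
  have "continuous_map T (prod_topology T T) (\<lambda>y. (y, - x))"
    using top by (simp add: continuous_map_paired)
  moreover have "continuous_map (prod_topology T T) T (\<lambda>(x, y). x + y)"
    using T by (simp add: complex_vector_topology_def)
  ultimately have "continuous_map T T ((\<lambda>(x, y). x + y) \<circ> (\<lambda>y. (y, - x)))"
    by (rule continuous_map_compose)
  from continuous_map_compose[OF this q]
  have "continuous_map T euclideanreal (\<lambda>y. q (y - x))" by (simp add: o_def)
  then have "openin T {y \<in> topspace T. q (y - x) \<in> {..<d}}"
    by (rule openin_continuous_map_preimage) simp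
  then show ?thesis using top by simp
qed

lemma continuous_map_of_q_continuous:
  fixes F :: "'x \<Rightarrow> 'y::metric_space"
  assumes T: "complex_vector_topology T" and q: "continuous_map T euclideanreal q"
    and F: "\<And>x e. 0 < e \<Longrightarrow> \<exists>d>0. \<forall>y. q (y - x) < d \<longrightarrow> dist (F y) (F x) < e"
  shows "continuous_map T euclidean F"
proof -
  have top: "topspace T = UNIV" using T by (simp add: complex_vector_topology_def)
  have "openin T {x. F x \<in> U}" if U: "open U" for U
  proof (subst openin_subopen, intro ballI)
    fix x assume "x \<in> {x. F x \<in> U}"
    then obtain e where e: "0 < e" "\<And>y. dist y (F x) < e \<Longrightarrow> y \<in> U"
      using U unfolding open_dist by blast
    obtain d where "0 < d" "\<forall>y. q (y - x) < d \<longrightarrow> dist (F y) (F x) < e"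
      using F[OF e(1)] by blast
    then show "\<exists>W. openin T W \<and> x \<in> W \<and> W \<subseteq> {x. F x \<in> U}"
      using e by (intro exI[of _ "{y. q (y - x) < d}"]) (auto intro: openin_q_ball[OF T q])
  qed
  then show ?thesis
    using top by (simp add: continuous_map_def)
qed

lemma monomial_continuous_map:
  fixes E :: "'x \<Rightarrow> 'y::complex_normed_vector"
  assumes T: "complex_vector_topology T" and q: "continuous_map T euclideanreal q"
    and E: "monomial n b E"
  shows "continuous_map T euclidean E"
proof (rule continuous_map_of_q_continuous[OF T q])
  fix x and e :: real assume e: "0 < e"
  define L where "L = real n * b * (q x + 1) ^ (n - 1) + 1"
  have L: "0 < L" unfolding L_def using monomial_nonneg[OF E] by (intro add_nonneg_pos) auto
  have "dist (E y) (E x) < e" if y: "q (y - x) < min 1 (e / L)" for y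
  proof -
    have "q y \<le> q x + 1" using q_triangle[of "y - x" x] y by simp
    then have "norm (E y - E x) \<le> real n * b * (q x + 1) ^ (n - 1) * q (y - x)"
      by (intro monomial_Lipschitz[OF E]) auto
    also have "\<dots> \<le> L * q (y - x)" unfolding L_def by (intro mult_right_mono) auto
    also have "\<dots> < e" using y L by (simp add: pos_less_divide_eq mult.commute)
    finally show ?thesis by (simp add: dist_norm)
  qed
  then show "\<exists>d>0. \<forall>y. q (y - x) < d \<longrightarrow> dist (E y) (E x) < e"
    using e L by (intro exI[of _ "min 1 (e / L)"]) auto
qed

theorem star_analytic_of_germs:
  fixes F :: "'x \<Rightarrow> 'y::complex_banach"
  assumes T: "complex_vector_topology T" and q: "continuous_map T euclideanreal q"
    and F: "\<And>x. \<exists>\<delta>>0. \<exists>M. germ \<delta> M (\<lambda>h. F (x + h))"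
  shows "star_analytic T F"
  unfolding star_analytic_def
proof
  fix x
  obtain \<delta> M where \<delta>: "0 < \<delta>" and germ: "germ \<delta> M (\<lambda>h. F (x + h))" using F by blast
  obtain b E S where E: "\<And>n. monomial n (b n) (E n)" "((\<lambda>n. b n * \<delta> ^ n) has_sum S) UNIV"
    "\<And>h. q h \<le> \<delta> \<Longrightarrow> ((\<lambda>n. E n h) has_sum F (x + h)) UNIV"
    by (rule germE[OF germ]) (rule that)
  let ?V = "{h. q h < \<delta>}"
  have "openin T ?V" using openin_q_ball[OF T q, of 0] by simp
  then have "T interior_of ?V = ?V" by (rule interior_of_openin)
  then have "0 \<in> T interior_of ?V" using \<delta> by simp
  moreover have "uniform_limit ?V (\<lambda>N h. \<Sum>n<N. E n h) (\<lambda>h. F (x + h)) sequentially"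
  proof -
    have "uniform_limit ?V (\<lambda>N h. \<Sum>n<N. E n h) (\<lambda>h. \<Sum>n. E n h) sequentially"
    proof (rule Weierstrass_m_test)
      show "norm (E n h) \<le> b n * \<delta> ^ n" if "h \<in> ?V" for n h
        using that by (intro monomial_norm_le_radius[OF E(1)]) simp
      show "summable (\<lambda>n. b n * \<delta> ^ n)"
        using has_sum_imp_sums[OF E(2)] by (rule sums_summable)
    qed
    moreover have "(\<Sum>n. E n h) = F (x + h)" if "h \<in> ?V" for h
      using sums_unique[OF has_sum_imp_sums[OF E(3)[of h]]] that by simp
    ultimately show ?thesis
      unfolding uniform_limit_iff by simp
  qed
  ultimately show "\<exists>V Fn. 0 \<in> T interior_of V \<and>
      (\<forall>n. homogeneous_star_polynomial n (Fn n) \<and> continuous_map T euclidean (Fn n)) \<and>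
      uniform_limit V (\<lambda>N h. \<Sum>n<N. Fn n h) (\<lambda>h. F (x + h)) sequentially"
    using monomial_star_polynomial[OF E(1)] monomial_continuous_map[OF T q E(1)] by blast
qed

section \<open>Translating monomials\<close>

text \<open>The arguments \<open>z + h\<close> are expanded one at a time; those already replaced by \<open>h\<close> are kept in
  front.\<close>

lemma germ_translated_form:
  fixes B :: "'x list \<Rightarrow> 'y::complex_banach"
  assumes \<delta>: "0 < \<delta>" and "bounded_multilinear (m + n) b B" "0 \<le> b"
  shows "germ \<delta> (b * \<delta> ^ m * (q z + \<delta>) ^ n) (\<lambda>h. B (replicate m h @ replicate n (z + h)))"
  using assms(2,3)
proof (induction n arbitrary: m b B)
  case 0
  then have "monomial m b (\<lambda>h. B (replicate m h))"
    unfolding monomial_def by auto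
  from germ_monomial[OF this \<delta>] show ?case by simp
next
  case (Suc n)
  then have B: "real_multilinear (Suc (m + n)) B"
    "\<And>xs. length xs = Suc (m + n) \<Longrightarrow> norm (B xs) \<le> b * prod_list (map q xs)"
    by (auto simp: bounded_multilinear_def)
  define C where "C ys = B (take m ys @ z # drop m ys)" for ys
  have "bounded_multilinear (m + n) (b * q z) C"
    unfolding bounded_multilinear_def
  proof (intro conjI allI impI)
    show "real_multilinear (m + n) C"
      unfolding C_def by (rule real_multilinear_insert[OF B(1)]) simp
    fix ys :: "'x list" assume "length ys = m + n"
    then have "norm (C ys) \<le> b * prod_list (map q (take m ys @ z # drop m ys))"
      unfolding C_def by (intro B(2)) auto
    also have "\<dots> = b * q z * (prod_list (map q (take m ys)) * prod_list (map q (drop m ys)))"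
      by (simp add: mult_ac)
    also have "prod_list (map q (take m ys)) * prod_list (map q (drop m ys)) = prod_list (map q ys)"
      by (metis append_take_drop_id map_append prod_list.append)
    finally show "norm (C ys) \<le> b * q z * prod_list (map q ys)" .
  qed
  from Suc.IH[OF this] Suc.prems
  have 1: "germ \<delta> (b * q z * \<delta> ^ m * (q z + \<delta>) ^ n) (\<lambda>h. C (replicate m h @ replicate n (z + h)))"
    by simp
  have 2: "germ \<delta> (b * \<delta> ^ Suc m * (q z + \<delta>) ^ n) (\<lambda>h. B (replicate (Suc m) h @ replicate n (z + h)))"
    using Suc by (intro Suc.IH) auto
  have "C (replicate m h @ replicate n (z + h)) + B (replicate (Suc m) h @ replicate n (z + h))
      = B (replicate m h @ replicate (Suc n) (z + h))" for h
  proof -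
    have lin: "linear (\<lambda>v. B (replicate m h @ v # replicate n (z + h)))"
      by (rule real_multilinear_slot[OF B(1)]) simp
    have "B (replicate (Suc m) h @ replicate n (z + h)) = B (replicate m h @ h # replicate n (z + h))"
      by (simp add: replicate_app_Cons_same)
    then show ?thesis
      using linear_add[OF lin, of z h] by (simp add: C_def)
  qed
  with germ_add[OF \<delta> 1 2]
  have "germ \<delta> (b * q z * \<delta> ^ m * (q z + \<delta>) ^ n + b * \<delta> ^ Suc m * (q z + \<delta>) ^ n)
      (\<lambda>h. B (replicate m h @ replicate (Suc n) (z + h)))" by simp
  moreover have "b * q z * \<delta> ^ m * (q z + \<delta>) ^ n + b * \<delta> ^ Suc m * (q z + \<delta>) ^ n
      = b * \<delta> ^ m * (q z + \<delta>) ^ Suc n"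
    by (simp add: algebra_simps)
  ultimately show ?case by simp
qed

lemma germ_translated_monomial:
  fixes E :: "'x \<Rightarrow> 'y::complex_banach"
  assumes "0 < \<delta>" "monomial n b E"
  shows "germ \<delta> (b * (q z + \<delta>) ^ n) (\<lambda>h. E (z + h))"
proof -
  obtain B where B: "bounded_multilinear n b B" "\<And>x. E x = B (replicate n x)"
    using assms(2) unfolding monomial_def by blast
  show ?thesis
    using germ_translated_form[OF assms(1), of 0 n b B z] B monomial_nonneg[OF assms(2)] by simp
qed

lemma monomial_cnj:
  fixes E :: "'x \<Rightarrow> complex"
  assumes "monomial n b E" shows "monomial n b (\<lambda>x. cnj (E x))"
proof -
  obtain B where B: "real_multilinear n B" "\<And>x. E x = B (replicate n x)"
    "\<And>xs. length xs = n \<Longrightarrow> norm (B xs) \<le> b * prod_list (map q xs)" "0 \<le> b"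
    by (rule monomialE[OF assms]) (rule that)
  show ?thesis
    by (rule monomialI[of _ "\<lambda>xs. cnj (B xs)"])
      (auto simp: B intro!: real_multilinear_compose[OF B(1)] bounded_linear.linear[OF bounded_linear_cnj])
qed

end

section \<open>Gaussian partitions indexed by grid points\<close>

lemma finite_to_nat_less: "finite {k :: 'a::countable. real (to_nat k) < C}"
proof -
  have "{k :: 'a. real (to_nat k) < C} \<subseteq> to_nat -` {..nat \<lceil>C\<rceil>}"
    by auto linarith
  moreover have "finite (to_nat -` {..nat \<lceil>C\<rceil>} :: 'a set)"
    by (rule finite_vimageI) auto
  ultimately show ?thesis by (rule finite_subset)
qed

lemma half_power_sums:
  fixes I :: "'a::countable set"
  shows "(\<lambda>k. (1/2 :: real) ^ to_nat k) summable_on I" "(\<Sum>\<^sub>\<infinity>k\<in>I. (1/2 :: real) ^ to_nat k) \<le> 2"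
proof -
  have *: "((\<lambda>n. (1/2 :: real) ^ n) has_sum 2) UNIV"
    using geometric_sums[of "1/2 :: real"] by (intro sums_nonneg_imp_has_sum) auto
  have inj: "inj_on to_nat I" by (simp add: inj_on_def)
  have sub: "(\<lambda>n. (1/2 :: real) ^ n) summable_on to_nat ` I"
    by (rule summable_on_subset_banach[OF has_sum_imp_summable[OF *]]) simp
  then show "(\<lambda>k. (1/2 :: real) ^ to_nat k) summable_on I"
    by (simp add: summable_on_reindex[OF inj] o_def)
  have "(\<Sum>\<^sub>\<infinity>k\<in>I. (1/2 :: real) ^ to_nat k) = (\<Sum>\<^sub>\<infinity>n\<in>to_nat ` I. (1/2 :: real) ^ n)"
    by (simp add: infsum_reindex[OF inj] o_def)
  also have "\<dots> \<le> 2"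
    by (rule has_sum_mono2[OF has_sum_infsum[OF sub] *]) auto
  finally show "(\<Sum>\<^sub>\<infinity>k\<in>I. (1/2 :: real) ^ to_nat k) \<le> 2" .
qed

lemma sum_quarter_powers: "(\<Sum>j\<le>n. (t / 2 ^ j)\<^sup>2) \<le> 2 * (t :: real)\<^sup>2"
proof -
  have "(\<Sum>j\<le>n. (1/4 :: real) ^ j) = (1 - (1/4) ^ Suc n) / (1 - 1/4)"
    by (simp only: sum_gp0 lessThan_Suc_atMost[symmetric] sum_gp_strict) simp
  also have "\<dots> \<le> 1 / (1 - 1/4)" by (intro divide_right_mono) auto
  also have "\<dots> \<le> (2 :: real)" by simp
  finally have "t\<^sup>2 * (\<Sum>j\<le>n. (1/4 :: real) ^ j) \<le> t\<^sup>2 * 2" by (rule mult_left_mono) simp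
  moreover have "(t / 2 ^ j)\<^sup>2 = t\<^sup>2 * (1/4) ^ j" for j
    by (simp add: power_divide power2_eq_square flip: power_mult_distrib)
  ultimately show ?thesis by (simp add: sum_distrib_left)
qed

text \<open>The functions \<open>u j\<close> serve as coordinates. The factor \<open>1 / 2 ^ j\<close> in the last assumption makes the
  perturbations of all coordinates together small in \<open>l\<^sup>2\<close>.\<close>

locale approximation = normed_by q for q :: "'x::complex_vector \<Rightarrow> real" +
  fixes u :: "nat \<Rightarrow> 'x \<Rightarrow> real" and \<sigma> :: "nat \<Rightarrow> real"
    and f :: "'x \<Rightarrow> 'y::complex_banach" and v :: "nat \<Rightarrow> 'y" and \<epsilon> :: real
  assumes \<epsilon>_pos: "0 < \<epsilon>"
    and \<sigma>_pos: "\<And>j. 0 < \<sigma> j"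
    and u_nonneg: "\<And>j x. 0 \<le> u j x"
    and cover: "\<And>x. \<exists>j. u j x < \<sigma> j"
    and near: "\<And>j x. u j x < 4 * \<sigma> j \<Longrightarrow> norm (f x - v j) \<le> \<epsilon> / 2"
    and u_germ: "\<And>x. \<exists>K\<ge>0. \<forall>j \<delta>. 0 < \<delta> \<longrightarrow> \<delta> \<le> 1 \<longrightarrow>
      germ \<delta> (\<delta> * K / 2 ^ j) (\<lambda>h. complex_of_real (u j (x + h) - u j x))"
begin

text \<open>At most a third of each of the levels \<open>\<sigma> 0, \<dots>, \<sigma> n\<close>, so that moving by this distance
  cannot bridge the gaps of width \<open>\<sigma> j\<close> around the cells.\<close>

definition radius :: "nat \<Rightarrow> real" where
  "radius n = Min (\<sigma> ` {..n}) / 3"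

text \<open>With this mesh a grid cube in \<open>n + 1\<close> dimensions has diameter at most \<open>radius n\<close>.\<close>

definition mesh :: "nat \<Rightarrow> real" where
  "mesh n = radius n / real (Suc n)"

text \<open>A list \<open>k\<close> of \<open>n + 1\<close> numbers stands for a grid point in the coordinates \<open>0, \<dots>, n\<close>, and \<open>n\<close> is the index of the
  sublevel set on which it is used. As such lists form a countable type, the weights form a series.\<close>

definition depth :: "nat list \<Rightarrow> nat" where
  "depth k = length k - 1"

definition grid :: "nat list \<Rightarrow> nat \<Rightarrow> real" where
  "grid k j = mesh (depth k) * real (k ! j)"

text \<open>Each point \<open>x\<close> lies near a cell whose depth is the first \<open>n\<close> with \<open>u n x < 3 * \<sigma> n\<close>. The constants
  leave a gap on both sides: points with \<open>u j x < \<sigma> j\<close> stay away from all cells of depth greater than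
  \<open>j\<close>, and points near a cell of depth \<open>n\<close> satisfy \<open>u n x < 4 * \<sigma> n\<close>.\<close>

definition cells :: "nat list set" where
  "cells = {k. k \<noteq> [] \<and> (\<forall>j<depth k. 2 * \<sigma> j \<le> grid k j) \<and> grid k (depth k) \<le> 3 * \<sigma> (depth k)}"

definition sqdist :: "nat list \<Rightarrow> 'x \<Rightarrow> real" where
  "sqdist k x = (\<Sum>j\<le>depth k. (u j x - grid k j)\<^sup>2)"

text \<open>This bound enters the weights as a factor. The total weight at \<open>x\<close> then dominates
  \<open>norm (f x)\<close> up to \<open>\<epsilon>\<close>, so that an unbounded \<open>f\<close> needs no separate treatment.\<close>

definition size_bound :: "nat list \<Rightarrow> real" where
  "size_bound k = 1 + norm (v (depth k))"

definition error :: real where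
  "error = \<epsilon> / (8 * (2 + \<epsilon>))"

text \<open>The decay is required beyond \<open>radius\<^sup>2\<close>, which makes the weights of distant cells
  negligible everywhere, and beyond \<open>1 / (to_nat k + 1)\<close>, which gives local summability whatever the
  gap at a given point is, since finitely many cells can be neglected.\<close>

definition sharpness :: "nat list \<Rightarrow> real" where
  "sharpness k = (SOME \<kappa>. 0 < \<kappa> \<and>
    (\<forall>g \<ge> min ((radius (depth k))\<^sup>2) (1 / (real (to_nat k) + 1)).
      (size_bound k)\<^sup>2 * exp (- \<kappa> * g) \<le> error * (1/2) ^ to_nat k))"

definition weight :: "nat list \<Rightarrow> 'x \<Rightarrow> real" where
  "weight k x = size_bound k * exp (sharpness k * ((radius (depth k))\<^sup>2 - sqdist k x))"

lemma radius_pos: "0 < radius n"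
  using \<sigma>_pos by (auto simp: radius_def)

lemma mesh_pos: "0 < mesh n"
  using radius_pos by (simp add: mesh_def)

lemma radius_le: "j \<le> n \<Longrightarrow> 3 * radius n \<le> \<sigma> j"
  by (auto simp: radius_def intro: Min_le)

lemma radius_sq_le: "j \<le> n \<Longrightarrow> 8 * (radius n)\<^sup>2 \<le> (\<sigma> j)\<^sup>2"
proof -
  assume "j \<le> n"
  then have "9 * (radius n)\<^sup>2 \<le> (\<sigma> j)\<^sup>2"
    using power_mono[OF radius_le, of j n 2] radius_pos[of n] by (simp add: power_mult_distrib)
  then show ?thesis using zero_le_power2[of "radius n"] by linarith
qed

lemma mesh_le_radius: "mesh n \<le> radius n"
  using radius_pos[of n] by (simp add: mesh_def divide_le_eq mult_le_cancel_left1)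

lemma mesh_sq: "real (Suc n) * (mesh n)\<^sup>2 \<le> (radius n)\<^sup>2"
proof -
  have "real (Suc n) * (mesh n)\<^sup>2 = mesh n * radius n"
    by (simp add: mesh_def power2_eq_square)
  also have "\<dots> \<le> radius n * radius n"
    using mesh_le_radius radius_pos[of n] by (intro mult_right_mono) auto
  finally show ?thesis by (simp add: power2_eq_square)
qed

lemma size_bound_ge_1: "1 \<le> size_bound k"
  by (simp add: size_bound_def)

lemma size_bound_nonneg: "0 \<le> size_bound k"
  using size_bound_ge_1[of k] by linarith

lemma le_size_bound_mult: "0 \<le> a \<Longrightarrow> a \<le> size_bound k * a"
  using mult_right_mono[OF size_bound_ge_1, of a k] by simp

lemma error_pos: "0 < error"
  using \<epsilon>_pos by (simp add: error_def)

lemma sharpness: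
  shows sharpness_pos: "0 < sharpness k"
    and sharpness_decay: "(radius (depth k))\<^sup>2 \<le> g \<or> 1 / (real (to_nat k) + 1) \<le> g \<Longrightarrow>
      (size_bound k)\<^sup>2 * exp (- sharpness k * g) \<le> error * (1/2) ^ to_nat k"
proof -
  define g0 where "g0 = min ((radius (depth k))\<^sup>2) (1 / (real (to_nat k) + 1))"
  define e where "e = error * (1/2) ^ to_nat k"
  have g0: "0 < g0" using radius_pos[of "depth k"] by (simp add: g0_def)
  have e: "0 < e" using error_pos by (simp add: e_def)
  define L where "L = ln ((size_bound k)\<^sup>2 / e)"
  define \<kappa> where "\<kappa> = max 1 (L / g0)"
  have "(size_bound k)\<^sup>2 * exp (- \<kappa> * g) \<le> e" if "g0 \<le> g" for g
  proof -
    have "L \<le> \<kappa> * g0" using g0 by (simp add: \<kappa>_def flip: pos_divide_le_eq)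
    also have "\<dots> \<le> \<kappa> * g" using that unfolding \<kappa>_def by (intro mult_left_mono) auto
    finally have "exp (- \<kappa> * g) \<le> exp (- L)" by simp
    also have "\<dots> = e / (size_bound k)\<^sup>2"
      using e size_bound_ge_1[of k] by (simp add: L_def exp_minus)
    finally show ?thesis
      using size_bound_ge_1[of k] by (simp add: pos_le_divide_eq mult.commute)
  qed
  then have "\<exists>\<kappa>>0. \<forall>g\<ge>g0. (size_bound k)\<^sup>2 * exp (- \<kappa> * g) \<le> e"
    by (intro exI[of _ \<kappa>]) (auto simp: \<kappa>_def)
  from someI_ex[OF this[unfolded g0_def e_def]]
  have *: "0 < sharpness k \<and> (\<forall>g \<ge> min ((radius (depth k))\<^sup>2) (1 / (real (to_nat k) + 1)).
      (size_bound k)\<^sup>2 * exp (- sharpness k * g) \<le> error * (1/2) ^ to_nat k)"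
    unfolding sharpness_def by simp
  show "0 < sharpness k" using * by blast
  show "(size_bound k)\<^sup>2 * exp (- sharpness k * g) \<le> error * (1/2) ^ to_nat k"
    if "(radius (depth k))\<^sup>2 \<le> g \<or> 1 / (real (to_nat k) + 1) \<le> g"
  proof -
    have "min ((radius (depth k))\<^sup>2) (1 / (real (to_nat k) + 1)) \<le> g"
      using that by (simp add: min_le_iff_disj)
    then show ?thesis using * by blast
  qed
qed

lemma weight_pos: "0 < weight k x"
  using size_bound_ge_1[of k] by (simp add: weight_def)

lemma sqdist_term: "j \<le> depth k \<Longrightarrow> (u j x - grid k j)\<^sup>2 \<le> sqdist k x"
  unfolding sqdist_def by (rule member_le_sum) auto

lemma dominant_cell:
  "\<exists>k\<in>cells. size_bound k \<le> weight k x \<and> norm (f x - v (depth k)) \<le> \<epsilon> / 2"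
proof -
  obtain i where "u i x < \<sigma> i" using cover by blast
  then have "u i x < 3 * \<sigma> i" using \<sigma>_pos[of i] by linarith
  then have ex: "\<exists>n. u n x < 3 * \<sigma> n" by blast
  define n where "n = (LEAST n. u n x < 3 * \<sigma> n)"
  have n: "u n x < 3 * \<sigma> n" unfolding n_def by (rule LeastI_ex[OF ex])
  have before: "3 * \<sigma> j \<le> u j x" if "j < n" for j
    using not_less_Least[of j "\<lambda>n. u n x < 3 * \<sigma> n"] that unfolding n_def by linarith
  define k where "k = map (\<lambda>j. nat \<lfloor>u j x / mesh n\<rfloor>) [0..<Suc n]"
  have depth: "depth k = n" by (simp add: depth_def k_def)
  have grid: "grid k j = mesh n * real_of_int \<lfloor>u j x / mesh n\<rfloor>" if "j \<le> n" for j
  proof -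
    have "0 \<le> \<lfloor>u j x / mesh n\<rfloor>" using u_nonneg mesh_pos[of n] by simp
    then have "real (k ! j) = real_of_int \<lfloor>u j x / mesh n\<rfloor>"
      using that by (simp add: k_def del: upt_Suc)
    then show ?thesis by (simp add: grid_def depth)
  qed
  have le: "grid k j \<le> u j x" and gt: "u j x - mesh n < grid k j" if "j \<le> n" for j
  proof -
    have fl: "real_of_int \<lfloor>u j x / mesh n\<rfloor> \<le> u j x / mesh n" "u j x / mesh n - 1 < real_of_int \<lfloor>u j x / mesh n\<rfloor>"
      by linarith+
    show "grid k j \<le> u j x"
      using mult_left_mono[OF fl(1), of "mesh n"] mesh_pos[of n] by (simp add: grid[OF that])
    show "u j x - mesh n < grid k j"
      using mult_strict_left_mono[OF fl(2), of "mesh n"] mesh_pos[of n]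
      by (simp add: grid[OF that] right_diff_distrib)
  qed
  have "k \<in> cells"
    unfolding cells_def
  proof (intro CollectI conjI allI impI)
    show "k \<noteq> []" by (simp add: k_def)
    show "2 * \<sigma> j \<le> grid k j" if "j < depth k" for j
    proof -
      have j: "j < n" using that depth by simp
      have "mesh n \<le> \<sigma> j" using mesh_le_radius[of n] radius_le[of j n] radius_pos[of n] j by linarith
      then show ?thesis using gt[of j] before[OF j] j by simp
    qed
    show "grid k (depth k) \<le> 3 * \<sigma> (depth k)"
      using le[of n] n depth by simp
  qed
  moreover have "sqdist k x \<le> (radius n)\<^sup>2"
  proof -
    have "sqdist k x \<le> (\<Sum>j\<le>n. (mesh n)\<^sup>2)"
      unfolding sqdist_def depth
    proof (rule sum_mono)
      fix j assume "j \<in> {..n}"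
      then show "(u j x - grid k j)\<^sup>2 \<le> (mesh n)\<^sup>2"
        using le[of j] gt[of j] by (intro power_mono) auto
    qed
    also have "\<dots> = real (Suc n) * (mesh n)\<^sup>2" by simp
    finally show ?thesis using mesh_sq[of n] by linarith
  qed
  then have "size_bound k \<le> weight k x"
    using size_bound_ge_1[of k] sharpness_pos[of k] by (simp add: weight_def depth)
  moreover have "norm (f x - v (depth k)) \<le> \<epsilon> / 2"
    using near[of n x] n \<sigma>_pos[of n] depth by simp
  ultimately show ?thesis by blast
qed

text \<open>With \<open>e\<close> the \<open>j\<close>-th coordinate of the distance vector and \<open>t\<close> a majorant of its perturbation, the change of \<open>e\<^sup>2\<close>
  is majorized by \<open>2 * \<bar>e\<bar> * t + t\<^sup>2 \<le> e\<^sup>2 / 2 + 3 * t\<^sup>2\<close>. Half of the squared distance thus survives in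
  the exponent, with an error that does not depend on the cell.\<close>

lemma weight_germ:
  assumes \<delta>: "0 < \<delta>" "\<delta> \<le> 1" and K: "0 \<le> K"
    and u: "\<And>j. germ \<delta> (\<delta> * K / 2 ^ j) (\<lambda>h. complex_of_real (u j (x + h) - u j x))"
  shows "germ \<delta> (size_bound k *
      exp (- sharpness k * (sqdist k x / 2 - (radius (depth k))\<^sup>2 - 6 * (\<delta> * K)\<^sup>2)))
    (\<lambda>h. complex_of_real (weight k (x + h)))"
proof -
  define t where "t j = \<delta> * K / 2 ^ j" for j
  define e where "e j = u j x - grid k j" for j
  have summand: "germ \<delta> ((e j)\<^sup>2 / 2 + 3 * (t j)\<^sup>2)
      (\<lambda>h. complex_of_real ((u j (x + h) - grid k j)\<^sup>2 - (u j x - grid k j)\<^sup>2))" for j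
  proof -
    have uj: "germ \<delta> (t j) (\<lambda>h. complex_of_real (u j (x + h) - u j x))"
      using u by (simp add: t_def)
    have "germ \<delta> (cmod (complex_of_real (2 * e j)) * t j + t j ^ 2)
        (\<lambda>h. complex_of_real (2 * e j) * complex_of_real (u j (x + h) - u j x)
          + complex_of_real (u j (x + h) - u j x) ^ 2)"
      by (rule germ_add[OF \<delta>(1) germ_cmult[OF \<delta>(1) uj] germ_power[OF \<delta>(1) uj]])
    moreover have "cmod (complex_of_real (2 * e j)) * t j + (t j)\<^sup>2 \<le> (e j)\<^sup>2 / 2 + 3 * (t j)\<^sup>2"
    proof -
      have "0 \<le> (\<bar>e j\<bar> - 2 * t j)\<^sup>2" by simp
      then have "4 * (\<bar>e j\<bar> * t j) \<le> (e j)\<^sup>2 + 4 * (t j)\<^sup>2"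
        by (simp add: power2_diff power_mult_distrib algebra_simps)
      then show ?thesis by (simp add: norm_mult)
    qed
    moreover have "complex_of_real (2 * e j) * complex_of_real (u j (x + h) - u j x)
          + complex_of_real (u j (x + h) - u j x) ^ 2
        = complex_of_real ((u j (x + h) - grid k j)\<^sup>2 - (u j x - grid k j)\<^sup>2)" for h
      by (simp flip: of_real_mult of_real_add of_real_power)
        (simp add: e_def power2_eq_square algebra_simps)
    ultimately show ?thesis
      by (auto intro: germ_mono elim: germ_cong)
  qed
  have "germ \<delta> (\<Sum>j\<le>depth k. (e j)\<^sup>2 / 2 + 3 * (t j)\<^sup>2)
      (\<lambda>h. \<Sum>j\<le>depth k. complex_of_real ((u j (x + h) - grid k j)\<^sup>2 - (u j x - grid k j)\<^sup>2))"
    by (rule germ_sum[OF \<delta>(1) _ summand]) simp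
  moreover have "(\<Sum>j\<le>depth k. (e j)\<^sup>2 / 2 + 3 * (t j)\<^sup>2) \<le> sqdist k x / 2 + 6 * (\<delta> * K)\<^sup>2"
    using sum_quarter_powers[where t = "\<delta> * K" and n = "depth k"]
    by (simp add: sum.distrib sqdist_def e_def t_def flip: sum_divide_distrib sum_distrib_left)
  ultimately have diff: "germ \<delta> (sqdist k x / 2 + 6 * (\<delta> * K)\<^sup>2)
      (\<lambda>h. complex_of_real (sqdist k (x + h) - sqdist k x))"
    by (auto simp: sqdist_def sum_subtractf intro: germ_mono)
  define A where "A = size_bound k * exp (sharpness k * ((radius (depth k))\<^sup>2 - sqdist k x))"
  have "germ \<delta> (cmod (complex_of_real A) *
        exp (cmod (complex_of_real (- sharpness k)) * (sqdist k x / 2 + 6 * (\<delta> * K)\<^sup>2)))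
      (\<lambda>h. complex_of_real A *
        exp (complex_of_real (- sharpness k) * complex_of_real (sqdist k (x + h) - sqdist k x)))"
    by (intro germ_cmult germ_exp \<delta>(1) diff)
  moreover have "cmod (complex_of_real A) *
        exp (cmod (complex_of_real (- sharpness k)) * (sqdist k x / 2 + 6 * (\<delta> * K)\<^sup>2))
      = size_bound k * exp (- sharpness k * (sqdist k x / 2 - (radius (depth k))\<^sup>2 - 6 * (\<delta> * K)\<^sup>2))"
    using size_bound_ge_1[of k] sharpness_pos[of k]
    by (simp add: A_def norm_mult abs_mult flip: exp_add) (simp add: algebra_simps)
  moreover have "complex_of_real A *
        exp (complex_of_real (- sharpness k) * complex_of_real (sqdist k (x + h) - sqdist k x))
      = complex_of_real (weight k (x + h))" for h
  proof -
    have "A * exp (- sharpness k * (sqdist k (x + h) - sqdist k x)) = weight k (x + h)"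
      by (simp add: A_def weight_def flip: exp_add) (simp add: algebra_simps)
    then show ?thesis
      by (simp only: exp_of_real flip: of_real_mult)
  qed
  ultimately show ?thesis by simp
qed

lemma finite_near_cells: "finite {k \<in> cells. depth k \<le> m \<and> sqdist k x < R}"
proof (rule finite_subset)
  define b where "b n = nat \<lceil>((\<Sum>j\<le>m. u j x) + (\<bar>R\<bar> + 1)) / mesh n\<rceil>" for n
  show "{k \<in> cells. depth k \<le> m \<and> sqdist k x < R}
      \<subseteq> (\<Union>n\<le>m. {k. set k \<subseteq> {..b n} \<and> length k = Suc n})"
  proof
    fix k assume "k \<in> {k \<in> cells. depth k \<le> m \<and> sqdist k x < R}"
    then have k: "k \<noteq> []" "depth k \<le> m" "sqdist k x < R" by (auto simp: cells_def)
    have len: "length k = Suc (depth k)" using k by (cases k) (auto simp: depth_def)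
    have "set k \<subseteq> {..b (depth k)}"
    proof
      fix i assume "i \<in> set k"
      then obtain j where j: "j \<le> depth k" "i = k ! j"
        using len by (auto simp: in_set_conv_nth less_Suc_eq_le)
      have "(u j x - grid k j)\<^sup>2 \<le> (\<bar>R\<bar> + 1)\<^sup>2"
        using sqdist_term[OF j(1), of x] k(3) by (auto simp: power2_sum) (use zero_le_power2[of R] in linarith)
      then have "\<bar>u j x - grid k j\<bar> \<le> \<bar>R\<bar> + 1"
        using abs_le_square_iff[of "u j x - grid k j" "\<bar>R\<bar> + 1"] by simp
      moreover have "u j x \<le> (\<Sum>j\<le>m. u j x)"
        using j k by (intro member_le_sum) (auto simp: u_nonneg)
      ultimately have "grid k j \<le> (\<Sum>j\<le>m. u j x) + (\<bar>R\<bar> + 1)" by linarith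
      then have "real i \<le> ((\<Sum>j\<le>m. u j x) + (\<bar>R\<bar> + 1)) / mesh (depth k)"
        using mesh_pos[of "depth k"] by (simp add: grid_def j pos_le_divide_eq mult.commute)
      then show "i \<in> {..b (depth k)}" unfolding b_def by simp linarith
    qed
    then show "k \<in> (\<Union>n\<le>m. {k. set k \<subseteq> {..b n} \<and> length k = Suc n})"
      using k len by blast
  qed
  show "finite (\<Union>n\<le>m. {k. set k \<subseteq> {..b n} \<and> length k = Suc n})"
    by (intro finite_UN_I finite_lists_length_eq) auto
qed

text \<open>If \<open>u m x < \<sigma> m\<close>, cells of depth greater than \<open>m\<close> have distance at least \<open>\<sigma> m\<close> from \<open>x\<close>, and only
  finitely many of the others are near \<open>x\<close>. So a fixed negative exponent remains for all but
  finitely many cells once \<open>\<delta>\<close> is small against \<open>\<sigma> m\<close>.\<close>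

lemma local_majorants:
  "\<exists>\<delta> B. 0 < \<delta> \<and> \<delta> \<le> 1 \<and> (\<forall>k. germ \<delta> (B k) (\<lambda>h. complex_of_real (weight k (x + h)))) \<and>
    (\<lambda>k. size_bound k * B k) summable_on cells"
proof -
  obtain K where K: "0 \<le> K" "\<And>j \<delta>. 0 < \<delta> \<Longrightarrow> \<delta> \<le> 1 \<Longrightarrow>
      germ \<delta> (\<delta> * K / 2 ^ j) (\<lambda>h. complex_of_real (u j (x + h) - u j x))"
    using u_germ[of x] by blast
  obtain m where m: "u m x < \<sigma> m" using cover by blast
  define s where "s = \<sigma> m"
  have s: "0 < s" using \<sigma>_pos by (simp add: s_def)
  \<comment> \<open>Since \<open>6 / 7\<^sup>2 < 1 / 8\<close>, the loss \<open>6 * (\<delta> * K)\<^sup>2\<close> in the exponent stays below \<open>s\<^sup>2 / 8\<close>.\<close>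
  define \<delta> where "\<delta> = min 1 (s / (7 * (K + 1)))"
  have \<delta>: "0 < \<delta>" "\<delta> \<le> 1" using s K(1) by (auto simp: \<delta>_def)
  have small: "6 * (\<delta> * K)\<^sup>2 \<le> s\<^sup>2 / 8"
  proof -
    have "\<delta> * K \<le> s / (7 * (K + 1)) * (K + 1)"
      using s K(1) by (intro mult_mono) (auto simp: \<delta>_def)
    also have "\<dots> = s / 7" using K(1) by (simp add: field_simps)
    finally have "(\<delta> * K)\<^sup>2 \<le> (s / 7)\<^sup>2" using \<delta> K(1) by (intro power_mono) auto
    also have "\<dots> = s\<^sup>2 / 49" by (simp add: power_divide)
    finally show ?thesis using zero_le_power2[of "\<delta> * K"] by linarith
  qed
  define g where "g k = sqdist k x / 2 - (radius (depth k))\<^sup>2 - 6 * (\<delta> * K)\<^sup>2" for k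
  define B where "B k = size_bound k * exp (- sharpness k * g k)" for k
  have germ: "germ \<delta> (B k) (\<lambda>h. complex_of_real (weight k (x + h)))" for k
    unfolding B_def g_def by (rule weight_germ[OF \<delta> K(1) K(2)[OF \<delta>]])
  define R where "R = (\<sigma> 0)\<^sup>2 / 4 + s\<^sup>2"
  define E where "E = {k \<in> cells. depth k \<le> m \<and> sqdist k x < R} \<union> {k. real (to_nat k) < 4 / s\<^sup>2}"
  have "finite E" unfolding E_def using finite_near_cells finite_to_nat_less by blast
  have g_large: "1 / (real (to_nat k) + 1) \<le> g k" if "k \<in> cells - E" for k
  proof -
    have "s\<^sup>2 / 4 \<le> g k"
    proof (cases "depth k \<le> m")
      case True
      then have "R \<le> sqdist k x" using that by (auto simp: E_def)
      moreover have "8 * (radius (depth k))\<^sup>2 \<le> (\<sigma> 0)\<^sup>2" by (rule radius_sq_le) simp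
      ultimately show ?thesis
        using small zero_le_power2[of s] unfolding g_def R_def by linarith
    next
      case False
      then have "2 * s \<le> grid k m" using that by (auto simp: cells_def s_def)
      then have "s \<le> grid k m - u m x" using m by (simp add: s_def)
      then have "s\<^sup>2 \<le> (u m x - grid k m)\<^sup>2"
        using s power_mono[of s "grid k m - u m x" 2] by (simp add: power2_commute)
      also have "\<dots> \<le> sqdist k x" using False by (intro sqdist_term) simp
      finally have "s\<^sup>2 \<le> sqdist k x" .
      moreover have "8 * (radius (depth k))\<^sup>2 \<le> s\<^sup>2"
        unfolding s_def using False by (intro radius_sq_le) simp
      ultimately show ?thesis using small unfolding g_def by (simp add: field_simps)
    qed
    moreover have "4 / s\<^sup>2 \<le> real (to_nat k) + 1"
      using that by (auto simp: E_def)
    then have "1 / (real (to_nat k) + 1) \<le> s\<^sup>2 / 4"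
      using s by (simp add: field_simps)
    ultimately show ?thesis by linarith
  qed
  have "(\<lambda>k. size_bound k * B k) summable_on (cells - E)"
  proof (rule summable_on_comparison_test)
    show "(\<lambda>k. error * (1/2) ^ to_nat k) summable_on (cells - E)"
      by (rule summable_on_cmult_right[OF half_power_sums(1)])
    fix k assume "k \<in> cells - E"
    then show "size_bound k * B k \<le> error * (1/2) ^ to_nat k"
      using sharpness_decay[of k "g k"] g_large by (simp add: B_def power2_eq_square mult_ac)
    show "0 \<le> size_bound k * B k"
      using size_bound_ge_1[of k] by (simp add: B_def)
  qed
  then have "(\<lambda>k. size_bound k * B k) summable_on ((cells - E) \<union> (cells \<inter> E))"
    using \<open>finite E\<close> by (intro summable_on_union) auto
  also have "(cells - E) \<union> (cells \<inter> E) = cells" by blast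
  finally show ?thesis using \<delta> germ by blast
qed

definition total_weight :: "'x \<Rightarrow> real" where
  "total_weight x = (\<Sum>\<^sub>\<infinity>k\<in>cells. weight k x)"

definition weighted_values :: "'x \<Rightarrow> 'y" where
  "weighted_values x = (\<Sum>\<^sub>\<infinity>k\<in>cells. weight k x *\<^sub>R v (depth k))"

lemma weights_summable:
  shows "(\<lambda>k. size_bound k * weight k x) summable_on cells"
    and "(\<lambda>k. weight k x) summable_on cells"
    and "(\<lambda>k. weight k x *\<^sub>R v (depth k)) summable_on cells"
proof -
  obtain \<delta> B where B: "0 < \<delta>" "\<And>k. germ \<delta> (B k) (\<lambda>h. complex_of_real (weight k (x + h)))"
    "(\<lambda>k. size_bound k * B k) summable_on cells"
    using local_majorants[of x] by blast
  have le: "weight k x \<le> B k" for k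
    using germ_norm_le[OF B(2), of 0 k] B(1) weight_pos[of k x] by simp
  show 1: "(\<lambda>k. size_bound k * weight k x) summable_on cells"
    by (rule summable_on_comparison_test[OF B(3)])
      (use le weight_pos[of _ x, THEN less_imp_le] size_bound_nonneg in \<open>auto intro!: mult_left_mono mult_nonneg_nonneg\<close>)
  show "(\<lambda>k. weight k x) summable_on cells"
    by (rule summable_on_comparison_test[OF 1])
      (use weight_pos[of _ x, THEN less_imp_le] le_size_bound_mult in auto)
  have "(\<lambda>k. norm (weight k x *\<^sub>R v (depth k))) summable_on cells"
  proof (rule Infinite_Sum.abs_summable_on_comparison_test'[OF 1])
    fix k
    show "norm (weight k x *\<^sub>R v (depth k)) \<le> size_bound k * weight k x"
      using weight_pos[of k x] by (simp add: size_bound_def algebra_simps)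
  qed
  then show "(\<lambda>k. weight k x *\<^sub>R v (depth k)) summable_on cells"
    by (rule abs_summable_summable)
qed

lemma total_weight_ge: "k \<in> cells \<Longrightarrow> weight k x \<le> total_weight x"
  unfolding total_weight_def
  using finite_sum_le_infsum[OF weights_summable(2), of "{k}" x] weight_pos[of _ x, THEN less_imp_le]
  by simp

lemma total_weight_ge_1: "1 \<le> total_weight x"
  using dominant_cell[of x] total_weight_ge[of _ x] size_bound_ge_1 by (meson order_trans)

text \<open>Near cells carry values within \<open>\<epsilon> / 2\<close> of \<open>f x\<close>. For the others the factor \<open>size_bound k0\<close>
  coming from the norm of \<open>f x\<close> is compensated by the weight of the dominant cell \<open>k0\<close>.\<close>

lemma weighted_error:
  "norm (weighted_values x - total_weight x *\<^sub>R f x) < \<epsilon> * total_weight x"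
proof -
  obtain k0 where k0: "k0 \<in> cells" "size_bound k0 \<le> weight k0 x" "norm (f x - v (depth k0)) \<le> \<epsilon> / 2"
    using dominant_cell[of x] by blast
  define C where "C = size_bound k0 * (2 + \<epsilon>)"
  have C: "0 \<le> C" using size_bound_ge_1[of k0] \<epsilon>_pos by (simp add: C_def)
  have fx: "norm (f x) \<le> size_bound k0 + \<epsilon> / 2"
    using k0(3) norm_triangle_ineq2[of "f x" "v (depth k0)"] by (simp add: size_bound_def)
  have summand: "norm (weight k x *\<^sub>R (v (depth k) - f x))
      \<le> \<epsilon> / 2 * weight k x + C * (error * (1/2) ^ to_nat k)" if k: "k \<in> cells" for k
  proof (cases "sqdist k x < 2 * (radius (depth k))\<^sup>2")
    case True
    let ?n = "depth k"
    have "(u ?n x - grid k ?n)\<^sup>2 < (\<sigma> ?n)\<^sup>2"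
      using sqdist_term[of ?n k x] True radius_sq_le[of ?n ?n] radius_pos[of ?n]
      by (smt (verit) order_refl zero_less_power2)
    then have "\<bar>u ?n x - grid k ?n\<bar> < \<sigma> ?n"
      using \<sigma>_pos[of ?n] by (simp add: abs_square_less_1 power2_less_imp_less[of "\<bar>_\<bar>"])
    then have "u ?n x < 4 * \<sigma> ?n" using k by (auto simp: cells_def)
    from near[OF this] have "norm (v ?n - f x) \<le> \<epsilon> / 2" by (simp add: norm_minus_commute)
    then have "norm (weight k x *\<^sub>R (v ?n - f x)) \<le> \<epsilon> / 2 * weight k x"
      using weight_pos[of k x] by (simp add: mult.commute)
    moreover have "0 \<le> C * (error * (1/2) ^ to_nat k)" using C error_pos by simp
    ultimately show ?thesis by linarith
  next
    case False
    have c: "1 \<le> size_bound k" "1 \<le> size_bound k0" by (rule size_bound_ge_1)+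
    have "norm (v (depth k) - f x) \<le> norm (v (depth k)) + norm (f x)" by (rule norm_triangle_ineq4)
    also have "\<dots> \<le> size_bound k + size_bound k0 + \<epsilon>"
      using fx \<epsilon>_pos by (simp add: size_bound_def)
    also have "\<dots> \<le> size_bound k * size_bound k0 + size_bound k * size_bound k0
        + size_bound k * size_bound k0 * \<epsilon>"
    proof (intro add_mono)
      have 1: "1 * 1 \<le> size_bound k * size_bound k0" using c by (intro mult_mono) auto
      show "size_bound k \<le> size_bound k * size_bound k0" "size_bound k0 \<le> size_bound k * size_bound k0"
        using c by auto
      show "\<epsilon> \<le> size_bound k * size_bound k0 * \<epsilon>" using 1 \<epsilon>_pos by auto
    qed
    also have "\<dots> = size_bound k * C" by (simp add: C_def algebra_simps)
    finally have "norm (weight k x *\<^sub>R (v (depth k) - f x)) \<le> weight k x * (size_bound k * C)"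
      using weight_pos[of k x] by simp
    also have "\<dots> = C * ((size_bound k)\<^sup>2 * exp (- sharpness k * (sqdist k x - (radius (depth k))\<^sup>2)))"
      by (simp add: weight_def power2_eq_square algebra_simps)
    also have "\<dots> \<le> C * (error * (1/2) ^ to_nat k)"
      using C False by (intro mult_left_mono sharpness_decay) auto
    finally show ?thesis using weight_pos[of k x] \<epsilon>_pos
      by (smt (verit) mult_pos_pos half_gt_zero)
  qed
  have lhs: "((\<lambda>k. weight k x *\<^sub>R (v (depth k) - f x)) has_sum (weighted_values x - total_weight x *\<^sub>R f x)) cells"
  proof -
    have "((\<lambda>k. weight k x *\<^sub>R v (depth k) + weight k x *\<^sub>R (- f x)) has_sum
        (weighted_values x + total_weight x *\<^sub>R (- f x))) cells"
      unfolding weighted_values_def total_weight_def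
      by (intro has_sum_add has_sum_infsum weights_summable has_sum_bounded_linear[OF bounded_linear_scaleR_left])
    then show ?thesis by (simp add: algebra_simps)
  qed
  define Z where "Z = (\<Sum>\<^sub>\<infinity>k\<in>cells. (1/2 :: real) ^ to_nat k)"
  have rhs: "((\<lambda>k. \<epsilon> / 2 * weight k x + C * (error * (1/2) ^ to_nat k)) has_sum
      (\<epsilon> / 2 * total_weight x + C * (error * Z))) cells"
    unfolding total_weight_def Z_def
    by (intro has_sum_add has_sum_cmult_right has_sum_infsum weights_summable half_power_sums)
  have "norm (weighted_values x - total_weight x *\<^sub>R f x) \<le> \<epsilon> / 2 * total_weight x + C * (error * Z)"
    by (rule norm_infsum_le[OF lhs rhs summand])
  also have "C * (error * Z) \<le> C * (error * 2)"
    unfolding Z_def using half_power_sums(2) C error_pos by (intro mult_left_mono) auto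
  also have "C * (error * 2) = size_bound k0 * (\<epsilon> / 4)"
    using \<epsilon>_pos by (simp add: C_def error_def field_simps)
  also have "size_bound k0 * (\<epsilon> / 4) \<le> total_weight x * (\<epsilon> / 4)"
    using k0 total_weight_ge[OF k0(1), of x] \<epsilon>_pos by (intro mult_right_mono) auto
  also have "\<epsilon> / 2 * total_weight x + total_weight x * (\<epsilon> / 4) < \<epsilon> * total_weight x"
    using \<epsilon>_pos total_weight_ge_1[of x] by (simp add: algebra_simps)
  finally show ?thesis by simp
qed

definition approximant :: "'x \<Rightarrow> 'y" where
  "approximant x = (1 / total_weight x) *\<^sub>R weighted_values x"

lemma approximant_close: "norm (f x - approximant x) < \<epsilon>"
proof -
  have S: "0 < total_weight x" using total_weight_ge_1[of x] by linarith
  have "f x - approximant x = (1 / total_weight x) *\<^sub>R (total_weight x *\<^sub>R f x - weighted_values x)"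
    using S by (simp add: approximant_def scaleR_diff_right)
  then have "norm (f x - approximant x)
      = norm (weighted_values x - total_weight x *\<^sub>R f x) / total_weight x"
    using S by (simp add: norm_minus_commute)
  also have "\<dots> < \<epsilon>" using weighted_error[of x] S by (simp add: pos_divide_less_eq)
  finally show ?thesis .
qed

text \<open>The total weight is at least \<open>1\<close>, and its variation has small germ norm on a small ball, so its
  inverse is a geometric series.\<close>

lemma approximant_germ: "\<exists>\<delta>>0. \<exists>M. germ \<delta> M (\<lambda>h. approximant (x + h))"
proof -
  obtain \<delta> B where \<delta>: "0 < \<delta>" and B: "\<And>k. germ \<delta> (B k) (\<lambda>h. complex_of_real (weight k (x + h)))"
    and sum: "(\<lambda>k. size_bound k * B k) summable_on cells"
    using local_majorants[of x] by blast
  have B0: "0 \<le> B k" for k using germ_nonneg[OF B] \<delta> by simp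
  have "B summable_on cells"
    by (rule summable_on_comparison_test[OF sum])
      (use B0 le_size_bound_mult in auto)
  from germ_infsum[OF \<delta> B this]
  have S: "germ \<delta> (infsum B cells) (\<lambda>h. complex_of_real (total_weight (x + h)))"
    by (simp add: total_weight_def infsumI[OF has_sum_of_real[OF has_sum_infsum[OF weights_summable(2)]]])
  have "germ \<delta> (size_bound k * B k) (\<lambda>h. weight k (x + h) *\<^sub>R v (depth k))" for k
  proof -
    have "germ \<delta> (B k * norm (v (depth k))) (\<lambda>h. weight k (x + h) *\<^sub>R v (depth k))"
      using germ_scaleC[OF \<delta> B germ_const[OF \<delta>]] by (simp add: scaleR_scaleC)
    then show ?thesis
      by (rule germ_mono) (use B0[of k] in \<open>simp add: size_bound_def algebra_simps\<close>)
  qed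
  from germ_infsum[OF \<delta> this sum]
  have N: "germ \<delta> (\<Sum>\<^sub>\<infinity>k\<in>cells. size_bound k * B k) (\<lambda>h. weighted_values (x + h))"
    by (simp add: weighted_values_def)
  define M where "M = infsum B cells"
  define s where "s = total_weight x"
  have s: "1 \<le> s" unfolding s_def by (rule total_weight_ge_1)
  have M: "0 \<le> M" using germ_nonneg[OF S] \<delta> by (simp add: M_def)
  define \<delta>' where "\<delta>' = \<delta> / (2 * (M + 1))"
  have \<delta>': "0 < \<delta>'" "\<delta>' \<le> \<delta>" using \<delta> M by (auto simp: \<delta>'_def field_simps)
  define g where "g h = complex_of_real (- 1 / s) * (complex_of_real (total_weight (x + h)) - complex_of_real s)" for h
  have "germ \<delta>' (\<delta>' / \<delta> * M) (\<lambda>h. complex_of_real (total_weight (x + h)) - complex_of_real s)"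
    using germ_recentre[OF S \<delta>'] by (simp add: s_def M_def)
  from germ_cmult[OF \<delta>'(1) this]
  have "germ \<delta>' (cmod (complex_of_real (- 1 / s)) * (\<delta>' / \<delta> * M)) g"
    unfolding g_def .
  moreover have "cmod (complex_of_real (- 1 / s)) * (\<delta>' / \<delta> * M) \<le> 1 / 2"
  proof -
    have "\<delta>' / \<delta> * M = M / (2 * (M + 1))" using \<delta> by (simp add: \<delta>'_def)
    also have "\<dots> \<le> 1 / 2" using M by (simp add: divide_le_eq)
    finally have "cmod (complex_of_real (- 1 / s)) * (\<delta>' / \<delta> * M) \<le> 1 * (1 / 2)"
      using s M \<delta> \<delta>' by (intro mult_mono) (auto simp: norm_divide)
    then show ?thesis by simp
  qed
  ultimately have "germ \<delta>' (1 / 2) g" by (rule germ_mono)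
  from germ_cmult[OF \<delta>'(1) germ_geometric[OF \<delta>'(1) this], of "complex_of_real (1 / s)"]
  have "germ \<delta>' (cmod (complex_of_real (1 / s)) * 2)
      (\<lambda>h. complex_of_real (1 / s) * (1 / (1 - g h)))" by simp
  from germ_scaleC[OF \<delta>'(1) this germ_restrict[OF N \<delta>']]
  have "\<exists>M. germ \<delta>' M (\<lambda>h. (complex_of_real (1 / s) * (1 / (1 - g h))) *\<^sub>C weighted_values (x + h))"
    by blast
  moreover have "(complex_of_real (1 / s) * (1 / (1 - g h))) *\<^sub>C weighted_values (x + h) = approximant (x + h)" for h
  proof -
    have "1 - g h = complex_of_real (total_weight (x + h) / s)"
      using s by (simp add: g_def field_simps)
    then have "complex_of_real (1 / s) * (1 / (1 - g h)) = complex_of_real (1 / total_weight (x + h))"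
      using s total_weight_ge_1[of "x + h"] by simp
    then show ?thesis by (simp only: approximant_def scaleR_scaleC)
  qed
  ultimately show ?thesis using \<delta>'(1) by auto
qed

end

section \<open>A separating real polynomial with controlled germs\<close>

context normed_by
begin

lemma monomial_scaled:
  assumes "monomial n b E" shows "E (t *\<^sub>R x) = t ^ n *\<^sub>R E x"
proof -
  obtain B where "real_multilinear n B" "\<And>x. E x = B (replicate n x)"
    by (rule monomialE[OF assms]) (rule that)
  then show ?thesis using real_multilinear_scaled by metis
qed

lemma small_near_0:
  assumes P: "continuous_map (norm_topology q) euclidean P" and P0: "P 0 = (0 :: complex)"
  shows "\<exists>\<eta>>0. \<forall>z. q z < \<eta> \<longrightarrow> cmod (P z) \<le> 1"
proof -
  interpret Metric_space UNIV "norm_dist q"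
    by (rule Metric_space_norm_dist[OF is_norm])
  have "openin mtopology {z \<in> topspace mtopology. P z \<in> ball 0 1}"
    using P unfolding norm_topology_def by (rule openin_continuous_map_preimage) simp
  then have "openin mtopology {z. cmod (P z) < 1}" by simp
  moreover have "0 \<in> {z. cmod (P z) < 1}" using P0 by simp
  ultimately obtain \<eta> where "0 < \<eta>" "mball 0 \<eta> \<subseteq> {z. cmod (P z) < 1}"
    unfolding openin_mtopology by blast
  then show ?thesis
    by (intro exI[of _ \<eta>]) (auto simp: norm_dist_def subset_iff intro: less_imp_le)
qed

text \<open>A \<open>*\<close>-polynomial may list several summands of the same degree, and their continuity is not
  assumed; only the sums over a fixed degree inherit it from \<open>P\<close>.\<close>

lemma homogeneous_components:
  assumes "star_polynomial (P :: 'x \<Rightarrow> complex)"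
  shows "\<exists>N E. (\<forall>j. homogeneous_star_polynomial j (E j)) \<and>
    (\<forall>t x. P (t *\<^sub>R x) = (\<Sum>j\<le>N. t ^ j *\<^sub>R E j x)) \<and> (\<forall>j t x. E j (t *\<^sub>R x) = t ^ j *\<^sub>R E j x)"
proof -
  obtain M :: nat and F where "\<forall>i<M. \<exists>n. homogeneous_star_polynomial n (F i)" and P: "\<And>x. P x = (\<Sum>i<M. F i x)"
    using assms unfolding star_polynomial_def by blast
  then have "\<forall>i\<in>{..<M}. \<exists>n B. real_multilinear n B \<and> (\<forall>x. F i x = B (replicate n x))"
    using real_multilinear_of_homogeneous_star_polynomial by blast
  from bchoice[OF this] obtain n where "\<forall>i\<in>{..<M}. \<exists>B. real_multilinear (n i) B \<and> (\<forall>x. F i x = B (replicate (n i) x))" ..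
  from bchoice[OF this] obtain B where B: "\<And>i. i < M \<Longrightarrow> real_multilinear (n i) (B i)"
    "\<And>i x. i < M \<Longrightarrow> F i x = B i (replicate (n i) x)" by blast
  define C where "C j xs = (\<Sum>i\<in>{i. i < M \<and> n i = j}. B i xs)" for j xs
  define E where "E j x = C j (replicate j x)" for j x
  have C: "real_multilinear j (C j)" for j
    unfolding C_def by (rule real_multilinear_sum) (use B in auto)
  have scaled: "E j (t *\<^sub>R x) = t ^ j *\<^sub>R E j x" for j t x
    unfolding E_def by (rule real_multilinear_scaled[OF C])
  have "P x = (\<Sum>j\<le>sum n {..<M}. E j x)" for x
  proof -
    have "P x = (\<Sum>i<M. B i (replicate (n i) x))" by (simp add: P B)
    also have "\<dots> = (\<Sum>j\<le>sum n {..<M}. \<Sum>i\<in>{i \<in> {..<M}. n i = j}. B i (replicate (n i) x))"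
      by (rule sum.group[symmetric]) (auto intro: member_le_sum)
    also have "\<dots> = (\<Sum>j\<le>sum n {..<M}. E j x)"
      unfolding E_def C_def by (intro sum.cong) auto
    finally show ?thesis .
  qed
  then have "P (t *\<^sub>R x) = (\<Sum>j\<le>sum n {..<M}. t ^ j *\<^sub>R E j x)" for t x
    by (simp add: scaled)
  moreover have "homogeneous_star_polynomial j (E j)" for j
    using homogeneous_star_polynomial_of_real_multilinear[OF C] by (simp add: E_def[abs_def])
  ultimately show ?thesis using scaled by blast
qed

text \<open>The components of \<open>P\<close> are combinations of the functions \<open>x \<mapsto> P (l x)\<close>, hence bounded near \<open>0\<close>
  because \<open>P\<close> is continuous, and then bounded by homogeneity. There is no component of degree \<open>0\<close>
  because \<open>P 0 = 0\<close>.\<close>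

lemma separating_monomials:
  assumes "separating_star_polynomial q P"
  shows "\<exists>N b (E :: nat \<Rightarrow> 'x \<Rightarrow> complex). (\<forall>i\<in>{1..N}. monomial i (b i) (E i)) \<and>
    (\<forall>z. q z = 1 \<longrightarrow> 1 \<le> (\<Sum>i = 1..N. cmod (E i z)))"
proof -
  have P: "star_polynomial P" "P 0 = 0" "\<And>z. q z = 1 \<Longrightarrow> 1 \<le> cmod (P z)"
    and cont: "continuous_map (norm_topology q) euclidean P"
    using assms unfolding separating_star_polynomial_def by auto
  obtain N E where E: "\<And>j. homogeneous_star_polynomial j (E j)"
    "\<And>t x. P (t *\<^sub>R x) = (\<Sum>j\<le>N. t ^ j *\<^sub>R E j x)" "\<And>j t x. E j (t *\<^sub>R x) = t ^ j *\<^sub>R E j x"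
    using homogeneous_components[OF P(1)] by blast
  obtain \<eta> where \<eta>: "0 < \<eta>" "\<And>z. q z < \<eta> \<Longrightarrow> cmod (P z) \<le> 1"
    using small_near_0[OF cont P(2)] by blast
  have "\<exists>b. monomial j b (E j)" if j: "j \<in> {1..N}" for j
  proof -
    obtain c :: "nat \<Rightarrow> real" where c: "\<And>A :: nat \<Rightarrow> complex.
        (\<Sum>l\<le>N. c l *\<^sub>R (\<Sum>i\<le>N. real l ^ i *\<^sub>R A i)) = A j"
      using coefficient_from_values[of j N] j by auto
    define \<Lambda> where "\<Lambda> = (\<Sum>l\<le>N. \<bar>c l\<bar>)"
    have \<Lambda>: "0 \<le> \<Lambda>" by (simp add: \<Lambda>_def sum_nonneg)
    define r where "r = \<eta> / (2 * (real N + 1))"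
    have r: "0 < r" using \<eta> by (simp add: r_def)
    have near: "cmod (E j x) \<le> \<Lambda>" if x: "q x = r" for x
    proof -
      have "E j x = (\<Sum>l\<le>N. c l *\<^sub>R P (real l *\<^sub>R x))" unfolding E(2) c ..
      also have "cmod \<dots> \<le> (\<Sum>l\<le>N. \<bar>c l\<bar>)"
      proof (rule sum_norm_le)
        fix l assume l: "l \<in> {..N}"
        have "q (real l *\<^sub>R x) \<le> real N * r"
          using l r x by (auto simp: q_scaleR intro: mult_right_mono)
        also have "\<dots> < \<eta>" using \<eta>(1) by (simp add: r_def field_simps add_nonneg_pos)
        finally have "cmod (P (real l *\<^sub>R x)) \<le> 1" by (rule \<eta>)
        then show "cmod (c l *\<^sub>R P (real l *\<^sub>R x)) \<le> \<bar>c l\<bar>"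
          by (simp add: mult_left_le)
      qed
      finally show ?thesis by (simp add: \<Lambda>_def)
    qed
    have "cmod (E j x) \<le> \<Lambda> / r ^ j * q x ^ j" for x
    proof (cases "x = 0")
      case True
      then show ?thesis using E(3)[of j 0 0] j by (simp add: power_0_left)
    next
      case False
      then have qx: "0 < q x" using q_zero_iff[of x] q_nonneg[of x] by linarith
      have "E j x = (q x / r) ^ j *\<^sub>R E j ((r / q x) *\<^sub>R x)"
        unfolding E(3)[symmetric] using qx r by simp
      then have "cmod (E j x) = (q x / r) ^ j * cmod (E j ((r / q x) *\<^sub>R x))"
        using qx r by simp
      also have "\<dots> \<le> (q x / r) ^ j * \<Lambda>"
        using qx r by (intro mult_left_mono near) (auto simp: q_scaleR)
      finally show ?thesis by (simp add: power_divide mult.commute)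
    qed
    then show ?thesis
      by (rule monomial_of_bound[OF E(1)]) (use \<Lambda> r in auto)
  qed
  then obtain b where b: "\<And>i. i \<in> {1..N} \<Longrightarrow> monomial i (b i) (E i)" by metis
  have "1 \<le> (\<Sum>i = 1..N. cmod (E i z))" if "q z = 1" for z
  proof -
    have "E 0 z = P (0 *\<^sub>R z)" unfolding E(2) by (simp add: power_0_left if_distrib[of "\<lambda>c. c *\<^sub>R _"] cong: if_cong)
    then have E0: "E 0 z = 0" using P(2) by simp
    have "P z = (\<Sum>j\<le>N. E j z)" using E(2)[of 1 z] by simp
    also have "\<dots> = (\<Sum>j = 1..N. E j z)"
      by (rule sum.mono_neutral_right) (use E0 in \<open>auto simp: not_less_eq_eq\<close>)
    finally have "cmod (P z) \<le> (\<Sum>i = 1..N. cmod (E i z))" by (simp add: norm_sum)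
    then show ?thesis using P(3)[OF that] by linarith
  qed
  then show ?thesis using b by blast
qed

text \<open>The modulus of \<open>P\<close> itself may vanish away from the unit sphere. The sum of the squared moduli of
  its components does not: by homogeneity a lower bound on the sphere propagates along rays.\<close>

lemma separating_real_polynomial:
  assumes "separating_star_polynomial q P"
  shows "\<exists>Q C D. 0 \<le> C \<and> (\<forall>x. 0 \<le> Q x) \<and>
    (\<forall>z. germ 1 (C * (1 + q z) ^ D) (\<lambda>h. complex_of_real (Q (z + h)))) \<and>
    (\<forall>e>0. \<exists>\<delta>>0. \<forall>x. q x < \<delta> \<longrightarrow> Q x < e) \<and>
    (\<forall>r>0. \<exists>c>0. \<forall>x. Q x < c \<longrightarrow> q x < r)"
proof -
  obtain N b and E :: "nat \<Rightarrow> 'x \<Rightarrow> complex"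
    where E: "\<And>i. i \<in> {1..N} \<Longrightarrow> monomial i (b i) (E i)"
      "\<And>z. q z = 1 \<Longrightarrow> 1 \<le> (\<Sum>i = 1..N. cmod (E i z))"
    using separating_monomials[OF assms] by blast
  define Q where "Q x = (\<Sum>i = 1..N. (cmod (E i x))\<^sup>2)" for x
  define C where "C = (\<Sum>i = 1..N. (b i)\<^sup>2)"
  have C: "0 \<le> C" by (simp add: C_def sum_nonneg)
  have Q0: "0 \<le> Q x" for x by (simp add: Q_def sum_nonneg)
  have germ: "germ 1 (C * (1 + q z) ^ (2 * N)) (\<lambda>h. complex_of_real (Q (z + h)))" for z
  proof -
    have "germ 1 ((b i)\<^sup>2 * (1 + q z) ^ (2 * N)) (\<lambda>h. complex_of_real ((cmod (E i (z + h)))\<^sup>2))"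
      if i: "i \<in> {1..N}" for i
    proof -
      have "germ 1 (b i * (q z + 1) ^ i * (b i * (q z + 1) ^ i)) (\<lambda>h. E i (z + h) * cnj (E i (z + h)))"
        using E(1)[OF i]
        by (intro germ_mult germ_translated_monomial[where E = "E i"]
            germ_translated_monomial[where E = "\<lambda>x. cnj (E i x)"] monomial_cnj) auto
      moreover have "b i * (q z + 1) ^ i * (b i * (q z + 1) ^ i) \<le> (b i)\<^sup>2 * (1 + q z) ^ (2 * N)"
      proof -
        have "b i * (q z + 1) ^ i * (b i * (q z + 1) ^ i) = (b i)\<^sup>2 * (1 + q z) ^ (2 * i)"
          by (simp add: power2_eq_square mult_2 mult_2_right power_add mult_ac add.commute)
        also have "\<dots> \<le> (b i)\<^sup>2 * (1 + q z) ^ (2 * N)"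
          using i by (intro mult_left_mono power_increasing) auto
        finally show ?thesis .
      qed
      ultimately have "germ 1 ((b i)\<^sup>2 * (1 + q z) ^ (2 * N)) (\<lambda>h. E i (z + h) * cnj (E i (z + h)))"
        by (rule germ_mono)
      then show ?thesis by (simp only: complex_norm_square)
    qed
    then have "germ 1 (\<Sum>i = 1..N. (b i)\<^sup>2 * (1 + q z) ^ (2 * N))
        (\<lambda>h. \<Sum>i = 1..N. complex_of_real ((cmod (E i (z + h)))\<^sup>2))"
      by (intro germ_sum) auto
    then show ?thesis by (simp add: Q_def C_def sum_distrib_right)
  qed
  have small: "\<exists>\<delta>>0. \<forall>x. q x < \<delta> \<longrightarrow> Q x < e" if e: "0 < e" for e
  proof -
    define \<delta> where "\<delta> = min 1 (e / (2 * (C + 1)))"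
    have \<delta>: "0 < \<delta>" "\<delta> \<le> 1" using e C by (auto simp: \<delta>_def)
    have "Q 0 = 0" unfolding Q_def using monomial_at_0[OF E(1)] by (intro sum.neutral) auto
    then have g: "germ \<delta> (\<delta> * C) (\<lambda>h. complex_of_real (Q h))"
      using germ_recentre[OF germ[of 0] \<delta>] by simp
    have "\<delta> * C \<le> e / (2 * (C + 1)) * C" using C by (intro mult_right_mono) (auto simp: \<delta>_def)
    also have "\<dots> < e" using e C by (simp add: field_simps add_nonneg_pos)
    finally have "Q x < e" if "q x < \<delta>" for x
      using germ_norm_le[OF g, of x] that Q0[of x] by simp
    then show ?thesis using \<delta> by blast
  qed
  have large: "\<exists>c>0. \<forall>x. Q x < c \<longrightarrow> q x < r" if r: "0 < r" for r
  proof -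
    define s where "s = min 1 r"
    have s: "0 < s" "s \<le> 1" using r by (auto simp: s_def)
    define c where "c = (s ^ N / (real N + 1))\<^sup>2"
    have "c \<le> Q x" if x: "r \<le> q x" for x
    proof -
      have qx: "0 < q x" using r x by linarith
      define z where "z = (1 / q x) *\<^sub>R x"
      have "q z = 1" using qx by (simp add: z_def q_scaleR)
      have "\<exists>i\<in>{1..N}. 1 / (real N + 1) \<le> cmod (E i z)"
      proof (rule ccontr)
        assume "\<not> ?thesis"
        then have "(\<Sum>i = 1..N. cmod (E i z)) \<le> (\<Sum>i = 1..N. 1 / (real N + 1))"
          by (intro sum_mono) force
        also have "\<dots> < 1" by simp
        finally show False using E(2)[OF \<open>q z = 1\<close>] by linarith
      qed
      then obtain i where i: "i \<in> {1..N}" "1 / (real N + 1) \<le> cmod (E i z)" by blast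
      have "s ^ N \<le> s ^ i" using i s by (intro power_decreasing) auto
      also have "\<dots> \<le> q x ^ i" using s x by (intro power_mono) (auto simp: s_def)
      finally have "s ^ N * (1 / (real N + 1)) \<le> q x ^ i * cmod (E i z)"
        using i s by (intro mult_mono) auto
      also have "\<dots> = cmod (E i x)"
        using monomial_scaled[OF E(1)[OF i(1)], of "1 / q x" x] qx
        by (simp add: z_def power_one_over field_simps)
      finally have "c \<le> (cmod (E i x))\<^sup>2"
        unfolding c_def using s by (intro power_mono) auto
      also have "\<dots> \<le> Q x" unfolding Q_def using i by (intro member_le_sum) auto
      finally show ?thesis .
    qed
    moreover have "0 < c" using s by (simp add: c_def)
    ultimately show ?thesis by (meson not_less)
  qed
  show ?thesis using C Q0 germ small large by blast
qed

section \<open>The approximation theorem\<close>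

text \<open>The multiples \<open>\<alpha> j\<close> of \<open>Q (x - x\<^sub>j)\<close> compensate for the growth of its germ with \<open>q x\<^sub>j\<close>, so that the germs become
  summable in \<open>j\<close> at every \<open>x\<close>.\<close>

theorem star_analytic_approximation:
  fixes f :: "'x \<Rightarrow> 'y::complex_banach"
  assumes T: "complex_vector_topology T" and q: "continuous_map T euclideanreal q"
    and sep: "separable_topology T" and P: "separating_star_polynomial q P"
    and f: "\<And>x e. 0 < e \<Longrightarrow> \<exists>d>0. \<forall>y. q (y - x) < d \<longrightarrow> norm (f y - f x) < e"
    and \<epsilon>: "0 < \<epsilon>"
  shows "\<exists>H. star_analytic T H \<and> (\<forall>x. norm (f x - H x) < \<epsilon>)"
proof -
  obtain Q C D where C: "0 \<le> C" and Q: "\<And>x. 0 \<le> Q x"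
    "\<And>z. germ 1 (C * (1 + q z) ^ D) (\<lambda>h. complex_of_real (Q (z + h)))"
    "\<And>e. 0 < e \<Longrightarrow> \<exists>\<delta>>0. \<forall>x. q x < \<delta> \<longrightarrow> Q x < e"
    "\<And>r. 0 < r \<Longrightarrow> \<exists>c>0. \<forall>x. Q x < c \<longrightarrow> q x < r"
    using separating_real_polynomial[OF P] by blast
  have top: "topspace T = UNIV" using T by (simp add: complex_vector_topology_def)
  obtain S where S: "countable S" "T closure_of S = UNIV"
    using sep unfolding separable_topology_def top by blast
  have dense: "\<exists>d\<in>S. q (d - z) < r" if "0 < r" for z r
  proof -
    have "z \<in> T closure_of S" using S by simp
    then have "\<exists>y\<in>S. y \<in> {y. q (y - z) < r}"
      using openin_q_ball[OF T q, of z r] that unfolding in_closure_of by (auto dest!: spec[of _ "{y. q (y - z) < r}"])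
    then show ?thesis by blast
  qed
  \<comment> \<open>The pairs of a centre from the dense set and a level such that \<open>f\<close> is nearly constant on
    the corresponding sublevel set.\<close>
  define A where "A = {(d, l). d \<in> S \<and> (\<exists>w. \<forall>x. Q (x - d) < 4 / 2 ^ l \<longrightarrow> norm (f x - w) \<le> \<epsilon> / 2)}"
  have A_cover: "\<exists>(d, l)\<in>A. Q (z - d) < 1 / 2 ^ l" for z
  proof -
    obtain r where r: "0 < r" "\<And>y. q (y - z) < r \<Longrightarrow> norm (f y - f z) < \<epsilon> / 2"
      using f[of "\<epsilon> / 2" z] \<epsilon> by auto
    obtain c where c: "0 < c" "\<And>x. Q x < c \<Longrightarrow> q x < r / 2"
      using Q(4)[of "r / 2"] r by auto
    obtain l where l: "4 / 2 ^ l < c"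
      using real_arch_pow_inv[of "c / 4" "1/2"] c by (auto simp: power_one_over field_simps)
    obtain \<delta> where \<delta>: "0 < \<delta>" "\<And>x. q x < \<delta> \<Longrightarrow> Q x < 1 / 2 ^ l"
      using Q(3)[of "1 / 2 ^ l"] by auto
    obtain d where d: "d \<in> S" "q (d - z) < min \<delta> (r / 2)"
      using dense[of "min \<delta> (r / 2)" z] \<delta> r by auto
    have "norm (f x - f z) \<le> \<epsilon> / 2" if "Q (x - d) < 4 / 2 ^ l" for x
    proof -
      have "q (x - d) < r / 2" using that l by (intro c) linarith
      then have "q (x - z) < r" using q_triangle_diff[of x z d] d(2) by linarith
      then show ?thesis using r(2) by (simp add: less_imp_le)
    qed
    then have "(d, l) \<in> A" using d unfolding A_def by blast
    moreover have "Q (z - d) < 1 / 2 ^ l" using d(2) by (intro \<delta>) (simp add: q_minus_commute)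
    ultimately show ?thesis by blast
  qed
  have "A \<noteq> {}" using A_cover by blast
  have "A \<subseteq> S \<times> UNIV" by (auto simp: A_def)
  then have "countable A" using S(1) by (rule countable_subset[OF _ countable_SIGMA]) auto
  define a where "a = from_nat_into A"
  have range_a: "range a = A"
    unfolding a_def by (rule range_from_nat_into[OF \<open>A \<noteq> {}\<close> \<open>countable A\<close>])
  define \<alpha> where "\<alpha> j = 1 / (2 ^ j * (1 + q (fst (a j))) ^ D)" for j
  define u where "u j x = \<alpha> j * Q (x - fst (a j))" for j x
  define \<sigma> where "\<sigma> j = \<alpha> j * (1 / 2 ^ snd (a j))" for j
  have \<alpha>: "0 < \<alpha> j" for j unfolding \<alpha>_def using q_nonneg[of "fst (a j)"]
    by (intro divide_pos_pos mult_pos_pos zero_less_power add_pos_nonneg) auto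
  have "\<forall>j. \<exists>w. \<forall>x. Q (x - fst (a j)) < 4 / 2 ^ snd (a j) \<longrightarrow> norm (f x - w) \<le> \<epsilon> / 2"
  proof
    fix j
    have "a j \<in> A" using range_a by blast
    then show "\<exists>w. \<forall>x. Q (x - fst (a j)) < 4 / 2 ^ snd (a j) \<longrightarrow> norm (f x - w) \<le> \<epsilon> / 2"
      by (simp add: A_def case_prod_unfold)
  qed
  then obtain v where v: "\<And>j x. Q (x - fst (a j)) < 4 / 2 ^ snd (a j) \<Longrightarrow> norm (f x - v j) \<le> \<epsilon> / 2"
    by metis
  interpret approximation q u \<sigma> f v \<epsilon>
  proof
    show "0 < \<epsilon>" by (rule \<epsilon>)
    show "0 < \<sigma> j" for j using \<alpha> by (simp add: \<sigma>_def)
    show "0 \<le> u j x" for j x using \<alpha>[of j] Q(1) by (simp add: u_def)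
    show "\<exists>j. u j x < \<sigma> j" for x
    proof -
      obtain d l where dl: "(d, l) \<in> A" "Q (x - d) < 1 / 2 ^ l" using A_cover by blast
      then obtain j where "a j = (d, l)" using range_a by (metis imageE)
      then have "u j x < \<sigma> j" unfolding u_def \<sigma>_def using dl \<alpha> by (intro mult_strict_left_mono) auto
      then show ?thesis ..
    qed
    show "norm (f x - v j) \<le> \<epsilon> / 2" if "u j x < 4 * \<sigma> j" for j x
    proof (rule v)
      have "\<alpha> j * Q (x - fst (a j)) < \<alpha> j * (4 / 2 ^ snd (a j))"
        using that by (simp add: u_def \<sigma>_def mult.commute)
      then show "Q (x - fst (a j)) < 4 / 2 ^ snd (a j)"
        using \<alpha>[of j] by (simp only: mult_less_cancel_left_pos)
    qed
    show "\<exists>K\<ge>0. \<forall>j \<delta>. 0 < \<delta> \<longrightarrow> \<delta> \<le> 1 \<longrightarrow>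
      germ \<delta> (\<delta> * K / 2 ^ j) (\<lambda>h. complex_of_real (u j (x + h) - u j x))" for x
    proof (intro exI conjI allI impI)
      show "0 \<le> C * (1 + q x) ^ D" using C by simp
      fix j and \<delta> :: real assume \<delta>: "0 < \<delta>" "\<delta> \<le> 1"
      define p where "p = fst (a j)"
      have "germ \<delta> (\<delta> / 1 * (C * (1 + q (x - p)) ^ D))
          (\<lambda>h. complex_of_real (Q (x - p + h)) - complex_of_real (Q (x - p + 0)))"
        by (rule germ_recentre[OF Q(2) \<delta>])
      from germ_cmult[OF \<delta>(1) this, of "complex_of_real (\<alpha> j)"]
      have "germ \<delta> (\<alpha> j * (\<delta> * (C * (1 + q (x - p)) ^ D)))
          (\<lambda>h. complex_of_real (u j (x + h) - u j x))"
        using \<alpha>[of j] by (simp add: u_def p_def algebra_simps)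
      moreover have "\<alpha> j * (\<delta> * (C * (1 + q (x - p)) ^ D)) \<le> \<delta> * (C * (1 + q x) ^ D) / 2 ^ j"
      proof -
        have "q (x - p) \<le> q x + q p" using q_triangle[of x "- p"] by simp
        then have "1 + q (x - p) \<le> (1 + q x) * (1 + q p)"
          using mult_nonneg_nonneg[OF q_nonneg[of x] q_nonneg[of p]]
          unfolding distrib_left distrib_right by linarith
        then have "(1 + q (x - p)) ^ D \<le> ((1 + q x) * (1 + q p)) ^ D"
          by (intro power_mono) auto
        then have "\<alpha> j * (\<delta> * (C * (1 + q (x - p)) ^ D)) \<le> \<alpha> j * (\<delta> * (C * ((1 + q x) ^ D * (1 + q p) ^ D)))"
          using \<alpha>[of j] \<delta> C by (intro mult_left_mono) (auto simp: power_mult_distrib)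
        also have "\<dots> = \<delta> * (C * (1 + q x) ^ D) / 2 ^ j"
        proof -
          have "1 + q p \<noteq> 0" using q_nonneg[of p] by linarith
          then show ?thesis by (simp add: \<alpha>_def p_def)
        qed
        finally show ?thesis .
      qed
      ultimately show "germ \<delta> (\<delta> * (C * (1 + q x) ^ D) / 2 ^ j) (\<lambda>h. complex_of_real (u j (x + h) - u j x))"
        by (rule germ_mono)
    qed
  qed
  have "star_analytic T approximant"
    by (rule star_analytic_of_germs[OF T q approximant_germ])
  then show ?thesis using approximant_close by blast
qed

text \<open>Alternating between \<open>x\<close> and points near \<open>x\<close> at which \<open>f\<close> differs from \<open>f x\<close> gives a Cauchy
  sequence with divergent values.\<close>

lemma continuous_of_Cauchy_to_convergent:
  fixes f :: "'x \<Rightarrow> 'y::real_normed_vector"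
  assumes f: "\<And>x. Metric_space.MCauchy UNIV (norm_dist q) x \<Longrightarrow> convergent (\<lambda>m. f (x m))"
    and e: "0 < e"
  shows "\<exists>d>0. \<forall>y. q (y - x) < d \<longrightarrow> norm (f y - f x) < e"
proof (rule ccontr)
  assume "\<not> ?thesis"
  then have "\<forall>m. \<exists>y. q (y - x) < 1 / real (Suc m) \<and> e \<le> norm (f y - f x)"
    by (metis not_less zero_less_divide_1_iff of_nat_0_less_iff zero_less_Suc)
  then obtain y where y: "\<And>m. q (y m - x) < 1 / real (Suc m)" "\<And>m. e \<le> norm (f (y m) - f x)"
    by metis
  define s where "s m = (if even m then x else y m)" for m
  have s: "q (s m - x) < 1 / real (Suc m)" for m using y by (simp add: s_def)
  interpret Metric_space UNIV "norm_dist q"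
    by (rule Metric_space_norm_dist[OF is_norm])
  have "MCauchy s"
    unfolding MCauchy_def
  proof (intro conjI allI impI)
    fix r :: real assume r: "0 < r"
    obtain M where M: "1 / real (Suc M) < r / 2"
      using nat_approx_posE[of "r / 2"] r by auto
    have "q (s n - x) < r / 2" if "M \<le> n" for n
    proof -
      have "1 / real (Suc n) \<le> 1 / real (Suc M)" using that by (simp add: field_simps)
      then show ?thesis using s[of n] M by linarith
    qed
    then have "norm_dist q (s n) (s n') < r" if "M \<le> n" "M \<le> n'" for n n'
      using q_triangle_diff[of "s n" "s n'" x] that q_minus_commute[of x "s n'"]
      unfolding norm_dist_def by (smt (verit) field_sum_of_halves)
    then show "\<exists>M. \<forall>n n'. M \<le> n \<longrightarrow> M \<le> n' \<longrightarrow> norm_dist q (s n) (s n') < r" by blast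
  qed simp
  then have "Cauchy (\<lambda>m. f (s m))" by (intro convergent_Cauchy f)
  then obtain M where "\<And>m n. M \<le> m \<Longrightarrow> M \<le> n \<Longrightarrow> norm (f (s m) - f (s n)) < e"
    using e unfolding Cauchy_iff by blast
  from this[of "Suc (2 * M)" "2 * M"] y(2)[of "Suc (2 * M)"] show False
    by (simp add: s_def)
qed

end

theorem mainTheorem3:
  fixes T :: "'x::complex_vector topology"
    and p :: "nat \<Rightarrow> 'x \<Rightarrow> real"
    and f :: "'x \<Rightarrow> 'y::complex_banach"
  assumes "frechet_topology T"
    and "separable_topology T"
    and "topology_given_by_norms T p"
    and "\<And>n. \<exists>P. separating_star_polynomial (p n) P"
    and "\<exists>k. \<forall>x. Metric_space.MCauchy UNIV (norm_dist (p k)) x \<longrightarrow> convergent (\<lambda>m. f (x m))"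
  shows "\<forall>\<epsilon>>0. \<exists>H :: 'x \<Rightarrow> 'y. star_analytic T H \<and> (\<forall>x. norm (f x - H x) < \<epsilon>)"
proof (intro allI impI)
  fix \<epsilon> :: real assume "0 < \<epsilon>"
  obtain k where k: "\<And>x. Metric_space.MCauchy UNIV (norm_dist (p k)) x \<Longrightarrow> convergent (\<lambda>m. f (x m))"
    using assms(5) by blast
  obtain P where P: "separating_star_polynomial (p k) P" using assms(4) by blast
  interpret normed_by "p k"
    using assms(3) by unfold_locales (simp add: topology_given_by_norms_def)
  show "\<exists>H :: 'x \<Rightarrow> 'y. star_analytic T H \<and> (\<forall>x. norm (f x - H x) < \<epsilon>)"
  proof (rule star_analytic_approximation)
    show "complex_vector_topology T"
      using assms(1) by (simp add: frechet_topology_def)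
    show "continuous_map T euclideanreal (p k)"
      using assms(3) by (simp add: topology_given_by_norms_def)
    show "\<exists>d>0. \<forall>y. p k (y - x) < d \<longrightarrow> norm (f y - f x) < e" if "0 < e" for x e
      by (rule continuous_of_Cauchy_to_convergent[OF k that])
  qed fact+
qed

end
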